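(* Let $\Delta_u(d,n)$ denote the maximum diameter of the graph of a $d$-dimensional polyhedron with $n$ facets. For $n \geq d \geq 3$, \[ \Delta_u(d,n) \leq (n-3)\binom{\lfloor \log \frac n{4}\rfloor+d-3}{\lfloor \log \frac n{4}\rfloor}. \]
   Context: A polyhedron is the intersection of finitely many closed halfspaces; $d$ is the dimension of its affine span and $n$ the number of its facets. The diameter is the maximum over pairs of vertices of the edge-distance in the graph (1-skeleton). All logarithms are base $2$. *)

theory Defs
  imports "HOL-Analysis.Analysis" "HOL-Library.Extended_Nat"
begin

definition vertices_of :: "'a::euclidean_space set \<Rightarrow> 'a set" where
  "vertices_of P = {v. v extreme_point_of P}"

(* Unbounded edges (rays, lines) join no two vertices, so they contribute nothing to the graph. *)
definition edge_rel :: "'a::euclidean_space set \<Rightarrow> ('a \<times> 'a) set" where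
  "edge_rel P = {(u, v). u \<in> vertices_of P \<and> v \<in> vertices_of P \<and> closed_segment u v edge_of P}"

(* Values are extended naturals: the distance of vertices not joined by any path is \<infinity>,
   and so is the supremum of an unbounded set. No finiteness or connectedness is built in:
   a finite bound on a supremum below says that the distances are finite and bounded. *)
definition graph_dist :: "'a::euclidean_space set \<Rightarrow> 'a \<Rightarrow> 'a \<Rightarrow> enat" where
  "graph_dist P u v = (INF k \<in> {k. (u, v) \<in> edge_rel P ^^ k}. enat k)"

definition graph_diameter :: "'a::euclidean_space set \<Rightarrow> enat" where
  "graph_diameter P = (SUP (u, v) \<in> vertices_of P \<times> vertices_of P. graph_dist P u v)"

(* The polyhedra range over those lying in the Euclidean space 'a, whose dimension may exceed d.
   A nonempty set of extended naturals with finite supremum attains it, so this is then a maximum;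
   polyhedra without vertices contribute 0. *)
definition Delta_u :: "'a::euclidean_space itself \<Rightarrow> nat \<Rightarrow> nat \<Rightarrow> enat" where
  "Delta_u _ d n =
     (SUP P \<in> {P :: 'a set. polyhedron P \<and> aff_dim P = int d \<and> card {F. F facet_of P} = n}.
        graph_diameter P)"

end

(* For d > 3 the bound follows by induction. Two vertices on a common facet are joined inside this
   facet. Otherwise there are at least 2d >= 8 facets, and the recursion of Kalai and Kleitman,
   D(d,n) <= D(d-1,n-1) + 2 D(d,n/2) + 2, applies.

   The base of the induction is Klee's bound n - 3 in dimension 3. Project the polyhedron to a plane
   in which the two vertices u and v lie on the boundary of the shadow, in such a way that no facet
   is vertical. The shadow boundary from u to v is a chain of vertices, and a facet containing two
   of them covers a chord of the shadow. Chords of different facets on the same side of the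
   polyhedron do not cross. From a chain vertex, walk on the facet that reaches farthest along the
   chain until a chain vertex on a facet reaching still farther is met, and continue there. Since
   chords do not cross, every step reaches a facet that the walk has not met before. The walk starts
   at a vertex in at least 3 facets, hence it has at most n - 3 steps. *)

theory Submission
  imports Defs
begin

section \<open>Faces, optimal faces and vertices of polyhedra\<close>

text \<open>Nothing is assumed bounded, simple or full-dimensional. Finite distances therefore need
  a proof that the graph is connected; it comes from deforming one linear objective into another and
  following the optimal vertices. The same deformation produces the chain of the shadow. The
  delicate point in dimension 3 is that a facet may touch the walk at places far apart. Following
  the chain vertex by vertex could return to an old facet, and the inner vertices of a section need
  not lie on the chain at all. The caps localise them: a facet on the side of the current one cannot
  cross its chord without containing both ends, and a facet on the other side meets the current one
  inside the cap only in chain vertices. The form of the bound fits the recursion. In dimension 3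
  the binomial is 1. Lowering the dimension and halving \<open>n\<close>, which lowers the logarithm
  by at least one, give the two summands of Pascal's rule, and the 3 subtracted in the linear factor
  pays for the additive 2.\<close>

definition optimal_face :: "'a::euclidean_space set \<Rightarrow> 'a \<Rightarrow> 'a set" where
  "optimal_face P c = {x \<in> P. \<forall>y\<in>P. c \<bullet> y \<le> c \<bullet> x}"

lemma optimal_faceI: "x \<in> P \<Longrightarrow> (\<And>y. y \<in> P \<Longrightarrow> c \<bullet> y \<le> c \<bullet> x) \<Longrightarrow> x \<in> optimal_face P c"
  by (auto simp: optimal_face_def)

lemma optimal_faceD: "x \<in> optimal_face P c \<Longrightarrow> y \<in> P \<Longrightarrow> c \<bullet> y \<le> c \<bullet> x"
  by (auto simp: optimal_face_def)

lemma optimal_face_subset: "optimal_face P c \<subseteq> P"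
  by (auto simp: optimal_face_def)

lemma optimal_face_eqD:
  "x \<in> optimal_face P c \<Longrightarrow> y \<in> optimal_face P c \<Longrightarrow> c \<bullet> x = c \<bullet> y"
  by (force simp: optimal_face_def)

lemma optimal_face_scale: "0 < r \<Longrightarrow> optimal_face P (r *\<^sub>R c) = optimal_face P c"
  by (auto simp: optimal_face_def)

lemma optimal_face_eq_Int:
  assumes "x \<in> optimal_face P c"
  shows "optimal_face P c = P \<inter> {y. c \<bullet> y = c \<bullet> x}"
  using assms by (force simp: optimal_face_def)

lemma optimal_face_face_of:
  assumes "convex P"
  shows "optimal_face P c face_of P"
proof (cases "optimal_face P c = {}")
  case False
  then obtain x where x: "x \<in> optimal_face P c"
    by blast
  show ?thesis
    unfolding optimal_face_eq_Int [OF x]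
    by (rule face_of_Int_supporting_hyperplane_le [OF assms]) (use x in \<open>auto simp: optimal_face_def\<close>)
qed simp

lemma optimal_face_combination:
  assumes "x \<in> optimal_face P c" "x \<in> optimal_face P d" "0 < r" "0 < s"
  shows "optimal_face P (r *\<^sub>R c + s *\<^sub>R d) = optimal_face P c \<inter> optimal_face P d"
proof (intro set_eqI iffI)
  fix y assume y: "y \<in> optimal_face P (r *\<^sub>R c + s *\<^sub>R d)"
  have yP: "y \<in> P" and xP: "x \<in> P"
    using y assms(1) by (auto simp: optimal_face_def)
  have "c \<bullet> y \<le> c \<bullet> x" "d \<bullet> y \<le> d \<bullet> x"
    using assms yP by (auto simp: optimal_face_def)
  moreover have "r * (c \<bullet> x) + s * (d \<bullet> x) \<le> r * (c \<bullet> y) + s * (d \<bullet> y)"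
    using y xP by (auto simp: optimal_face_def inner_left_distrib)
  ultimately have "c \<bullet> y = c \<bullet> x" "d \<bullet> y = d \<bullet> x"
    using \<open>0 < r\<close> \<open>0 < s\<close>
    by (smt (verit, best) mult_less_cancel_left_pos)+
  then show "y \<in> optimal_face P c \<inter> optimal_face P d"
    using assms yP by (auto simp: optimal_face_def)
next
  fix y assume "y \<in> optimal_face P c \<inter> optimal_face P d"
  then show "y \<in> optimal_face P (r *\<^sub>R c + s *\<^sub>R d)"
    using assms by (auto simp: optimal_face_def inner_left_distrib intro!: add_mono)
qed

text \<open>On a segment from a relative interior point to a point outside \<open>P\<close>, within
  the affine hull, the last point of \<open>P\<close> lies in a facet. The inequality of this facet
  is strict at the start and tight at the exit, so it fails at the end. Hence one inequality per
  facet describes \<open>P\<close> inside its affine hull.\<close>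

lemma polyhedron_facet_halfspaces:
  fixes P :: "'a::euclidean_space set"
  assumes "polyhedron P"
  obtains a b where
    "\<And>F. F facet_of P \<Longrightarrow> a F \<noteq> 0"
    "\<And>x. x \<in> P \<longleftrightarrow> x \<in> affine hull P \<and> (\<forall>F. F facet_of P \<longrightarrow> a F \<bullet> x \<le> b F)"
    "\<And>F. F facet_of P \<Longrightarrow> F = P \<inter> {x. a F \<bullet> x = b F}"
proof -
  obtain H where "finite H" and seq: "P = affine hull P \<inter> \<Inter>H"
             and faces: "\<And>h. h \<in> H \<Longrightarrow> \<exists>a b. a \<noteq> 0 \<and> h = {x. a \<bullet> x \<le> b}"
             and min: "\<And>H'. H' \<subset> H \<Longrightarrow> P \<subset> (affine hull P) \<inter> \<Inter>H'"
    using assms by (simp add: polyhedron_Int_affine_minimal) meson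
  then obtain a b where ab: "\<And>h. h \<in> H \<Longrightarrow> a h \<noteq> 0 \<and> h = {x. a h \<bullet> x \<le> b h}"
    by metis
  note fac = facet_of_polyhedron_explicit [OF \<open>finite H\<close> seq ab min]
  define h where "h F = (SOME h. h \<in> H \<and> F = P \<inter> {x. a h \<bullet> x = b h})" for F
  have h: "h F \<in> H \<and> F = P \<inter> {x. a (h F) \<bullet> x = b (h F)}" if "F facet_of P" for F
    unfolding h_def by (rule someI_ex) (use fac that in blast)
  have sub: "P \<subseteq> {x \<in> affine hull P. \<forall>F. F facet_of P \<longrightarrow> a (h F) \<bullet> x \<le> b (h F)}"
    using ab h by (subst seq) blast
  have sup: "x \<in> P" if x: "x \<in> affine hull P" "\<forall>F. F facet_of P \<longrightarrow> a (h F) \<bullet> x \<le> b (h F)" for x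
  proof (rule ccontr)
    assume "x \<notin> P"
    have "P \<noteq> {}"
      using x(1) by auto
    then obtain z where z: "z \<in> rel_interior P"
      using assms polyhedron_imp_convex rel_interior_eq_empty by blast
    then have "z \<in> P"
      using rel_interior_subset by blast
    let ?S = "{t. 0 \<le> t \<and> t \<le> (1::real) \<and> z + t *\<^sub>R (x - z) \<in> P}"
    have "closed ?S"
    proof -
      have "closed ({0..1} \<inter> (\<lambda>t. z + t *\<^sub>R (x - z)) -` P)"
        by (intro continuous_closed_preimage continuous_intros)
          (use assms polyhedron_imp_closed in auto)
      moreover have "{0..1} \<inter> (\<lambda>t. z + t *\<^sub>R (x - z)) -` P = ?S"
        by auto
      ultimately show ?thesis by simp
    qed
    moreover have "bounded ?S"
      by (rule bounded_subset [of "{0..1}"]) auto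
    ultimately have "compact ?S"
      by (simp add: compact_eq_bounded_closed)
    moreover have "0 \<in> ?S"
      using \<open>z \<in> P\<close> by simp
    ultimately obtain t where t: "t \<in> ?S" and tmax: "\<And>s. s \<in> ?S \<Longrightarrow> s \<le> t"
      using compact_attains_sup [of ?S] by blast
    have "t < 1"
      using t \<open>x \<notin> P\<close> by (cases "t = 1") auto
    let ?y = "z + t *\<^sub>R (x - z)"
    have "?y \<in> P"
      using t by simp
    have "?y \<notin> rel_interior P"
    proof
      assume "?y \<in> rel_interior P"
      then obtain e where "e > 0" and e: "ball ?y e \<inter> affine hull P \<subseteq> P"
        by (auto simp: mem_rel_interior_ball)
      \<comment> \<open>Small enough to stay before time 1 and within distance \<open>e\<close> of
        the exit point; the summand 1 keeps the denominator positive.\<close>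
      define s where "s = min (1 - t) (e / (2 * (norm (x - z) + 1)))"
      have "s > 0"
        using \<open>t < 1\<close> \<open>e > 0\<close> by (auto simp: s_def intro!: divide_pos_pos add_nonneg_pos)
      have "s * norm (x - z) \<le> e / (2 * (norm (x - z) + 1)) * norm (x - z)"
        by (intro mult_right_mono) (auto simp: s_def)
      also have "\<dots> \<le> e / 2"
        using \<open>e > 0\<close> by (simp add: divide_simps add_nonneg_pos)
      finally have "norm (s *\<^sub>R (x - z)) < e"
        using \<open>s > 0\<close> \<open>e > 0\<close> by simp
      moreover have "z + (t + s) *\<^sub>R (x - z) \<in> affine hull P"
      proof -
        have "z \<in> affine hull P"
          using \<open>z \<in> P\<close> hull_inc by metis
        then have "(1 - (t + s)) *\<^sub>R z + (t + s) *\<^sub>R x \<in> affine hull P"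
          using x(1) affine_affine_hull [of P] unfolding affine_alt by blast
        then show ?thesis
          by (simp add: algebra_simps)
      qed
      moreover have "z + (t + s) *\<^sub>R (x - z) = ?y + s *\<^sub>R (x - z)"
        by (simp add: scaleR_add_left)
      moreover have "dist ?y (?y + s *\<^sub>R (x - z)) = norm (s *\<^sub>R (x - z))"
        by (simp only: dist_add_cancel dist_norm norm_minus_cancel [symmetric, of "s *\<^sub>R (x - z)"]) simp
      ultimately have "z + (t + s) *\<^sub>R (x - z) \<in> P"
        using e by (metis IntI mem_ball subsetD)
      then have "t + s \<in> ?S"
        using t \<open>s > 0\<close> by (auto simp: s_def)
      then show False
        using tmax [of "t + s"] \<open>s > 0\<close> by simp
    qed
    then obtain F where F: "F facet_of P" "?y \<in> F"
      using \<open>?y \<in> P\<close> rel_boundary_of_polyhedron [OF assms] by blast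
    have "z \<notin> F"
      using z F(1) by (metis assms rel_boundary_of_polyhedron DiffD2 UnionI mem_Collect_eq)
    then have "a (h F) \<bullet> z < b (h F)"
      using h [OF F(1)] sub \<open>z \<in> P\<close> F(1) by force
    moreover have "a (h F) \<bullet> x \<le> b (h F)"
      using x(2) F(1) by blast
    moreover have "a (h F) \<bullet> ?y = b (h F)"
      using F h by blast
    then have "(1 - t) * (a (h F) \<bullet> z) + t * (a (h F) \<bullet> x) = b (h F)"
      by (simp add: inner_simps algebra_simps)
    moreover have "0 \<le> t"
      using t by simp
    moreover have "(1 - t) * (a (h F) \<bullet> z) < (1 - t) * b (h F)"
      using \<open>t < 1\<close> \<open>a (h F) \<bullet> z < b (h F)\<close> by (intro mult_strict_left_mono) auto
    moreover have "t * (a (h F) \<bullet> x) \<le> t * b (h F)"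
      using t \<open>a (h F) \<bullet> x \<le> b (h F)\<close> by (intro mult_left_mono) auto
    ultimately show False
      by (simp add: algebra_simps)
  qed
  show thesis
  proof
    show "a (h F) \<noteq> 0" if "F facet_of P" for F
      using h [OF that] ab by blast
    show "x \<in> P \<longleftrightarrow> x \<in> affine hull P \<and> (\<forall>F. F facet_of P \<longrightarrow> a (h F) \<bullet> x \<le> b (h F))" for x
      using sub sup by blast
    show "F = P \<inter> {x. a (h F) \<bullet> x = b (h F)}" if "F facet_of P" for F
      using h [OF that] by blast
  qed
qed


text \<open>Some choice of a halfspace for every facet; the values on sets that are not facets are junk.\<close>

definition facet_halfspaces :: "'a::euclidean_space set \<Rightarrow> ('a set \<Rightarrow> 'a) \<times> ('a set \<Rightarrow> real)" where
  "facet_halfspaces P = (SOME (a, b). (\<forall>F. F facet_of P \<longrightarrow> a F \<noteq> 0) \<and>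
     (\<forall>x. x \<in> P \<longleftrightarrow> x \<in> affine hull P \<and> (\<forall>F. F facet_of P \<longrightarrow> a F \<bullet> x \<le> b F)) \<and>
     (\<forall>F. F facet_of P \<longrightarrow> F = P \<inter> {x. a F \<bullet> x = b F}))"

definition facet_normal :: "'a::euclidean_space set \<Rightarrow> 'a set \<Rightarrow> 'a" where
  "facet_normal P = fst (facet_halfspaces P)"

definition facet_level :: "'a::euclidean_space set \<Rightarrow> 'a set \<Rightarrow> real" where
  "facet_level P = snd (facet_halfspaces P)"

lemma
  fixes P :: "'a::euclidean_space set"
  assumes "polyhedron P"
  shows facet_normal_nonzero: "F facet_of P \<Longrightarrow> facet_normal P F \<noteq> 0"
    and mem_polyhedron_iff: "x \<in> P \<longleftrightarrow>
      x \<in> affine hull P \<and> (\<forall>F. F facet_of P \<longrightarrow> facet_normal P F \<bullet> x \<le> facet_level P F)"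
    and facet_eq: "F facet_of P \<Longrightarrow> F = P \<inter> {x. facet_normal P F \<bullet> x = facet_level P F}"
proof -
  have "\<exists>ab. case ab of (a, b) \<Rightarrow> (\<forall>F. F facet_of P \<longrightarrow> a F \<noteq> 0) \<and>
     (\<forall>x. x \<in> P \<longleftrightarrow> x \<in> affine hull P \<and> (\<forall>F. F facet_of P \<longrightarrow> a F \<bullet> x \<le> b F)) \<and>
     (\<forall>F. F facet_of P \<longrightarrow> F = P \<inter> {x. a F \<bullet> x = b F})"
  proof (rule polyhedron_facet_halfspaces [OF assms])
    fix a b
    assume "\<And>F. F facet_of P \<Longrightarrow> a F \<noteq> 0"
      "\<And>x. x \<in> P \<longleftrightarrow> x \<in> affine hull P \<and> (\<forall>F. F facet_of P \<longrightarrow> a F \<bullet> x \<le> (b F :: real))"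
      "\<And>F. F facet_of P \<Longrightarrow> F = P \<inter> {x. a F \<bullet> x = b F}"
    then show ?thesis
      by (intro exI [of _ "(a, b)"] case_prodI conjI allI impI) assumption+
  qed
  from someI_ex [OF this]
  have *: "(\<forall>F. F facet_of P \<longrightarrow> facet_normal P F \<noteq> 0) \<and>
     (\<forall>x. x \<in> P \<longleftrightarrow>
      x \<in> affine hull P \<and> (\<forall>F. F facet_of P \<longrightarrow> facet_normal P F \<bullet> x \<le> facet_level P F)) \<and>
     (\<forall>F. F facet_of P \<longrightarrow> F = P \<inter> {x. facet_normal P F \<bullet> x = facet_level P F})"
    unfolding facet_normal_def facet_level_def facet_halfspaces_def case_prod_beta .
  show "F facet_of P \<Longrightarrow> facet_normal P F \<noteq> 0"
    using * by simp
  show "x \<in> P \<longleftrightarrow>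
      x \<in> affine hull P \<and> (\<forall>F. F facet_of P \<longrightarrow> facet_normal P F \<bullet> x \<le> facet_level P F)"
    using * by (elim conjE) (erule spec)
  show "F facet_of P \<Longrightarrow> F = P \<inter> {x. facet_normal P F \<bullet> x = facet_level P F}"
    by (rule * [THEN conjunct2, THEN conjunct2, THEN spec, THEN mp])
qed

lemma facet_normal_le:
  assumes "polyhedron P" "F facet_of P" "x \<in> P"
  shows "facet_normal P F \<bullet> x \<le> facet_level P F"
  using assms mem_polyhedron_iff [OF assms(1), of x] by simp

lemma mem_facet_iff:
  assumes "polyhedron P" "F facet_of P"
  shows "x \<in> F \<longleftrightarrow> x \<in> P \<and> facet_normal P F \<bullet> x = facet_level P F"
  by (subst facet_eq [OF assms]) simp

lemma facet_normal_eq: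
  assumes "polyhedron P" "F facet_of P" "x \<in> F"
  shows "facet_normal P F \<bullet> x = facet_level P F"
  using assms mem_facet_iff [OF assms(1,2)] by simp

lemma mem_polyhedronI:
  assumes "polyhedron P" "x \<in> affine hull P"
    and "\<And>F. F facet_of P \<Longrightarrow> facet_normal P F \<bullet> x \<le> facet_level P F"
  shows "x \<in> P"
  using assms mem_polyhedron_iff [OF assms(1), of x] by simp

lemma mem_facetI:
  assumes "polyhedron P" "F facet_of P" "x \<in> P" "facet_normal P F \<bullet> x = facet_level P F"
  shows "x \<in> F"
  using assms mem_facet_iff [OF assms(1,2)] by simp

lemma facet_eq_optimal_face:
  assumes P: "polyhedron P" and F: "F facet_of P"
  shows "optimal_face P (facet_normal P F) = F"
proof -
  obtain x where "x \<in> F"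
    using F by (auto simp: facet_of_def)
  then have "x \<in> optimal_face P (facet_normal P F)"
    using facet_normal_le [OF P F] facet_normal_eq [OF P F] facet_of_imp_subset [OF F]
    by (auto intro!: optimal_faceI)
  then show ?thesis
    using facet_normal_eq [OF P F \<open>x \<in> F\<close>] mem_facet_iff [OF P F]
      optimal_face_eq_Int [of x P "facet_normal P F"] by auto
qed

section \<open>Rays, lines and the existence of vertices\<close>

lemma mem_affine_hull_direction:
  fixes P :: "'a::euclidean_space set"
  assumes "x \<in> affine hull P" "x + z \<in> affine hull P" "y \<in> affine hull P"
  shows "y + t *\<^sub>R z \<in> affine hull P"
  using mem_affine_3_minus [OF affine_affine_hull assms(3,2,1), of t] by simp

lemma finite_arg_max:
  fixes f :: "'b \<Rightarrow> real"
  assumes "finite S" "S \<noteq> {}"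
  shows "\<exists>p\<in>S. \<forall>q\<in>S. f q \<le> f p"
proof -
  have "Max (f ` S) \<in> f ` S"
    using assms by simp
  then show ?thesis
    using assms by (metis (no_types, lifting) Max_ge finite_imageI imageE imageI)
qed

text \<open>This is the ratio test of the simplex method: only facets whose normal has positive
  product with \<open>z\<close> block the ray, and the first of them to become tight gives the exit.
  Without such facets the whole ray would stay in \<open>P\<close>.\<close>

lemma exit_through_facet:
  fixes P :: "'a::euclidean_space set"
  assumes P: "polyhedron P" and x: "x \<in> P" "x + z \<in> affine hull P"
    and out: "0 \<le> t" "x + t *\<^sub>R z \<notin> P"
  obtains F s where "F facet_of P" "0 \<le> s" "x + s *\<^sub>R z \<in> F"
proof -
  let ?a = "facet_normal P" and ?b = "facet_level P"
  have aff: "x + s *\<^sub>R z \<in> affine hull P" for s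
    using x by (intro mem_affine_hull_direction [of x]) (auto intro: hull_inc)
  let ?S = "{F. F facet_of P \<and> 0 < ?a F \<bullet> z}"
  let ?t = "\<lambda>F. (?b F - ?a F \<bullet> x) / (?a F \<bullet> z)"
  have fin: "finite ?S"
    by (rule finite_subset [OF _ finite_polyhedron_facets [OF P]]) auto
  have ax: "?a F \<bullet> x \<le> ?b F" if "F facet_of P" for F
    using x(1) P that facet_normal_le by blast
  have "?S \<noteq> {}"
  proof
    assume "?S = {}"
    have "?a F \<bullet> (x + t *\<^sub>R z) \<le> ?b F" if "F facet_of P" for F
    proof -
      have "?a F \<bullet> z \<le> 0"
        using \<open>?S = {}\<close> that not_less by blast
      then show ?thesis
        using ax [OF that] mult_nonneg_nonpos [OF \<open>0 \<le> t\<close>] by (fastforce simp: inner_simps)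
    qed
    then show False
      using out(2) aff mem_polyhedronI [OF P] by blast
  qed
  define s where "s = Min (?t ` ?S)"
  have "s \<in> ?t ` ?S"
    unfolding s_def using fin \<open>?S \<noteq> {}\<close> by (intro Min_in) auto
  then obtain F where F: "F facet_of P" "0 < ?a F \<bullet> z" "s = ?t F"
    by blast
  have "0 \<le> s"
    using F ax by simp
  have "?a G \<bullet> (x + s *\<^sub>R z) \<le> ?b G" if G: "G facet_of P" for G
  proof (cases "0 < ?a G \<bullet> z")
    case True
    then have "s \<le> ?t G"
      unfolding s_def using fin G by (intro Min_le) auto
    then show ?thesis
      using True by (simp add: inner_simps pos_le_divide_eq)
  next
    case False
    then show ?thesis
      using ax [OF G] mult_nonneg_nonpos [OF \<open>0 \<le> s\<close>, of "?a G \<bullet> z"] by (simp add: inner_simps)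
  qed
  then have "x + s *\<^sub>R z \<in> P"
    using aff mem_polyhedronI [OF P] by blast
  moreover have "?a F \<bullet> (x + s *\<^sub>R z) = ?b F"
    using F by (simp add: inner_simps)
  ultimately have "x + s *\<^sub>R z \<in> F"
    using mem_facetI [OF P F(1)] by blast
  then show thesis
    using that F(1) \<open>0 \<le> s\<close> by blast
qed

text \<open>Induction on the dimension: a ray from \<open>x\<close> along which \<open>c\<close>
  does not decrease leaves \<open>P\<close> through a facet, which inherits the hypotheses. If
  \<open>c\<close> grows, the bound \<open>B\<close> stops the ray; if \<open>c\<close> is constant,
  one of the two opposite rays leaves because \<open>P\<close> contains no line.\<close>

lemma polyhedron_vertex_above:
  fixes P :: "'a::euclidean_space set"
  assumes "polyhedron P" "\<And>x z. z \<noteq> 0 \<Longrightarrow> \<exists>t. x + t *\<^sub>R z \<notin> P"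
    and "\<And>y. y \<in> P \<Longrightarrow> c \<bullet> y \<le> B" "x \<in> P"
  shows "\<exists>p. p extreme_point_of P \<and> c \<bullet> x \<le> c \<bullet> p"
  using assms
proof (induction "nat (aff_dim P)" arbitrary: P x rule: less_induct)
  case less
  show ?case
  proof (cases "P = {x}")
    case True
    then show ?thesis by auto
  next
    case False
    then obtain y where y: "y \<in> P" "y \<noteq> x"
      using \<open>x \<in> P\<close> by blast
    have step: ?thesis if z: "z \<noteq> 0" "x + z \<in> affine hull P" "0 \<le> c \<bullet> z" "0 \<le> t" "x + t *\<^sub>R z \<notin> P" for z t
    proof -
      obtain F s where F: "F facet_of P" "0 \<le> s" "x + s *\<^sub>R z \<in> F"
        using exit_through_facet [OF less.prems(1) \<open>x \<in> P\<close> z(2,4,5)] .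
      have "aff_dim F = aff_dim P - 1" "F \<noteq> {}"
        using F(1) unfolding facet_of_def by blast+
      then have "aff_dim F < aff_dim P" "0 \<le> aff_dim F"
        using aff_dim_negative_iff [of F] by linarith+
      then have "nat (aff_dim F) < nat (aff_dim P)"
        by simp
      have "F \<subseteq> P" "polyhedron F"
        using F(1) less.prems(1) facet_of_imp_subset facet_of_imp_face_of face_of_polyhedron_polyhedron
        by metis+
      then have "\<exists>p. p extreme_point_of F \<and> c \<bullet> (x + s *\<^sub>R z) \<le> c \<bullet> p"
        using less.hyps [OF \<open>nat (aff_dim F) < nat (aff_dim P)\<close>, of "x + s *\<^sub>R z"]
          less.prems(2,3) F(3) by (meson subsetD)
      moreover have "c \<bullet> x \<le> c \<bullet> (x + s *\<^sub>R z)"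
        using F(2) z(3) by (simp add: inner_simps)
      ultimately show ?thesis
        using extreme_point_of_face [OF facet_of_imp_face_of [OF F(1)]] by (meson order_trans)
    qed
    define z where "z = (if 0 \<le> c \<bullet> (y - x) then y - x else x - y)"
    have "z \<noteq> 0" "0 \<le> c \<bullet> z"
      using y by (auto simp: z_def inner_simps)
    have "y \<in> affine hull P" "x \<in> affine hull P"
      using y \<open>x \<in> P\<close> by (auto intro: hull_inc)
    then have zz: "x + z \<in> affine hull P" "x - z \<in> affine hull P"
      using affine_affine_hull [of P] mem_affine_3_minus [of "affine hull P" x y x 1]
        mem_affine_3_minus [of "affine hull P" x x y 1]
      by (auto simp: z_def algebra_simps)
    show ?thesis
    proof (cases "c \<bullet> z = 0")
      case True
      obtain t where t: "x + t *\<^sub>R z \<notin> P"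
        using less.prems(2) \<open>z \<noteq> 0\<close> by blast
      show ?thesis
      proof (cases "0 \<le> t")
        case True
        then show ?thesis
          using step [of z t] t \<open>z \<noteq> 0\<close> \<open>0 \<le> c \<bullet> z\<close> zz by blast
      next
        case False
        then show ?thesis
          using step [of "- z" "- t"] t \<open>z \<noteq> 0\<close> \<open>c \<bullet> z = 0\<close> zz by simp
      qed
    next
      case False
      then have "0 < c \<bullet> z"
        using \<open>0 \<le> c \<bullet> z\<close> by simp
      \<comment> \<open>At this time the objective has the value \<open>B + c \<bullet> z\<close>,
        which exceeds the bound.\<close>
      define t where "t = (B - c \<bullet> x) / (c \<bullet> z) + 1"
      have "c \<bullet> x \<le> B"
        using less.prems by blast
      then have "0 \<le> t"
        using \<open>0 < c \<bullet> z\<close> by (simp add: t_def)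
      have "c \<bullet> (x + t *\<^sub>R z) = B + c \<bullet> z"
        using \<open>0 < c \<bullet> z\<close> by (simp add: t_def inner_simps field_simps)
      then have "x + t *\<^sub>R z \<notin> P"
        using less.prems(3) [of "x + t *\<^sub>R z"] \<open>0 < c \<bullet> z\<close> by auto
      then show ?thesis
        using step [of z t] \<open>0 \<le> t\<close> \<open>z \<noteq> 0\<close> \<open>0 \<le> c \<bullet> z\<close> zz by blast
    qed
  qed
qed

text \<open>The direction of a line in \<open>P\<close> is orthogonal to every facet normal, so the
  line can be translated to \<open>v\<close>, which would then be a midpoint of two points of
  \<open>P\<close>.\<close>

lemma extreme_point_no_line:
  fixes P :: "'a::euclidean_space set"
  assumes P: "polyhedron P" and v: "v extreme_point_of P" and "z \<noteq> 0"
  shows "\<exists>t. x + t *\<^sub>R z \<notin> P"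
proof (rule ccontr)
  assume "\<nexists>t. x + t *\<^sub>R z \<notin> P"
  then have line: "x + t *\<^sub>R z \<in> P" for t
    by blast
  let ?a = "facet_normal P" and ?b = "facet_level P"
  have az: "?a F \<bullet> z = 0" if "F facet_of P" for F
  proof (rule ccontr)
    assume nz: "?a F \<bullet> z \<noteq> 0"
    let ?t = "(?b F + 1 - ?a F \<bullet> x) / (?a F \<bullet> z)"
    have "?a F \<bullet> (x + ?t *\<^sub>R z) \<le> ?b F"
      using facet_normal_le [OF P that line] .
    then show False
      using nz by (simp add: inner_simps)
  qed
  have "v \<in> P"
    using v by (simp add: extreme_point_of_def)
  have "v + s *\<^sub>R z \<in> P" for s
  proof (rule mem_polyhedronI [OF P])
    show "v + s *\<^sub>R z \<in> affine hull P"
      using \<open>v \<in> P\<close> line [of 0] line [of 1]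
      by (intro mem_affine_hull_direction [of x]) (auto intro: hull_inc)
    show "?a F \<bullet> (v + s *\<^sub>R z) \<le> ?b F" if "F facet_of P" for F
      using az [OF that] facet_normal_le [OF P that \<open>v \<in> P\<close>] by (simp add: inner_simps)
  qed
  from this [of 1] this [of "-1"] have "v + z \<in> P" "v - z \<in> P"
    by auto
  moreover have "v \<in> open_segment (v + z) (v - z)"
  proof -
    have "v = (1 - 1/2) *\<^sub>R (v + z) + (1/2) *\<^sub>R (v - z)"
      by (simp add: scaleR_add_right scaleR_diff_right flip: scaleR_add_left)
    moreover have "v + z \<noteq> v - z"
    proof
      assume "v + z = v - z"
      then have "z + z = 0"
        by (simp add: algebra_simps)
      then have "2 *\<^sub>R z = 0"
        by (simp add: scaleR_2)
      then show False
        using \<open>z \<noteq> 0\<close> by simp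
    qed
    ultimately show ?thesis
      unfolding in_segment by (intro conjI exI [of _ "1/2"]) auto
  qed
  ultimately show False
    using v by (auto simp: extreme_point_of_def)
qed

lemma face_has_vertex:
  fixes P :: "'a::euclidean_space set"
  assumes P: "polyhedron P" and v: "v extreme_point_of P" and F: "F face_of P" "F \<noteq> {}"
  obtains p where "p extreme_point_of P" "p \<in> F"
proof -
  obtain x where "x \<in> F"
    using F by blast
  have "F \<subseteq> P" "polyhedron F"
    using F P face_of_imp_subset face_of_polyhedron_polyhedron by blast+
  then have "\<exists>p. p extreme_point_of F \<and> 0 \<bullet> x \<le> 0 \<bullet> p"
    using \<open>x \<in> F\<close> extreme_point_no_line [OF P v]
    by (intro polyhedron_vertex_above [where B = 0]) (auto, meson subsetD)
  then show thesis
    using that extreme_point_of_face [OF F(1)] by blast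
qed

lemma optimal_vertex_exists:
  fixes P :: "'a::euclidean_space set"
  assumes P: "polyhedron P" and v: "v extreme_point_of P" and bd: "\<And>y. y \<in> P \<Longrightarrow> c \<bullet> y \<le> B"
  obtains p where "p extreme_point_of P" "p \<in> optimal_face P c"
proof -
  let ?V = "{p. p extreme_point_of P}"
  have "finite ?V" "?V \<noteq> {}"
    using finite_polyhedron_extreme_points [OF P] v by auto
  then obtain p where p: "p \<in> ?V" "\<And>q. q \<in> ?V \<Longrightarrow> c \<bullet> q \<le> c \<bullet> p"
    using finite_arg_max [of ?V "\<lambda>p. c \<bullet> p"] by blast
  have "p \<in> optimal_face P c"
  proof (rule optimal_faceI)
    show "p \<in> P"
      using p by (simp add: extreme_point_of_def)
    fix y assume "y \<in> P"
    then obtain q where "q extreme_point_of P" "c \<bullet> y \<le> c \<bullet> q"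
      using polyhedron_vertex_above [OF P extreme_point_no_line [OF P v] bd] by blast
    then show "c \<bullet> y \<le> c \<bullet> p"
      using p(2) [of q] by simp
  qed
  then show thesis
    using that p by blast
qed

section \<open>Tight facets at a vertex\<close>

lemma feasible_direction:
  fixes P :: "'a::euclidean_space set"
  assumes P: "polyhedron P" and x: "x \<in> P" "x + z \<in> affine hull P"
    and le: "\<And>F. F facet_of P \<Longrightarrow> x \<in> F \<Longrightarrow> facet_normal P F \<bullet> z \<le> 0"
  obtains e where "0 < e" "\<And>t. 0 \<le> t \<Longrightarrow> t \<le> e \<Longrightarrow> x + t *\<^sub>R z \<in> P"
proof -
  let ?S = "{F. F facet_of P \<and> x \<notin> F}"
  let ?t = "\<lambda>F. (facet_level P F - facet_normal P F \<bullet> x) / (\<bar>facet_normal P F \<bullet> z\<bar> + 1)"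
  define e where "e = Min (insert 1 (?t ` ?S))"
  have fin: "finite ?S"
    by (rule finite_subset [OF _ finite_polyhedron_facets [OF P]]) auto
  have slack: "facet_normal P F \<bullet> x < facet_level P F" if "F \<in> ?S" for F
    using that facet_normal_le [OF P _ x(1)] mem_facetI [OF P _ x(1)] by force
  then have "0 < ?t F" if "F \<in> ?S" for F
    using that by (intro divide_pos_pos) auto
  then have "0 < e"
    unfolding e_def using fin by (subst Min_gr_iff) auto
  moreover have "x + t *\<^sub>R z \<in> P" if t: "0 \<le> t" "t \<le> e" for t
  proof (rule mem_polyhedronI [OF P])
    show "x + t *\<^sub>R z \<in> affine hull P"
      using x by (intro mem_affine_hull_direction [of x]) (auto intro: hull_inc)
    fix F assume F: "F facet_of P"
    show "facet_normal P F \<bullet> (x + t *\<^sub>R z) \<le> facet_level P F"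
    proof (cases "x \<in> F")
      case True
      have "t * (facet_normal P F \<bullet> z) \<le> 0"
        using le [OF F True] t by (intro mult_nonneg_nonpos)
      then show ?thesis
        using facet_normal_le [OF P F x(1)] by (simp add: inner_simps)
    next
      case False
      then have "t \<le> ?t F"
        using F t fin by (intro order_trans [OF t(2)]) (auto simp: e_def)
      then have "t * (\<bar>facet_normal P F \<bullet> z\<bar> + 1) \<le> facet_level P F - facet_normal P F \<bullet> x"
        by (subst (asm) pos_le_divide_eq) auto
      moreover have "t * (facet_normal P F \<bullet> z) \<le> t * (\<bar>facet_normal P F \<bullet> z\<bar> + 1)"
        using t by (intro mult_left_mono) auto
      ultimately show ?thesis
        by (simp add: inner_simps)
    qed
  qed
  ultimately show thesis
    using that by blast
qed

text \<open>Close to \<open>v\<close> only the facets through \<open>v\<close> restrict a movement,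
  so a direction tangent to all of them is feasible both ways. That the tight facets pin down a
  vertex is behind the facet count at a vertex, its sharpness, and its survival when other facets
  are dropped.\<close>

lemma vertex_direction_zero:
  fixes P :: "'a::euclidean_space set"
  assumes P: "polyhedron P" and v: "v extreme_point_of P" and z: "v + z \<in> affine hull P"
    and eq: "\<And>F. F facet_of P \<Longrightarrow> v \<in> F \<Longrightarrow> facet_normal P F \<bullet> z = 0"
  shows "z = 0"
proof (rule ccontr)
  assume "z \<noteq> 0"
  have "v \<in> P"
    using v by (simp add: extreme_point_of_def)
  then have "v \<in> affine hull P"
    by (rule hull_inc)
  then have z': "v + (- z) \<in> affine hull P"
    using mem_affine_hull_direction [of v P z v "-1"] z by simp
  obtain d where d: "0 < d" "\<And>t. 0 \<le> t \<Longrightarrow> t \<le> d \<Longrightarrow> v + t *\<^sub>R z \<in> P"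
    by (rule feasible_direction [OF P \<open>v \<in> P\<close> z]) (use eq in auto)
  obtain e where e: "0 < e" "\<And>t. 0 \<le> t \<Longrightarrow> t \<le> e \<Longrightarrow> v + t *\<^sub>R (- z) \<in> P"
    by (rule feasible_direction [OF P \<open>v \<in> P\<close> z']) (use eq in auto)
  let ?t = "min d e"
  have "0 < ?t"
    using d e by simp
  have "v + ?t *\<^sub>R z \<in> P" "v + ?t *\<^sub>R (- z) \<in> P"
    using d e by (auto intro: d(2) e(2))
  moreover have "v \<in> open_segment (v + ?t *\<^sub>R z) (v + ?t *\<^sub>R (- z))"
  proof -
    have "v = (1 - 1/2) *\<^sub>R (v + ?t *\<^sub>R z) + (1/2) *\<^sub>R (v + ?t *\<^sub>R (- z))"
      by (simp add: scaleR_add_right scaleR_diff_right flip: scaleR_add_left)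
    moreover have "v + ?t *\<^sub>R z \<noteq> v + ?t *\<^sub>R (- z)"
    proof
      assume "v + ?t *\<^sub>R z = v + ?t *\<^sub>R (- z)"
      then have "(2 * ?t) *\<^sub>R z = 0"
        by (simp add: scaleR_2 eq_neg_iff_add_eq_0 flip: scaleR_scaleR)
      then show False
        using \<open>z \<noteq> 0\<close> \<open>0 < ?t\<close> by auto
    qed
    ultimately show ?thesis
      unfolding in_segment by (intro conjI exI [of _ "1/2"]) auto
  qed
  ultimately show False
    using v by (auto simp: extreme_point_of_def)
qed

text \<open>With too few normals at \<open>v\<close>, these and the orthogonal complement of the
  direction space \<open>D\<close> do not span the whole space. A nonzero vector orthogonal to both
  lies in \<open>D\<close> and is tangent to all facets at \<open>v\<close>.\<close>

lemma card_facets_at_vertex: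
  fixes P :: "'a::euclidean_space set"
  assumes P: "polyhedron P" and v: "v extreme_point_of P"
  shows "aff_dim P \<le> int (card {F. F facet_of P \<and> v \<in> F})"
proof (rule ccontr)
  assume less: "\<not> aff_dim P \<le> int (card {F. F facet_of P \<and> v \<in> F})"
  let ?N = "facet_normal P ` {F. F facet_of P \<and> v \<in> F}"
  define D where "D = (\<lambda>x. x - v) ` (affine hull P)"
  have "v \<in> P"
    using v by (simp add: extreme_point_of_def)
  then have vaff: "v \<in> affine hull P"
    by (rule hull_inc)
  have subD: "subspace D"
    unfolding D_def by (rule affine_diffs_subspace_subtract [OF affine_affine_hull vaff])
  have dimD: "int (dim D) = aff_dim P"
    using aff_dim_eq_dim_subtract [of v "affine hull P"] vaff by (simp add: D_def hull_hull)
  have fin: "finite {F. F facet_of P \<and> v \<in> F}"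
    by (rule finite_subset [OF _ finite_polyhedron_facets [OF P]]) auto
  have "dim ?N \<le> card {F. F facet_of P \<and> v \<in> F}"
    using fin by (intro order_trans [OF dim_le_card' card_image_le]) auto
  then have less': "dim ?N < dim D"
    using less dimD by linarith
  have "dim (D\<^sup>\<bottom>) + dim D = DIM('a)"
  proof -
    have "D\<^sup>\<bottom> = {y \<in> UNIV. \<forall>x\<in>D. orthogonal x y}"
      by (auto simp: orthogonal_comp_def)
    then show ?thesis
      using dim_subspace_orthogonal_to_vectors [OF subD subspace_UNIV] by simp
  qed
  moreover have "dim (?N \<union> D\<^sup>\<bottom>) \<le> dim ?N + dim (D\<^sup>\<bottom>)"
    using dim_sums_Int [of "span ?N" "span (D\<^sup>\<bottom>)"] span_Un [of ?N "D\<^sup>\<bottom>"] dim_span [of "?N \<union> D\<^sup>\<bottom>"]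
    by (simp add: set_plus_def)
  ultimately have "dim (?N \<union> D\<^sup>\<bottom>) < DIM('a)"
    using less' by linarith
  then obtain z where z: "z \<noteq> 0" "\<And>y. y \<in> span (?N \<union> D\<^sup>\<bottom>) \<Longrightarrow> orthogonal z y"
    using orthogonal_to_subspace_exists by blast
  have "z \<in> D\<^sup>\<bottom>\<^sup>\<bottom>"
    using z(2) by (auto simp: orthogonal_comp_def orthogonal_commute span_base)
  then have "z \<in> D"
    using orthogonal_comp_self [OF subD] by simp
  then have "v + z \<in> affine hull P"
    by (auto simp: D_def)
  moreover have "facet_normal P F \<bullet> z = 0" if "F facet_of P" "v \<in> F" for F
    using z(2) [of "facet_normal P F"] that by (simp add: orthogonal_def inner_commute span_base)
  ultimately have "z = 0"
    using vertex_direction_zero [OF P v] by blast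
  then show False
    using z(1) by simp
qed

text \<open>The witness is the sum of the normals of the facets at the vertex. As the bound is linear in
  the distance, every objective close to the witness still exposes the vertex.\<close>

lemma vertex_is_sharp:
  fixes P :: "'a::euclidean_space set"
  assumes P: "polyhedron P" and v: "v extreme_point_of P"
  obtains c e where "0 < e" "\<And>y. y \<in> P \<Longrightarrow> c \<bullet> (y - v) \<le> - e * norm (y - v)"
proof -
  let ?S = "{F. F facet_of P \<and> v \<in> F}"
  define c where "c = (\<Sum>F\<in>?S. facet_normal P F)"
  \<comment> \<open>The unit directions of the tangent cone at \<open>v\<close>. By compactness, a
    linear function that is negative on this set is bounded away from 0 there.\<close>
  define T where "T = {z. v + z \<in> affine hull P} \<inter> sphere 0 1 \<inter>
    (\<Inter>F\<in>?S. {z. facet_normal P F \<bullet> z \<le> 0})"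
  have fin: "finite ?S"
    by (rule finite_subset [OF _ finite_polyhedron_facets [OF P]]) auto
  have "v \<in> P"
    using v by (simp add: extreme_point_of_def)
  have neg: "c \<bullet> z < 0" if "z \<in> T" for z
  proof -
    have le: "facet_normal P F \<bullet> z \<le> 0" if "F \<in> ?S" for F
      using \<open>z \<in> T\<close> that by (auto simp: T_def)
    have "c \<bullet> z = (\<Sum>F\<in>?S. facet_normal P F \<bullet> z)"
      by (simp add: c_def inner_sum_left)
    moreover have "(\<Sum>F\<in>?S. facet_normal P F \<bullet> z) \<noteq> 0"
    proof
      assume "(\<Sum>F\<in>?S. facet_normal P F \<bullet> z) = 0"
      then have "\<forall>F\<in>?S. facet_normal P F \<bullet> z = 0"
        using sum_nonneg_eq_0_iff [OF fin, of "\<lambda>F. - (facet_normal P F \<bullet> z)"] le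
        by (auto simp: sum_negf)
      then have "z = 0"
        using vertex_direction_zero [OF P v] \<open>z \<in> T\<close> by (auto simp: T_def)
      then show False
        using \<open>z \<in> T\<close> by (simp add: T_def)
    qed
    ultimately show ?thesis
      using sum_nonpos [of ?S "\<lambda>F. facet_normal P F \<bullet> z"] le by fastforce
  qed
  have "closed ((\<lambda>z. v + z) -` (affine hull P))"
    by (intro closed_vimage closed_affine_hull continuous_intros)
  then have "closed {z. v + z \<in> affine hull P}"
    by (simp add: vimage_def)
  then have "compact T"
    unfolding T_def
    by (intro compact_Int_closed closed_Int_compact) (auto intro!: closed_INT closed_halfspace_le)
  obtain e where e: "0 < e" "\<And>z. z \<in> T \<Longrightarrow> c \<bullet> z \<le> - e"
  proof (cases "T = {}")
    case False
    have "continuous_on T (\<lambda>z. c \<bullet> z)"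
      by (intro continuous_intros)
    then obtain z where "z \<in> T" "\<And>y. y \<in> T \<Longrightarrow> c \<bullet> y \<le> c \<bullet> z"
      using continuous_attains_sup [OF \<open>compact T\<close> False] by blast
    then show thesis
      using that [of "- (c \<bullet> z)"] neg by auto
  qed (use that [of 1] in auto)
  have "c \<bullet> (y - v) \<le> - e * norm (y - v)" if y: "y \<in> P" for y
  proof (cases "y = v")
    case False
    then have pos: "0 < norm (y - v)"
      by simp
    let ?z = "(y - v) /\<^sub>R norm (y - v)"
    have "?z \<in> T"
    proof -
      have "v + (1 / norm (y - v)) *\<^sub>R (y - v) \<in> affine hull P"
        using \<open>v \<in> P\<close> y by (intro mem_affine_hull_direction [of v]) (auto intro: hull_inc)
      moreover have "facet_normal P F \<bullet> ?z \<le> 0" if F: "F \<in> ?S" for F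
      proof -
        have "facet_normal P F \<bullet> (y - v) \<le> 0"
          using facet_normal_le [OF P _ y, of F] facet_normal_eq [OF P, of F v] F
          by (simp add: inner_simps)
        then show ?thesis
          using pos by (simp add: mult_nonneg_nonpos)
      qed
      ultimately show ?thesis
        using pos by (auto simp: T_def divide_inverse_commute)
    qed
    then have "c \<bullet> ?z \<le> - e"
      by (rule e(2))
    moreover have "c \<bullet> ?z = (c \<bullet> (y - v)) / norm (y - v)"
      by (simp add: divide_inverse)
    ultimately show ?thesis
      using pos by (simp only: pos_divide_le_eq)
  qed simp
  then show thesis
    using that e(1) by blast
qed

lemma sharp_imp_optimal_face:
  assumes "v \<in> P" "\<And>y. y \<in> P \<Longrightarrow> c \<bullet> (y - v) \<le> - e * norm (y - v)" "norm (d - c) < e"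
  shows "optimal_face P d = {v}"
proof -
  have less: "d \<bullet> y < d \<bullet> v" if "y \<in> P" "y \<noteq> v" for y
  proof -
    have "d \<bullet> (y - v) = (d - c) \<bullet> (y - v) + c \<bullet> (y - v)"
      by (simp add: inner_simps)
    also have "\<dots> \<le> norm (d - c) * norm (y - v) + (- e * norm (y - v))"
      using assms(2) [OF that(1)] norm_cauchy_schwarz [of "d - c" "y - v"] by (intro add_mono)
    also have "\<dots> = (norm (d - c) - e) * norm (y - v)"
      by (simp add: algebra_simps)
    also have "\<dots> < 0"
      using assms(3) that(2) by (intro mult_neg_pos) auto
    finally show ?thesis
      by (simp add: inner_simps)
  qed
  have "v \<in> optimal_face P d"
    using less assms(1) by (intro optimal_faceI) (auto simp: le_less)
  moreover have "y = v" if "y \<in> optimal_face P d" for y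
    using less [of y] that assms(1) by (force simp: optimal_face_def)
  ultimately show ?thesis
    by blast
qed

section \<open>Parametric objectives and connectedness of the graph\<close>

lemma aff_dim_le_1_eq_segment:
  fixes S :: "'a::euclidean_space set"
  assumes "convex S" "aff_dim S \<le> 1" "p extreme_point_of S" "q extreme_point_of S" "p \<noteq> q"
  shows "S = closed_segment p q"
proof
  have pq: "p \<in> S" "q \<in> S"
    using assms by (auto simp: extreme_point_of_def)
  then show "closed_segment p q \<subseteq> S"
    using assms(1) by (simp add: closed_segment_subset)
  show "S \<subseteq> closed_segment p q"
  proof
    fix x assume "x \<in> S"
    have "collinear {p, q, x}"
      using assms(2) pq \<open>x \<in> S\<close> by (meson collinear_aff_dim collinear_subset empty_subsetI insert_subset)
    then consider "between (q, x) p" | "between (x, p) q" | "between (p, q) x"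
      using collinear_between_cases by blast
    then show "x \<in> closed_segment p q"
    proof cases
      case 1
      then have "p \<in> closed_segment q x"
        by (simp add: between_mem_segment)
      moreover have "p \<notin> open_segment q x"
        using assms(3) pq \<open>x \<in> S\<close> by (auto simp: extreme_point_of_def)
      ultimately have "p = x"
        using \<open>p \<noteq> q\<close> by (auto simp: open_segment_def)
      then show ?thesis by simp
    next
      case 2
      then have "q \<in> closed_segment x p"
        by (simp add: between_mem_segment)
      moreover have "q \<notin> open_segment x p"
        using assms(4) pq \<open>x \<in> S\<close> by (auto simp: extreme_point_of_def)
      ultimately have "q = x"
        using \<open>p \<noteq> q\<close> by (auto simp: open_segment_def)
      then show ?thesis by simp
    next
      case 3
      then show ?thesis
        by (simp add: between_mem_segment)
    qed
  qed
qed

lemma edge_rel_sym: "(p, q) \<in> edge_rel P \<Longrightarrow> (q, p) \<in> edge_rel P"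
  by (simp add: edge_rel_def closed_segment_commute)

lemma edge_relI:
  fixes P :: "'a::euclidean_space set"
  assumes "E face_of P" "aff_dim E \<le> 1" "p \<in> E" "q \<in> E"
    and "p extreme_point_of P" "q extreme_point_of P" "p \<noteq> q"
  shows "(p, q) \<in> edge_rel P"
proof -
  have "p extreme_point_of E" "q extreme_point_of E"
    using assms extreme_point_of_face by blast+
  then have E: "E = closed_segment p q"
    using aff_dim_le_1_eq_segment assms face_of_imp_convex by blast
  then have "aff_dim E = 1"
    using \<open>p \<noteq> q\<close> by (simp add: aff_dim_2 segment_convex_hull aff_dim_convex_hull)
  then show ?thesis
    using assms E by (auto simp: edge_rel_def vertices_of_def edge_of_def)
qed

lemma vertices_of_face:
  "F face_of P \<Longrightarrow> vertices_of F = vertices_of P \<inter> F"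
  using extreme_point_of_face by (auto simp: vertices_of_def)

lemma edge_rel_face:
  assumes "F face_of P"
  shows "edge_rel F \<subseteq> Restr (edge_rel P) (vertices_of F)"
  using assms vertices_of_face [OF assms] face_of_trans
  by (auto simp: edge_rel_def edge_of_def)

section \<open>Linear deformation of objectives\<close>

definition along :: "'a::real_vector \<Rightarrow> 'a \<Rightarrow> real \<Rightarrow> 'a" where
  "along c d s = (1 - s) *\<^sub>R c + s *\<^sub>R d"

lemma along_0 [simp]: "along c d 0 = c" and along_1 [simp]: "along c d 1 = d"
  by (simp_all add: along_def)

lemma inner_along: "along c d s \<bullet> x = (1 - s) * (c \<bullet> x) + s * (d \<bullet> x)"
  by (simp add: along_def inner_simps)

lemma optimal_along_bounded:
  assumes p: "p \<in> optimal_face P (along c d s)" and r: "r \<in> optimal_face P d"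
    and st: "s \<le> t" "t \<le> 1"
  shows "\<exists>B. \<forall>y\<in>P. along c d t \<bullet> y \<le> B"
proof (cases "s = 1")
  case True
  then show ?thesis
    using st r by (auto simp: optimal_face_def)
next
  case False
  then have s: "s < 1"
    using st by simp
  \<comment> \<open>These coefficients write the objective at time \<open>t\<close> as a nonnegative
    combination of the one at time \<open>s\<close> and of \<open>d\<close>, both of which are
    bounded above on \<open>P\<close>.\<close>
  define l m where "l = (1 - t) / (1 - s)" and "m = (t - s) / (1 - s)"
  have lm: "0 \<le> l" "0 \<le> m"
    using st s by (simp_all add: l_def m_def)
  have eq: "along c d t \<bullet> y = l * (along c d s \<bullet> y) + m * (d \<bullet> y)" for y
  proof -
    have l: "l * (1 - s) = 1 - t" and m: "m * (1 - s) = t - s"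
      using s by (simp_all add: l_def m_def)
    have "(l * s + m) * (1 - s) = (l * (1 - s)) * s + m * (1 - s)"
      by (simp add: algebra_simps)
    also have "\<dots> = t * (1 - s)"
      unfolding l m by (simp add: algebra_simps)
    finally have "l * s + m = t"
      using s by simp
    with l have "(1 - t) * (c \<bullet> y) + t * (d \<bullet> y) = (l * (1 - s)) * (c \<bullet> y) + (l * s + m) * (d \<bullet> y)"
      by simp
    then show ?thesis
      by (simp add: inner_along algebra_simps)
  qed
  have "along c d t \<bullet> y \<le> l * (along c d s \<bullet> p) + m * (d \<bullet> r)" if "y \<in> P" for y
    unfolding eq using p r that lm
    by (intro add_mono mult_left_mono) (auto simp: optimal_face_def)
  then show ?thesis
    by blast
qed

lemma closed_optimal_times:
  fixes P :: "'a::euclidean_space set"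
  assumes "r \<in> P"
  shows "closed {t. r \<in> optimal_face P (along c d t)}"
proof -
  have "{t. r \<in> optimal_face P (along c d t)} = (\<Inter>y\<in>P. {t. along c d t \<bullet> y \<le> along c d t \<bullet> r})"
    using assms by (auto simp: optimal_face_def)
  moreover have "closed {t. along c d t \<bullet> y \<le> along c d t \<bullet> r}" for y
    unfolding inner_along by (intro closed_Collect_le continuous_intros)
  ultimately show ?thesis
    by (simp add: closed_INT)
qed

text \<open>As the parameter grows past the last time at which \<^term>\<open>p\<close> is optimal, some vertex of the optimal
  face at that time takes over.\<close>

lemma parametric_successor:
  fixes P :: "'a::euclidean_space set"
  assumes P: "polyhedron P" and p: "p extreme_point_of P" "p \<in> optimal_face P (along c d s)"
    and r: "r \<in> optimal_face P d" and pd: "p \<notin> optimal_face P d" and s: "s \<le> 1"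
  obtains q s1 s2 where "q extreme_point_of P" "s \<le> s1" "s1 < s2" "s2 \<le> 1"
    "p \<in> optimal_face P (along c d s1)" "q \<in> optimal_face P (along c d s1)"
    "q \<in> optimal_face P (along c d s2)" "p \<notin> optimal_face P (along c d s2)"
proof -
  define T where "T v = {t. v \<in> optimal_face P (along c d t)}" for v
  have closedT: "closed (T v)" if "v extreme_point_of P" for v
    unfolding T_def using that by (intro closed_optimal_times) (simp add: extreme_point_of_def)
  have "compact (T p \<inter> {s..1})"
    using closedT [OF p(1)] by (simp add: closed_Int_compact)
  moreover have "s \<in> T p \<inter> {s..1}"
    using p s by (simp add: T_def)
  ultimately obtain s1 where s1: "s1 \<in> T p \<inter> {s..1}" "\<And>t. t \<in> T p \<inter> {s..1} \<Longrightarrow> t \<le> s1"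
    using compact_attains_sup by (metis empty_iff)
  have "s1 \<noteq> 1"
    using s1(1) pd by (auto simp: T_def)
  then have "s1 < 1"
    using s1(1) by auto
  \<comment> \<open>The times at which some vertex that is not optimal at \<open>s1\<close> is
    optimal. There are finitely many vertices, so this set is closed, and every vertex optimal
    shortly after \<open>s1\<close> is already optimal at \<open>s1\<close>.\<close>
  let ?B = "\<Union>v\<in>{v. v extreme_point_of P \<and> s1 \<notin> T v}. T v"
  have "finite {v. v extreme_point_of P \<and> s1 \<notin> T v}"
    by (rule finite_subset [OF _ finite_polyhedron_extreme_points [OF P]]) auto
  then have "closed ?B"
    using closedT by (intro closed_UN) auto
  then have "open (- ?B)"
    by (rule open_Compl)
  moreover have "s1 \<in> - ?B"
    by blast
  ultimately obtain e where e: "0 < e" "ball s1 e \<subseteq> - ?B"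
    using openE by blast
  define s2 where "s2 = min 1 (s1 + e / 2)"
  have "s2 \<in> ball s1 e"
    using e \<open>s1 < 1\<close> by (auto simp: s2_def dist_real_def)
  then have s2: "s1 < s2" "s2 \<le> 1" "s2 \<in> - ?B"
    using e \<open>s1 < 1\<close> by (auto simp: s2_def)
  obtain B where "\<And>y. y \<in> P \<Longrightarrow> along c d s2 \<bullet> y \<le> B"
    using optimal_along_bounded [OF p(2) r, of s2] s1(1) s2 by auto
  then obtain q where q: "q extreme_point_of P" "q \<in> optimal_face P (along c d s2)"
    using optimal_vertex_exists [OF P p(1)] by blast
  then have "s1 \<in> T q"
    using s2(3) by (auto simp: T_def)
  moreover have "p \<notin> optimal_face P (along c d s2)"
    using s1(2) [of s2] s1(1) s2 by (auto simp: T_def)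
  ultimately show thesis
    using that [of q s1 s2] q s1(1) s2 by (auto simp: T_def)
qed

text \<open>Whenever the current vertex stops being optimal, a vertex of the same optimal face takes
  over, and \<open>(d - c) \<bullet> p\<close> strictly increases; hence finitely many changes
  suffice. \<open>R\<close> is left open because the moves inside an optimal face come once from an
  induction on the dimension and once from the connectedness of faces.\<close>

lemma parametric_path:
  fixes P :: "'a::euclidean_space set"
  assumes P: "polyhedron P" and p: "p extreme_point_of P" "p \<in> optimal_face P c"
    and r: "r extreme_point_of P" "r \<in> optimal_face P d"
    and step: "\<And>s x y. 0 \<le> s \<Longrightarrow> s \<le> 1 \<Longrightarrow> x extreme_point_of P \<Longrightarrow> y extreme_point_of P \<Longrightarrow>
      x \<in> optimal_face P (along c d s) \<Longrightarrow> y \<in> optimal_face P (along c d s) \<Longrightarrow> (x, y) \<in> R\<^sup>*"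
  shows "(p, r) \<in> R\<^sup>*"
proof -
  have "(p, r) \<in> R\<^sup>*" if "p extreme_point_of P" "p \<in> optimal_face P (along c d s)" "0 \<le> s" "s \<le> 1" for p s
    using that
  proof (induction "card {v. v extreme_point_of P \<and> (d - c) \<bullet> p < (d - c) \<bullet> v}"
      arbitrary: p s rule: less_induct)
    case less
    show ?case
    proof (cases "p \<in> optimal_face P d")
      case True
      then show ?thesis
        using step [of 1 p r] r less.prems by simp
    next
      case False
      then obtain q s1 s2 where q: "q extreme_point_of P" "s \<le> s1" "s1 < s2" "s2 \<le> 1"
        "p \<in> optimal_face P (along c d s1)" "q \<in> optimal_face P (along c d s1)"
        "q \<in> optimal_face P (along c d s2)" "p \<notin> optimal_face P (along c d s2)"
        using parametric_successor [OF P less.prems(1,2) r(2) _ less.prems(4)] by metis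
      have "along c d s1 \<bullet> p = along c d s1 \<bullet> q"
        using optimal_face_eqD q by blast
      moreover have "along c d s2 \<bullet> p < along c d s2 \<bullet> q"
      proof (rule ccontr)
        assume "\<not> ?thesis"
        moreover have "p \<in> P"
          using less.prems by (simp add: extreme_point_of_def)
        ultimately have "p \<in> optimal_face P (along c d s2)"
          using q(7) by (force simp: optimal_face_def)
        then show False
          using q(8) by blast
      qed
      \<comment> \<open>The objectives at \<open>s2\<close> and \<open>s1\<close> differ by the
        multiple \<open>s2 - s1\<close> of \<open>d - c\<close>.\<close>
      ultimately have "(s2 - s1) * ((d - c) \<bullet> p) < (s2 - s1) * ((d - c) \<bullet> q)"
        by (simp add: inner_along inner_simps algebra_simps)
      then have less': "(d - c) \<bullet> p < (d - c) \<bullet> q"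
        using q(3) by simp
      have "card {v. v extreme_point_of P \<and> (d - c) \<bullet> q < (d - c) \<bullet> v}
          < card {v. v extreme_point_of P \<and> (d - c) \<bullet> p < (d - c) \<bullet> v}"
      proof (rule psubset_card_mono)
        show "finite {v. v extreme_point_of P \<and> (d - c) \<bullet> p < (d - c) \<bullet> v}"
          by (rule finite_subset [OF _ finite_polyhedron_extreme_points [OF P]]) auto
        have "q \<in> {v. v extreme_point_of P \<and> (d - c) \<bullet> p < (d - c) \<bullet> v}"
          using less' q(1) by simp
        then show "{v. v extreme_point_of P \<and> (d - c) \<bullet> q < (d - c) \<bullet> v}
          \<subset> {v. v extreme_point_of P \<and> (d - c) \<bullet> p < (d - c) \<bullet> v}"
          using less' by auto
      qed
      then have "(q, r) \<in> R\<^sup>*"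
        using less.hyps q less.prems by (meson less_imp_le order_trans)
      moreover have "(p, q) \<in> R\<^sup>*"
        using step [of s1 p q] q less.prems by simp
      ultimately show ?thesis
        by simp
    qed
  qed
  from this [of p 0] show ?thesis
    using p by simp
qed

text \<open>Two independent directions from \<open>p\<close> span a plane, which contains a nonzero
  vector orthogonal to \<open>c\<close>. It is kept as a combination of differences of points of
  \<open>P\<close>, so that every objective constant on \<open>P\<close> vanishes on it.\<close>

lemma aff_dim_ge_2_orthogonal:
  fixes P :: "'a::euclidean_space set"
  assumes P: "2 \<le> aff_dim P" "p \<in> P" and c: "\<And>y. y \<in> P \<Longrightarrow> y \<noteq> p \<Longrightarrow> c \<bullet> y < c \<bullet> p"
  obtains x y \<alpha> \<beta> where "x \<in> P" "y \<in> P" "\<alpha> *\<^sub>R (x - p) + \<beta> *\<^sub>R (y - p) \<noteq> 0"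
    "c \<bullet> (\<alpha> *\<^sub>R (x - p) + \<beta> *\<^sub>R (y - p)) = 0"
proof -
  obtain x where x: "x \<in> P" "x \<noteq> p"
  proof -
    have "P \<noteq> {p}"
      using P by auto
    then show thesis
      using that P(2) by blast
  qed
  have "\<not> P \<subseteq> affine hull {p, x}"
  proof
    assume "P \<subseteq> affine hull {p, x}"
    then have "aff_dim P \<le> aff_dim {p, x}"
      by (metis aff_dim_affine_hull aff_dim_subset)
    then show False
      using P x by (simp add: aff_dim_2)
  qed
  then obtain y where y: "y \<in> P" "y \<notin> affine hull {p, x}"
    by blast
  define \<alpha> \<beta> where "\<alpha> = c \<bullet> (y - p)" and "\<beta> = - (c \<bullet> (x - p))"
  have "0 < \<beta>"
    using c [OF x] by (simp add: \<beta>_def inner_simps)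
  have "\<alpha> *\<^sub>R (x - p) + \<beta> *\<^sub>R (y - p) \<noteq> 0"
  proof
    assume eq: "\<alpha> *\<^sub>R (x - p) + \<beta> *\<^sub>R (y - p) = 0"
    have "y = p + (- \<alpha> / \<beta>) *\<^sub>R (x - p)"
    proof -
      have "\<beta> *\<^sub>R (y - p) = (- \<alpha>) *\<^sub>R (x - p)"
        using eq by (simp add: add_eq_0_iff)
      then have "(1 / \<beta>) *\<^sub>R (\<beta> *\<^sub>R (y - p)) = (1 / \<beta>) *\<^sub>R ((- \<alpha>) *\<^sub>R (x - p))"
        by simp
      then show ?thesis
        using \<open>0 < \<beta>\<close> by (simp add: algebra_simps)
    qed
    then have "y = (1 - (- \<alpha> / \<beta>)) *\<^sub>R p + (- \<alpha> / \<beta>) *\<^sub>R x"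
      by (simp add: algebra_simps)
    then have "y \<in> affine hull {p, x}"
      unfolding affine_hull_2 mem_Collect_eq
      by (intro exI [of _ "1 - (- \<alpha> / \<beta>)"] exI [of _ "- \<alpha> / \<beta>"]) simp
    then show False
      using y by blast
  qed
  moreover have "c \<bullet> (\<alpha> *\<^sub>R (x - p) + \<beta> *\<^sub>R (y - p)) = 0"
    by (simp add: \<alpha>_def \<beta>_def inner_simps algebra_simps)
  ultimately show thesis
    using that x y by blast
qed

text \<open>Both vertices are exposed by objectives, and deforming one objective into the other
  links them through optimal faces. If all these faces are proper, the induction on the dimension
  connects the vertices within each.\<close>

theorem vertices_connected:
  fixes P :: "'a::euclidean_space set"
  assumes "polyhedron P" "p extreme_point_of P" "q extreme_point_of P"
  shows "(p, q) \<in> (edge_rel P)\<^sup>*"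
  using assms
proof (induction "nat (aff_dim P)" arbitrary: P p q rule: less_induct)
  case (less P p q)
  note P = less.prems(1) and p = less.prems(2) and q = less.prems(3)
  have cP: "convex P"
    using P polyhedron_imp_convex by blast
  have pP: "p \<in> P" and qP: "q \<in> P"
    using p q by (auto simp: extreme_point_of_def)
  consider "p = q" | "p \<noteq> q" "aff_dim P \<le> 1" | "p \<noteq> q" "2 \<le> aff_dim P"
    by linarith
  then show ?case
  proof cases
    case 1
    then show ?thesis by simp
  next
    case 2
    then show ?thesis
      using edge_relI [of P P p q] face_of_refl [OF cP] p q pP qP by blast
  next
    case 3
    obtain c e where e: "0 < e" and ce: "\<And>y. y \<in> P \<Longrightarrow> c \<bullet> (y - p) \<le> - e * norm (y - p)"
      using vertex_is_sharp [OF P p] by blast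
    obtain d f where f: "0 < f" and df: "\<And>y. y \<in> P \<Longrightarrow> d \<bullet> (y - q) \<le> - f * norm (y - q)"
      using vertex_is_sharp [OF P q] by blast
    have optd: "optimal_face P d = {q}"
      using sharp_imp_optimal_face [OF qP df] f by simp
    have cless: "c \<bullet> y < c \<bullet> p" if "y \<in> P" "y \<noteq> p" for y
    proof -
      have "0 < e * norm (y - p)"
        using e that by simp
      then show ?thesis
        using ce [OF that(1)] by (simp add: inner_simps)
    qed
    obtain x y \<alpha> \<beta> where xy: "x \<in> P" "y \<in> P"
      and w0: "\<alpha> *\<^sub>R (x - p) + \<beta> *\<^sub>R (y - p) \<noteq> 0" "c \<bullet> (\<alpha> *\<^sub>R (x - p) + \<beta> *\<^sub>R (y - p)) = 0"
      using aff_dim_ge_2_orthogonal [OF 3(2) pP cless] by metis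
    define w where "w = \<alpha> *\<^sub>R (x - p) + \<beta> *\<^sub>R (y - p)"
    have w: "w \<noteq> 0" "c \<bullet> w = 0"
      using w0 by (simp_all add: w_def)
    \<comment> \<open>Tilting \<^term>\<open>c\<close> along \<^term>\<open>w\<close> keeps the two objectives from being opposite on \<^term>\<open>P\<close>: an objective
      between them that is constant on \<^term>\<open>P\<close> would make the optimal face all of \<^term>\<open>P\<close>, and the induction
      on the dimension would fail.\<close>
    define \<delta> where "\<delta> = (if 0 \<le> d \<bullet> w then 1 else -1) * (e / (2 * norm w))"
    have "norm (\<delta> *\<^sub>R w) = e / 2"
      using w e by (simp add: \<delta>_def abs_mult)
    then have optc: "optimal_face P (c + \<delta> *\<^sub>R w) = {p}"
      using sharp_imp_optimal_face [OF pP ce, of "c + \<delta> *\<^sub>R w"] e by simp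
    have proper: "optimal_face P (along (c + \<delta> *\<^sub>R w) d s) \<noteq> P" if s: "0 \<le> s" "s \<le> 1" for s
    proof
      let ?c = "along (c + \<delta> *\<^sub>R w) d s"
      assume "optimal_face P ?c = P"
      then have "?c \<bullet> x = ?c \<bullet> p" "?c \<bullet> y = ?c \<bullet> p"
        using optimal_face_eqD [of _ P ?c] xy pP by blast+
      then have "?c \<bullet> w = 0"
        by (simp add: w_def inner_right_distrib inner_diff_right)
      then have "(1 - s) * (\<delta> * (w \<bullet> w)) + s * (d \<bullet> w) = 0"
        using w(2) by (simp add: inner_along inner_left_distrib)
      moreover have pos: "0 < e / (2 * norm w) * (w \<bullet> w)"
        using e w by simp
      \<comment> \<open>The sign of \<delta> gives both summands the same sign, so both vanish. This
        leaves only \<open>s = 1\<close>, where the optimal face is \<open>{q}\<close>.\<close>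
      ultimately have "s = 1"
      proof (cases "0 \<le> d \<bullet> w")
        case True
        then have \<delta>: "0 < \<delta> * (w \<bullet> w)"
          using pos by (simp add: \<delta>_def)
        then have "0 \<le> (1 - s) * (\<delta> * (w \<bullet> w))" "0 \<le> s * (d \<bullet> w)"
          using s True by (simp_all del: mult_eq_0_iff)
        then have "(1 - s) * (\<delta> * (w \<bullet> w)) = 0"
          using \<open>(1 - s) * (\<delta> * (w \<bullet> w)) + s * (d \<bullet> w) = 0\<close> by linarith
        then show ?thesis
          using \<delta> by auto
      next
        case False
        then have \<delta>: "\<delta> * (w \<bullet> w) < 0"
          using pos by (simp add: \<delta>_def)
        have "(1 - s) * (\<delta> * (w \<bullet> w)) \<le> 0" "s * (d \<bullet> w) \<le> 0"
          using mult_nonneg_nonpos [of "1 - s" "\<delta> * (w \<bullet> w)"] mult_nonneg_nonpos [of s "d \<bullet> w"] s False \<delta>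
          by simp_all
        then have "(1 - s) * (\<delta> * (w \<bullet> w)) = 0"
          using \<open>(1 - s) * (\<delta> * (w \<bullet> w)) + s * (d \<bullet> w) = 0\<close> by linarith
        then show ?thesis
          using \<delta> by auto
      qed
      then show False
        using \<open>optimal_face P ?c = P\<close> optd pP 3 by auto
    qed
    show ?thesis
    proof (rule parametric_path [OF P p _ q, of "c + \<delta> *\<^sub>R w" d])
      show "p \<in> optimal_face P (c + \<delta> *\<^sub>R w)" "q \<in> optimal_face P d"
        using optc optd by auto
      fix s x y
      let ?F = "optimal_face P (along (c + \<delta> *\<^sub>R w) d s)"
      assume s: "0 \<le> s" "s \<le> 1" and xy: "x extreme_point_of P" "y extreme_point_of P" "x \<in> ?F" "y \<in> ?F"
      have F: "?F face_of P"
        by (rule optimal_face_face_of [OF cP])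
      have "aff_dim ?F < aff_dim P"
        by (rule face_of_aff_dim_lt [OF cP F proper [OF s]])
      then have "nat (aff_dim ?F) < nat (aff_dim P)"
        using 3 by linarith
      moreover have "polyhedron ?F"
        using face_of_polyhedron_polyhedron [OF P F] .
      ultimately have "(x, y) \<in> (edge_rel ?F)\<^sup>*"
        using less.hyps xy extreme_point_of_face [OF F] by blast
      moreover have "edge_rel ?F \<subseteq> edge_rel P"
        using edge_rel_face [OF F] by blast
      ultimately show "(x, y) \<in> (edge_rel P)\<^sup>*"
        using rtrancl_mono by blast
    qed
  qed
qed

lemma sym_Restr_edge_rel: "sym (Restr (edge_rel P) W)"
  using edge_rel_sym by (auto intro!: symI)

lemma path_in_face:
  fixes P :: "'a::euclidean_space set"
  assumes P: "polyhedron P" and F: "F face_of P" and p: "p extreme_point_of P" "p \<in> F"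
    and q: "q extreme_point_of P" "q \<in> F" and W: "vertices_of F \<subseteq> W"
  shows "(p, q) \<in> (Restr (edge_rel P) W)\<^sup>*"
proof -
  have "(p, q) \<in> (edge_rel F)\<^sup>*"
    using vertices_connected [OF face_of_polyhedron_polyhedron [OF P F]] p q
      extreme_point_of_face [OF F] by blast
  moreover have "edge_rel F \<subseteq> Restr (edge_rel P) W"
    using edge_rel_face [OF F] W by blast
  ultimately show ?thesis
    using rtrancl_mono by blast
qed

text \<open>Deform an objective exposing \<open>p\<close> into \<open>d\<close>. A point at least as
  good as \<open>p\<close> for the mixture, but not better for the first objective, is at least as
  good for \<open>d\<close>, so the optimal faces never fall below the level of \<open>p\<close>.
  Both vertices thus reach the same \<open>d\<close>-optimal vertex. This later keeps paths inside a
  cap.\<close>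

lemma superlevel_connected:
  fixes P :: "'a::euclidean_space set"
  assumes P: "polyhedron P" and p: "p extreme_point_of P" "t \<le> d \<bullet> p"
    and q: "q extreme_point_of P" "t \<le> d \<bullet> q" and bd: "\<And>y. y \<in> P \<Longrightarrow> d \<bullet> y \<le> B"
  shows "(p, q) \<in> (Restr (edge_rel P) {x. t \<le> d \<bullet> x})\<^sup>*"
proof -
  let ?R = "Restr (edge_rel P) {x. t \<le> d \<bullet> x}"
  have cP: "convex P"
    using P polyhedron_imp_convex by blast
  obtain r where r: "r extreme_point_of P" "r \<in> optimal_face P d"
    using optimal_vertex_exists [OF P p(1) bd] by blast
  have to_r: "(p, r) \<in> ?R\<^sup>*" if p: "p extreme_point_of P" "t \<le> d \<bullet> p" for p
  proof -
    have pP: "p \<in> P"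
      using p by (simp add: extreme_point_of_def)
    obtain c e where e: "0 < e" and ce: "\<And>y. y \<in> P \<Longrightarrow> c \<bullet> (y - p) \<le> - e * norm (y - p)"
      using vertex_is_sharp [OF P p(1)] by blast
    have optc: "optimal_face P c = {p}"
      using sharp_imp_optimal_face [OF pP ce] e by simp
    show ?thesis
    proof (rule parametric_path [OF P p(1) _ r])
      show "p \<in> optimal_face P c"
        using optc by simp
      fix s x y
      let ?F = "optimal_face P (along c d s)"
      assume s: "0 \<le> s" "s \<le> 1" and xy: "x extreme_point_of P" "y extreme_point_of P" "x \<in> ?F" "y \<in> ?F"
      have F: "?F face_of P"
        by (rule optimal_face_face_of [OF cP])
      have "d \<bullet> p \<le> d \<bullet> z" if z: "z \<in> ?F" for z
      proof (cases "s = 0")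
        case True
        then show ?thesis
          using z optc by simp
      next
        case False
        have "z \<in> P"
          using z optimal_face_subset by blast
        then have "c \<bullet> z \<le> c \<bullet> p"
          using optc optimal_faceD by (metis singletonI)
        moreover have "along c d s \<bullet> p \<le> along c d s \<bullet> z"
          using optimal_faceD [OF z pP] .
        moreover have "(1 - s) * (c \<bullet> z) \<le> (1 - s) * (c \<bullet> p)"
          using s \<open>c \<bullet> z \<le> c \<bullet> p\<close> by (intro mult_left_mono) auto
        ultimately have "s * (d \<bullet> p) \<le> s * (d \<bullet> z)"
          by (simp add: inner_along)
        then show ?thesis
          using False s by simp
      qed
      then have "vertices_of ?F \<subseteq> {x. t \<le> d \<bullet> x}"
        using p(2) vertices_of_face [OF F] by fastforce
      then show "(x, y) \<in> ?R\<^sup>*"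
        using path_in_face [OF P F] xy by blast
    qed
  qed
  have "(r, q) \<in> ?R\<^sup>*"
    by (rule symD [OF sym_rtrancl [OF sym_Restr_edge_rel] to_r [OF q]])
  then show ?thesis
    using to_r [OF p] by simp
qed

section \<open>The shadow of a three-dimensional polyhedron\<close>

text \<open>With \<open>e = cross3 a b\<close>, Lagrange's identity evaluates
  \<open>cross3 e (cross3 d e)\<close> in two ways: as a multiple of \<open>d\<close>, because
  \<open>d\<close> is orthogonal to \<open>e\<close>, and as a combination of \<open>a\<close> and
  \<open>b\<close>.\<close>

lemma orthogonal_to_cross3:
  fixes a b d :: "real^3"
  assumes "d \<bullet> (cross3 a b) = 0" "cross3 a b \<noteq> 0"
  obtains x y where "d = x *\<^sub>R a + y *\<^sub>R b"
proof -
  let ?e = "cross3 a b"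
  have e1: "cross3 ?e a = (a \<bullet> a) *\<^sub>R b - (a \<bullet> b) *\<^sub>R a"
    using cross_skew [of ?e a] Lagrange [of a a b] by simp
  have e2: "cross3 ?e b = (a \<bullet> b) *\<^sub>R b - (b \<bullet> b) *\<^sub>R a"
    using cross_skew [of ?e b] Lagrange [of b a b] by (simp add: inner_commute)
  have "(?e \<bullet> ?e) *\<^sub>R d = cross3 ?e (cross3 d ?e)"
    using Lagrange [of ?e d ?e] assms(1) by (simp add: inner_commute)
  also have "\<dots> = (d \<bullet> b) *\<^sub>R cross3 ?e a - (d \<bullet> a) *\<^sub>R cross3 ?e b"
    by (simp add: Lagrange [of d a b] Cross3.right_diff_distrib cross_mult_right)
  also have "\<dots> = ((d \<bullet> a) * (b \<bullet> b) - (d \<bullet> b) * (a \<bullet> b)) *\<^sub>R a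
      + ((d \<bullet> b) * (a \<bullet> a) - (d \<bullet> a) * (a \<bullet> b)) *\<^sub>R b"
    unfolding e1 e2 by (simp add: algebra_simps)
  finally have "(1 / (?e \<bullet> ?e)) *\<^sub>R ((?e \<bullet> ?e) *\<^sub>R d) = (1 / (?e \<bullet> ?e)) *\<^sub>R
      (((d \<bullet> a) * (b \<bullet> b) - (d \<bullet> b) * (a \<bullet> b)) *\<^sub>R a + ((d \<bullet> b) * (a \<bullet> a) - (d \<bullet> a) * (a \<bullet> b)) *\<^sub>R b)"
    by simp
  then have "d = (((d \<bullet> a) * (b \<bullet> b) - (d \<bullet> b) * (a \<bullet> b)) / (?e \<bullet> ?e)) *\<^sub>R a
      + (((d \<bullet> b) * (a \<bullet> a) - (d \<bullet> a) * (a \<bullet> b)) / (?e \<bullet> ?e)) *\<^sub>R b"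
    using assms(2) by (simp add: scaleR_add_right)
  then show thesis
    using that by blast
qed

lemma parallel_to_cross3:
  fixes a b w :: "real^3"
  assumes "a \<bullet> w = 0" "b \<bullet> w = 0" "cross3 a b \<noteq> 0"
  obtains t where "w = t *\<^sub>R cross3 a b"
proof -
  have "cross3 w (cross3 a b) = 0"
    using assms by (simp add: Lagrange inner_commute)
  then have "cross3 (cross3 a b) w = 0"
    using cross_skew [of "cross3 a b" w] by simp
  then have "collinear {0, cross3 a b, w}"
    by (simp add: cross_eq_0)
  then consider "w = 0" | c where "w = c *\<^sub>R cross3 a b"
    using assms(3) by (auto simp: collinear_lemma)
  then show thesis
    by cases (use that [of 0] that in auto)
qed

lemma optimal_face_proper:
  fixes P :: "'a::euclidean_space set"
  assumes "aff_dim P = int DIM('a)" "c \<noteq> 0"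
  shows "optimal_face P c \<noteq> P"
proof
  assume eq: "optimal_face P c = P"
  have "P \<noteq> {}"
    using assms by auto
  then obtain x where "x \<in> P"
    by blast
  then have "P \<subseteq> {y. c \<bullet> y = c \<bullet> x}"
    using eq optimal_face_eqD by blast
  then have "aff_dim P \<le> aff_dim {y. c \<bullet> y = c \<bullet> x}"
    by (rule aff_dim_subset)
  then show False
    using assms by (simp add: aff_dim_hyperplane)
qed

lemma facet_Int_facet:
  fixes P :: "'a::euclidean_space set"
  assumes P: "polyhedron P" "aff_dim P = 3" and FG: "F facet_of P" "G facet_of P" "F \<noteq> G"
  shows "F \<inter> G face_of P" "aff_dim (F \<inter> G) \<le> 1"
proof -
  have FP: "F face_of P" "G face_of P" "convex F"
    using FG facet_of_imp_face_of face_of_imp_convex by blast+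
  then show FGP: "F \<inter> G face_of P"
    by (simp add: face_of_Int)
  have "F \<inter> G face_of F"
    using FGP FP face_of_face by (metis face_of_subset facet_of_imp_subset FG(1) inf_le1)
  have dims: "aff_dim F = 2" "aff_dim G = 2"
    using FG P by (auto simp: facet_of_def)
  show "aff_dim (F \<inter> G) \<le> 1"
  proof (cases "F \<inter> G = F")
    case False
    then show ?thesis
      using face_of_aff_dim_lt [OF \<open>convex F\<close> \<open>F \<inter> G face_of F\<close>] dims by simp
  next
    case True
    then have "F face_of G"
      using FP FG by (metis face_of_subset facet_of_imp_subset inf_le2)
    moreover have "convex G"
      using FP face_of_imp_convex by blast
    ultimately show ?thesis
      using face_of_aff_dim_lt [of G F] FG(3) dims by simp
  qed
qed

lemma two_facets_edge:
  fixes P :: "'a::euclidean_space set"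
  assumes P: "polyhedron P" "aff_dim P = 3" and FG: "F facet_of P" "G facet_of P" "F \<noteq> G"
    and p: "p extreme_point_of P" "p \<in> F" "p \<in> G" and q: "q extreme_point_of P" "q \<in> F" "q \<in> G"
    and "p \<noteq> q"
  shows "(p, q) \<in> edge_rel P"
  using edge_relI [of "F \<inter> G" P p q] facet_Int_facet [OF P FG] p q \<open>p \<noteq> q\<close> by blast

lemma two_facets_no_three_vertices:
  fixes P :: "'a::euclidean_space set"
  assumes P: "polyhedron P" "aff_dim P = 3" and FG: "F facet_of P" "G facet_of P" "F \<noteq> G"
    and p: "p extreme_point_of P" "p \<in> F" "p \<in> G" and q: "q extreme_point_of P" "q \<in> F" "q \<in> G"
    and r: "r extreme_point_of P" "r \<in> F" "r \<in> G" and "p \<noteq> q"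
  shows "r = p \<or> r = q"
proof -
  have face: "F \<inter> G face_of P"
    by (rule facet_Int_facet [OF P FG])
  have ext: "p extreme_point_of F \<inter> G" "q extreme_point_of F \<inter> G" "r extreme_point_of F \<inter> G"
    using extreme_point_of_face [OF face] p q r by blast+
  have "F \<inter> G = closed_segment p q"
    by (rule aff_dim_le_1_eq_segment [OF face_of_imp_convex [OF face] facet_Int_facet(2) [OF P FG]
          ext(1,2) \<open>p \<noteq> q\<close>])
  then show ?thesis
    using ext(3) extreme_point_of_segment by metis
qed

text \<open>The shadow is the image under \<open>x \<mapsto> (a \<bullet> x, b \<bullet> x)\<close>, that is, the projection along \<^term>\<open>cross3 a b\<close>.
  Genericity says that no facet is vertical, so each one lies on the upper or on the lower side and
  each side projects injectively.\<close>

locale shadow =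
  fixes P :: "(real^3) set" and u v a b :: "real^3"
  assumes P: "polyhedron P" and dim: "aff_dim P = 3"
    and opt_a: "optimal_face P a = {u}" and opt_b: "optimal_face P b = {v}"
    and ab: "cross3 a b \<noteq> 0"
    and generic: "\<And>F. F facet_of P \<Longrightarrow> facet_normal P F \<bullet> cross3 a b \<noteq> 0"
begin

definition upper :: "(real^3) set \<Rightarrow> bool" where
  "upper F \<longleftrightarrow> 0 < facet_normal P F \<bullet> cross3 a b"

text \<open>The vertices on the arc of the shadow boundary from \<^term>\<open>u\<close> to \<^term>\<open>v\<close>. They are ordered by \<^term>\<open>b\<close>.\<close>

definition chain :: "(real^3) set" where
  "chain = {p. p extreme_point_of P \<and>
     (\<exists>x y. 0 \<le> x \<and> 0 \<le> y \<and> (x, y) \<noteq> (0, 0) \<and> p \<in> optimal_face P (x *\<^sub>R a + y *\<^sub>R b))}"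

text \<open>In the coordinates given by \<open>a\<close> and \<open>b\<close>, this is the linear
  form normal to the chord, normalised to vanish at \<open>p\<close> and \<open>q\<close>. For chain
  points with \<open>p\<close> before \<open>q\<close> both coefficients are positive, so the form
  points towards the arc.\<close>

definition chord :: "real^3 \<Rightarrow> real^3 \<Rightarrow> real^3 \<Rightarrow> real" where
  "chord p q x = (b \<bullet> q - b \<bullet> p) * (a \<bullet> x - a \<bullet> p) + (a \<bullet> p - a \<bullet> q) * (b \<bullet> x - b \<bullet> p)"

text \<open>The part of \<^term>\<open>P\<close> that the chord cuts off on the side of the arc from \<^term>\<open>p\<close> to \<^term>\<open>q\<close>.\<close>

definition cap :: "real^3 \<Rightarrow> real^3 \<Rightarrow> (real^3) set" where
  "cap p q = {x \<in> P. 0 \<le> chord p q x}"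

lemma convex_P: "convex P"
  using P polyhedron_imp_convex by blast

lemma facet_subset: "F facet_of P \<Longrightarrow> x \<in> F \<Longrightarrow> x \<in> P"
  using facet_of_imp_subset by blast

lemma combination_nonzero:
  assumes "(x, y) \<noteq> (0, 0)"
  shows "x *\<^sub>R a + y *\<^sub>R b \<noteq> 0"
proof
  assume 0: "x *\<^sub>R a + y *\<^sub>R b = 0"
  then have "cross3 (x *\<^sub>R a + y *\<^sub>R b) b = 0" "cross3 a (x *\<^sub>R a + y *\<^sub>R b) = 0"
    by simp_all
  then have "x *\<^sub>R cross3 a b = 0" "y *\<^sub>R cross3 a b = 0"
    by (simp_all add: cross_add_left cross_add_right cross_mult_left cross_mult_right)
  then show False
    using ab assms by auto
qed

lemma optimal_proper: "c \<noteq> 0 \<Longrightarrow> optimal_face P c \<noteq> P"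
  using optimal_face_proper [of P c] dim by simp

lemma shadow_fibre:
  assumes "x \<in> P" "y \<in> P" "a \<bullet> x = a \<bullet> y" "b \<bullet> x = b \<bullet> y"
  obtains t where "y = x + t *\<^sub>R cross3 a b"
proof -
  obtain t where "y - x = t *\<^sub>R cross3 a b"
    using parallel_to_cross3 [of a "y - x" b] assms ab by (auto simp: inner_diff_right)
  then show thesis
    using that [of t] by (simp add: algebra_simps)
qed

text \<open>The optimal face of a combination of \<open>a\<close> and \<open>b\<close> contains the
  part of the fibre in \<open>P\<close> and lies in a facet; no facet is vertical, so this part is a
  single point.\<close>

lemma boundary_fibre:
  assumes p: "p \<in> optimal_face P (x *\<^sub>R a + y *\<^sub>R b)" and xy: "(x, y) \<noteq> (0, 0)"
    and z: "z \<in> P" "a \<bullet> z = a \<bullet> p" "b \<bullet> z = b \<bullet> p"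
  shows "z = p"
proof -
  let ?c = "x *\<^sub>R a + y *\<^sub>R b"
  have pP: "p \<in> P"
    using p optimal_face_subset by blast
  have zo: "z \<in> optimal_face P ?c"
    using p z by (auto simp: optimal_face_def inner_left_distrib)
  have "optimal_face P ?c face_of P" "optimal_face P ?c \<noteq> {}" "optimal_face P ?c \<noteq> P"
    using optimal_face_face_of [OF convex_P] optimal_proper [OF combination_nonzero [OF xy]] p by auto
  then obtain F where F: "F facet_of P" "optimal_face P ?c \<subseteq> F"
    using face_of_polyhedron_subset_facet [OF P] by metis
  obtain t where t: "z = p + t *\<^sub>R cross3 a b"
    using shadow_fibre [OF pP z(1)] z by metis
  have "facet_normal P F \<bullet> z = facet_normal P F \<bullet> p"
    using facet_normal_eq [OF P F(1)] F(2) zo p by (metis subsetD)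
  then have "t = 0"
    using t generic [OF F(1)] by (simp add: inner_simps)
  then show ?thesis
    using t by simp
qed

text \<open>A point on an upper facet is the top end of its fibre in \<open>P\<close>, and one on a
  lower facet is the bottom end.\<close>

lemma same_side_fibre:
  assumes F: "F facet_of P" "x \<in> F" and G: "G facet_of P" "y \<in> G"
    and side: "upper F = upper G" and eq: "a \<bullet> x = a \<bullet> y" "b \<bullet> x = b \<bullet> y"
  shows "x = y"
proof -
  have xy: "x \<in> P" "y \<in> P"
    using F G facet_subset by blast+
  obtain t where t: "y = x + t *\<^sub>R cross3 a b"
    using shadow_fibre [OF xy eq] .
  have "facet_normal P F \<bullet> y \<le> facet_normal P F \<bullet> x" "facet_normal P G \<bullet> x \<le> facet_normal P G \<bullet> y"
    using facet_normal_le [OF P] facet_normal_eq [OF P] F G xy by simp_all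
  then have "t * (facet_normal P F \<bullet> cross3 a b) \<le> 0" "0 \<le> t * (facet_normal P G \<bullet> cross3 a b)"
    using t by (simp_all add: inner_simps)
  then have "t = 0"
    using side generic [OF F(1)] generic [OF G(1)]
    by (auto simp: upper_def mult_le_0_iff zero_le_mult_iff)
  then show ?thesis
    using t by simp
qed

section \<open>Order and convexity of the chain\<close>

lemma chainE:
  assumes "p \<in> chain"
  obtains x y where "0 \<le> x" "0 \<le> y" "(x, y) \<noteq> (0, 0)" "p \<in> optimal_face P (x *\<^sub>R a + y *\<^sub>R b)"
    "\<And>z. z \<in> P \<Longrightarrow> x * (a \<bullet> z - a \<bullet> p) + y * (b \<bullet> z - b \<bullet> p) \<le> 0"
proof -
  obtain x y where xy: "0 \<le> x" "0 \<le> y" "(x, y) \<noteq> (0, 0)" "p \<in> optimal_face P (x *\<^sub>R a + y *\<^sub>R b)"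
    using assms by (auto simp: chain_def)
  moreover have "x * (a \<bullet> z - a \<bullet> p) + y * (b \<bullet> z - b \<bullet> p) \<le> 0" if "z \<in> P" for z
    using optimal_faceD [OF xy(4) that] by (simp add: inner_left_distrib algebra_simps)
  ultimately show thesis
    using that by blast
qed

lemma chain_vertex: "p \<in> chain \<Longrightarrow> p extreme_point_of P"
  and chain_in: "p \<in> chain \<Longrightarrow> p \<in> P"
  by (auto simp: chain_def extreme_point_of_def)

lemma chain_fibre:
  assumes "p \<in> chain" "z \<in> P" "a \<bullet> z = a \<bullet> p" "b \<bullet> z = b \<bullet> p"
  shows "z = p"
  using chainE [OF assms(1)] boundary_fibre assms by metis

lemma opt_aD: "z \<in> P \<Longrightarrow> a \<bullet> z = a \<bullet> u \<Longrightarrow> z = u"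
  and opt_bD: "z \<in> P \<Longrightarrow> b \<bullet> z = b \<bullet> v \<Longrightarrow> z = v"
  using opt_a opt_b by (auto simp: optimal_face_def set_eq_iff) (metis order_refl)+

text \<open>If \<open>q\<close> were at least as good as \<open>p\<close> in both coordinates, the
  support inequality at \<open>p\<close> with its nonnegative weights would make both terms vanish.
  Then the shadows coincide or one weight is 0; in the latter case \<open>p\<close> is
  \<open>u\<close> or \<open>v\<close>, the unique optimum of \<open>a\<close> or
  \<open>b\<close>.\<close>

lemma chain_order:
  assumes p: "p \<in> chain" and q: "q \<in> chain" and le: "b \<bullet> p \<le> b \<bullet> q" and "p \<noteq> q"
  shows "b \<bullet> p < b \<bullet> q" "a \<bullet> q < a \<bullet> p"
proof -
  obtain x y where xy: "0 \<le> x" "0 \<le> y" "(x, y) \<noteq> (0, 0)" "p \<in> optimal_face P (x *\<^sub>R a + y *\<^sub>R b)"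
      and pq: "x * (a \<bullet> q - a \<bullet> p) + y * (b \<bullet> q - b \<bullet> p) \<le> 0"
    using chainE [OF p] chain_in [OF q] by metis
  obtain x' y' where xy': "0 \<le> x'" "0 \<le> y'" "(x', y') \<noteq> (0, 0)" "q \<in> optimal_face P (x' *\<^sub>R a + y' *\<^sub>R b)"
      and qp: "x' * (a \<bullet> p - a \<bullet> q) + y' * (b \<bullet> p - b \<bullet> q) \<le> 0"
    using chainE [OF q] chain_in [OF p] by metis
  show aa: "a \<bullet> q < a \<bullet> p"
  proof (rule ccontr)
    assume "\<not> a \<bullet> q < a \<bullet> p"
    then have "0 \<le> x * (a \<bullet> q - a \<bullet> p)" "0 \<le> y * (b \<bullet> q - b \<bullet> p)"
      using xy le by simp_all
    then have z: "x * (a \<bullet> q - a \<bullet> p) = 0" "y * (b \<bullet> q - b \<bullet> p) = 0"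
      using pq by linarith+
    consider "a \<bullet> q = a \<bullet> p" "b \<bullet> q = b \<bullet> p" | "x = 0" "b \<bullet> q = b \<bullet> p" | "y = 0" "a \<bullet> q = a \<bullet> p"
      using z xy(3) by auto
    then show False
    proof cases
      case 1
      then show ?thesis
        using chain_fibre [OF p chain_in [OF q]] \<open>p \<noteq> q\<close> by simp
    next
      case 2
      then have "p \<in> optimal_face P b"
        using xy optimal_face_scale [of y P b] by simp
      then have "p = v"
        using opt_b by simp
      then show ?thesis
        using 2 opt_bD [of q] chain_in [OF q] \<open>p \<noteq> q\<close> by simp
    next
      case 3
      then have "p \<in> optimal_face P a"
        using xy optimal_face_scale [of x P a] by simp
      then have "p = u"
        using opt_a by simp
      then show ?thesis
        using 3 opt_aD [of q] chain_in [OF q] \<open>p \<noteq> q\<close> by simp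
    qed
  qed
  show "b \<bullet> p < b \<bullet> q"
  proof (rule ccontr)
    assume "\<not> b \<bullet> p < b \<bullet> q"
    then have eq: "b \<bullet> p = b \<bullet> q"
      using le by simp
    then have "x' * (a \<bullet> p - a \<bullet> q) \<le> 0"
      using qp by simp
    then have "x' = 0"
      using aa xy'(1) by (simp add: mult_le_0_iff)
    then have "q \<in> optimal_face P b"
      using xy' optimal_face_scale [of y' P b] by simp
    then have "q = v"
      using opt_b by simp
    then show False
      using eq opt_bD [of p] chain_in [OF p] \<open>p \<noteq> q\<close> by simp
  qed
qed

lemma chain_eqI: "p \<in> chain \<Longrightarrow> q \<in> chain \<Longrightarrow> b \<bullet> p = b \<bullet> q \<Longrightarrow> p = q"
  using chain_order(1) [of p q] by force

lemma chain_decreasing: "p \<in> chain \<Longrightarrow> q \<in> chain \<Longrightarrow> b \<bullet> p < b \<bullet> q \<Longrightarrow> a \<bullet> q < a \<bullet> p"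
  using chain_order(2) [of p q] by force

text \<open>The support inequality at \<open>r\<close>, applied to \<open>p\<close> and to
  \<open>q\<close>, compares both slopes with the same ratio of weights, and multiplying gives the
  weak inequality. Equality would put the shadow of \<open>r\<close> inside the chord, hence
  \<open>r\<close> inside the segment from \<open>p\<close> to \<open>q\<close>, as only one point
  of \<open>P\<close> lies over the shadow of \<open>r\<close>.\<close>

lemma chain_convex:
  assumes p: "p \<in> chain" and r: "r \<in> chain" and q: "q \<in> chain"
    and pr: "b \<bullet> p < b \<bullet> r" and rq: "b \<bullet> r < b \<bullet> q"
  shows "(a \<bullet> p - a \<bullet> r) * (b \<bullet> q - b \<bullet> r) < (a \<bullet> r - a \<bullet> q) * (b \<bullet> r - b \<bullet> p)"
proof -
  define A B A' B' where "A = a \<bullet> p - a \<bullet> r" and "B = b \<bullet> r - b \<bullet> p"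
    and "A' = a \<bullet> r - a \<bullet> q" and "B' = b \<bullet> q - b \<bullet> r"
  have pos: "0 < A" "0 < B" "0 < A'" "0 < B'"
    using pr rq chain_decreasing [OF p r pr] chain_decreasing [OF r q rq]
    by (simp_all add: A_def B_def A'_def B'_def)
  obtain x y where xy: "0 \<le> x" "0 \<le> y" "(x, y) \<noteq> (0, 0)" "r \<in> optimal_face P (x *\<^sub>R a + y *\<^sub>R b)"
      and le: "x * (a \<bullet> p - a \<bullet> r) + y * (b \<bullet> p - b \<bullet> r) \<le> 0" "x * (a \<bullet> q - a \<bullet> r) + y * (b \<bullet> q - b \<bullet> r) \<le> 0"
    using chainE [OF r] chain_in [OF p] chain_in [OF q] by metis
  have le': "x * A \<le> y * B" "y * B' \<le> x * A'"
    using le by (simp_all add: A_def B_def A'_def B'_def algebra_simps)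
  have "0 < x"
  proof (rule ccontr)
    assume "\<not> 0 < x"
    then have "x = 0" "0 < y"
      using xy by auto
    then show False
      using le'(2) pos by (simp add: mult_le_0_iff)
  qed
  moreover have "0 < y"
  proof (rule ccontr)
    assume "\<not> 0 < y"
    then have "y = 0"
      using xy by auto
    then show False
      using le'(1) pos \<open>0 < x\<close> by (simp add: mult_le_0_iff)
  qed
  moreover have "(x * A) * (y * B') \<le> (y * B) * (x * A')"
    using mult_mono [OF le'] pos xy by simp
  then have "(x * y) * (A * B') \<le> (x * y) * (A' * B)"
    by (simp add: algebra_simps)
  ultimately have "A * B' \<le> A' * B"
    by simp
  moreover have "A * B' \<noteq> A' * B"
  proof
    assume eq: "A * B' = A' * B"
    define \<theta> where "\<theta> = A / (A + A')"
    have \<theta>: "0 < \<theta>" "\<theta> < 1" "\<theta> * (A + A') = A"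
      using pos by (simp_all add: \<theta>_def)
    have "\<theta> * (B + B') = B"
      using pos eq by (simp add: \<theta>_def field_simps)
    let ?z = "(1 - \<theta>) *\<^sub>R p + \<theta> *\<^sub>R q"
    have "?z \<in> P"
      using convex_P chain_in [OF p] chain_in [OF q] \<theta> by (intro convexD_alt) auto
    moreover have "a \<bullet> ?z = a \<bullet> r"
      using \<theta>(3) by (simp add: A_def A'_def inner_simps algebra_simps)
    moreover have "b \<bullet> ?z = b \<bullet> r"
      using \<open>\<theta> * (B + B') = B\<close> by (simp add: B_def B'_def inner_simps algebra_simps)
    ultimately have "?z = r"
      using chain_fibre [OF r] by blast
    moreover have "p \<noteq> q"
      using pr rq by auto
    ultimately have "r \<in> open_segment p q"
      unfolding in_segment using \<theta> by auto
    then show False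
      using chain_vertex [OF r] chain_in [OF p] chain_in [OF q] by (auto simp: extreme_point_of_def)
  qed
  ultimately show ?thesis
    by (simp add: A_def B_def A'_def B'_def)
qed

section \<open>Chords and caps\<close>

lemma chord_between:
  assumes "p \<in> chain" "r \<in> chain" "q \<in> chain" "b \<bullet> p < b \<bullet> r" "b \<bullet> r < b \<bullet> q"
  shows "0 < chord p q r"
  using chain_convex [OF assms] by (simp add: chord_def algebra_simps)

lemma chord_beyond:
  assumes "p \<in> chain" "q \<in> chain" "r \<in> chain" "b \<bullet> p < b \<bullet> q" "b \<bullet> q < b \<bullet> r"
  shows "chord p q r < 0"
  using chain_convex [OF assms] by (simp add: chord_def algebra_simps)

lemma chord_before:
  assumes "r \<in> chain" "p \<in> chain" "q \<in> chain" "b \<bullet> r < b \<bullet> p" "b \<bullet> p < b \<bullet> q"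
  shows "chord p q r < 0"
  using chain_convex [OF assms] by (simp add: chord_def algebra_simps)

lemma chord_ends [simp]: "chord p q p = 0" "chord p q q = 0"
  by (simp_all add: chord_def algebra_simps)

lemma chord_affine:
  "chord p q ((1 - t) *\<^sub>R x + t *\<^sub>R y) = (1 - t) * chord p q x + t * chord p q y"
  by (simp add: chord_def inner_simps algebra_simps)

text \<open>Only the shadow of \<open>w\<close> is located; \<open>z\<close> may lie at another
  height. If that shadow were on the line but outside the chord, one end of the chord would lie
  strictly between \<open>w\<close> and the other end and could not be extreme.\<close>

lemma chord_zero:
  assumes p: "p \<in> chain" and q: "q \<in> chain" and pq: "b \<bullet> p < b \<bullet> q"
    and w: "w \<in> P" "chord p q w = 0"
  obtains z where "z \<in> closed_segment p q" "a \<bullet> z = a \<bullet> w" "b \<bullet> z = b \<bullet> w"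
proof -
  define A B where "A = a \<bullet> p - a \<bullet> q" and "B = b \<bullet> q - b \<bullet> p"
  have pos: "0 < A" "0 < B"
    using pq chain_decreasing [OF p q pq] by (simp_all add: A_def B_def)
  define \<xi> where "\<xi> = (b \<bullet> w - b \<bullet> p) / B"
  have bw: "b \<bullet> w = b \<bullet> p + \<xi> * B"
    using pos by (simp add: \<xi>_def)
  have "B * (a \<bullet> w - a \<bullet> p) + A * (\<xi> * B) = 0"
    using w(2) bw by (simp add: chord_def A_def B_def)
  then have "B * (a \<bullet> w - a \<bullet> p + A * \<xi>) = 0"
    by (simp add: algebra_simps)
  then have "a \<bullet> w - a \<bullet> p + A * \<xi> = 0"
    using pos by (metis less_irrefl mult_eq_0_iff)
  then have aw: "a \<bullet> w = a \<bullet> p - \<xi> * A"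
    by (simp add: algebra_simps)
  have nle: False if r: "r \<in> chain" and s: "s \<in> P" "s \<noteq> w" and \<theta>: "0 < \<theta>" "\<theta> < 1"
    "a \<bullet> r = (1 - \<theta>) * (a \<bullet> w) + \<theta> * (a \<bullet> s)" "b \<bullet> r = (1 - \<theta>) * (b \<bullet> w) + \<theta> * (b \<bullet> s)" for r s \<theta>
  proof -
    let ?z = "(1 - \<theta>) *\<^sub>R w + \<theta> *\<^sub>R s"
    have "?z \<in> P"
      using convex_P w s \<theta> by (intro convexD_alt) auto
    then have "?z = r"
      using chain_fibre [OF r] \<theta> by (simp add: inner_simps)
    then have "r \<in> open_segment w s"
      unfolding in_segment using \<theta> s by auto
    then show False
      using chain_vertex [OF r] w s by (auto simp: extreme_point_of_def)
  qed
  have "0 \<le> \<xi>"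
  proof (rule ccontr)
    assume neg: "\<not> 0 \<le> \<xi>"
    define \<theta> where "\<theta> = - \<xi> / (1 - \<xi>)"
    have \<theta>: "0 < \<theta>" "\<theta> < 1" "\<theta> * (1 - \<xi>) = - \<xi>"
      using neg by (simp_all add: \<theta>_def field_simps)
    have "(1 - \<theta>) * \<xi> + \<theta> = 0"
      using \<theta>(3) by (simp add: algebra_simps)
    then have "(1 - \<theta>) * (a \<bullet> w) + \<theta> * (a \<bullet> q) = a \<bullet> p" "(1 - \<theta>) * (b \<bullet> w) + \<theta> * (b \<bullet> q) = b \<bullet> p"
      unfolding aw bw A_def B_def by algebra+
    moreover have "\<xi> * B < 0"
      using neg pos by (simp add: mult_neg_pos)
    then have "q \<noteq> w"
      using bw pq by auto
    ultimately show False
      using nle [OF p chain_in [OF q] _ \<theta>(1,2)] by simp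
  qed
  moreover have "\<xi> \<le> 1"
  proof (rule ccontr)
    assume gt: "\<not> \<xi> \<le> 1"
    define \<theta> where "\<theta> = (\<xi> - 1) / \<xi>"
    have \<theta>: "0 < \<theta>" "\<theta> < 1" "\<theta> * \<xi> = \<xi> - 1"
      using gt by (simp_all add: \<theta>_def field_simps)
    have "(1 - \<theta>) * \<xi> = 1"
      using \<theta>(3) by (simp add: algebra_simps)
    then have "(1 - \<theta>) * (a \<bullet> w) + \<theta> * (a \<bullet> p) = a \<bullet> q" "(1 - \<theta>) * (b \<bullet> w) + \<theta> * (b \<bullet> p) = b \<bullet> q"
      unfolding aw bw A_def B_def by algebra+
    moreover have "p \<noteq> w"
      using bw gt pos by auto
    ultimately show False
      using nle [OF q chain_in [OF p] _ \<theta>(1,2)] by simp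
  qed
  ultimately have "(1 - \<xi>) *\<^sub>R p + \<xi> *\<^sub>R q \<in> closed_segment p q"
    unfolding in_segment by blast
  then show thesis
    by (rule that) (simp_all add: aw bw A_def B_def inner_simps algebra_simps)
qed

text \<open>\<open>G\<close> has a point \<open>w\<close> over the chord, and so does
  \<open>M\<close>, which contains the segment from \<open>p\<close> to \<open>q\<close>. Being on
  the same side, the two points agree. So \<open>w\<close> is inside this segment, and the face
  \<open>G\<close> contains its ends.\<close>

lemma chord_crossing:
  assumes M: "M facet_of P" "p \<in> M" "q \<in> M" and G: "G facet_of P" and side: "upper M = upper G"
    and p: "p \<in> chain" and q: "q \<in> chain" and pq: "b \<bullet> p < b \<bullet> q"
    and xy: "x \<in> G" "y \<in> G" "0 < chord p q x" "chord p q y < 0"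
  shows "p \<in> G" "q \<in> G"
proof -
  define t where "t = chord p q x / (chord p q x - chord p q y)"
  have t: "0 < t" "t < 1" "t * (chord p q x - chord p q y) = chord p q x"
    using xy by (simp_all add: t_def)
  define w where "w = (1 - t) *\<^sub>R x + t *\<^sub>R y"
  have "chord p q w = 0"
    unfolding w_def chord_affine using t(3) by (simp add: algebra_simps)
  have wxy: "w \<in> open_segment x y"
    unfolding in_segment w_def using t xy by auto
  have "convex G"
    using G facet_of_imp_face_of face_of_imp_convex by blast
  then have "w \<in> G"
    unfolding w_def using xy t by (intro convexD_alt) auto
  then have "w \<in> P"
    using facet_subset [OF G] by blast
  obtain z where z: "z \<in> closed_segment p q" "a \<bullet> z = a \<bullet> w" "b \<bullet> z = b \<bullet> w"
    using chord_zero [OF p q pq \<open>w \<in> P\<close> \<open>chord p q w = 0\<close>] .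
  have "convex M"
    using M facet_of_imp_face_of face_of_imp_convex by blast
  then have "z \<in> M"
    using z(1) M closed_segment_subset by blast
  then have "z = w"
    using same_side_fibre [OF M(1) _ G \<open>w \<in> G\<close> side z(2,3)] by blast
  moreover have "w \<noteq> p" "w \<noteq> q"
    using wxy chain_vertex [OF p] chain_vertex [OF q] xy facet_subset [OF G]
    by (auto simp: extreme_point_of_def)
  ultimately have "w \<in> open_segment p q"
    using z(1) by (simp add: open_segment_def)
  then show "p \<in> G" "q \<in> G"
    using face_ofD [OF facet_of_imp_face_of [OF G]] \<open>w \<in> G\<close> chain_in p q by blast+
qed

text \<open>Planarity enters here: crossing chords of the shadow in two facets on the same side would
  meet in a common point of these facets.\<close>

lemma no_interleaving:
  assumes FG: "F facet_of P" "G facet_of P" "F \<noteq> G" "upper F = upper G"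
    and c: "i \<in> chain" "j \<in> chain" "k \<in> chain" "l \<in> chain" "i \<in> F" "k \<in> F" "j \<in> G" "l \<in> G"
    and less: "b \<bullet> i < b \<bullet> j" "b \<bullet> j < b \<bullet> k" "b \<bullet> k < b \<bullet> l"
  shows False
proof -
  have "b \<bullet> i < b \<bullet> k" "b \<bullet> j < b \<bullet> l"
    using less by linarith+
  have "0 < chord i k j" "chord i k l < 0"
    using chord_between chord_beyond c less by auto
  then have "i \<in> G" "k \<in> G"
    using chord_crossing [OF FG(1) c(5,6) FG(2,4) c(1,3) \<open>b \<bullet> i < b \<bullet> k\<close>] c by blast+
  moreover have "0 < chord j l k" "chord j l i < 0"
    using chord_between chord_before c less by auto
  then have "j \<in> F"
    using chord_crossing [OF FG(2) c(7,8) FG(1) FG(4)[symmetric] c(2,4) \<open>b \<bullet> j < b \<bullet> l\<close>] c by blast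
  moreover have "j \<noteq> i" "k \<noteq> i" "k \<noteq> j"
    using less by auto
  ultimately show False
    using two_facets_no_three_vertices [OF P dim FG(1-3), of i j k] chain_vertex c by blast
qed

text \<open>The chord and the supporting lines at \<open>p\<close> and \<open>q\<close> confine the
  shadow of the cap to a triangle. As the weights of the supporting lines are nonnegative, it lies
  in the rectangle with opposite corners \<open>p\<close> and \<open>q\<close>.\<close>

lemma cap_bounds:
  assumes p: "p \<in> chain" and q: "q \<in> chain" and pq: "b \<bullet> p < b \<bullet> q" and w: "w \<in> cap p q"
  shows "b \<bullet> p \<le> b \<bullet> w" "b \<bullet> w \<le> b \<bullet> q" "a \<bullet> q \<le> a \<bullet> w" "a \<bullet> w \<le> a \<bullet> p"
proof -
  define A B where "A = a \<bullet> p - a \<bullet> q" and "B = b \<bullet> q - b \<bullet> p"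
  have pos: "0 < A" "0 < B"
    using pq chain_decreasing [OF p q pq] by (simp_all add: A_def B_def)
  have wP: "w \<in> P" and c0: "0 \<le> chord p q w"
    using w by (auto simp: cap_def)
  obtain x y where xy: "0 \<le> x" "0 \<le> y" "(x, y) \<noteq> (0, 0)"
      and le: "x * (a \<bullet> w - a \<bullet> q) + y * (b \<bullet> w - b \<bullet> q) \<le> 0" "x * (a \<bullet> p - a \<bullet> q) + y * (b \<bullet> p - b \<bullet> q) \<le> 0"
    using chainE [OF q] chain_in [OF p] wP by metis
  obtain x' y' where xy': "0 \<le> x'" "0 \<le> y'" "(x', y') \<noteq> (0, 0)"
      and le': "x' * (a \<bullet> w - a \<bullet> p) + y' * (b \<bullet> w - b \<bullet> p) \<le> 0" "x' * (a \<bullet> q - a \<bullet> p) + y' * (b \<bullet> q - b \<bullet> p) \<le> 0"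
    using chainE [OF p] chain_in [OF q] wP by metis
  have xA: "x * A \<le> y * B" and yB': "y' * B \<le> x' * A"
    using le le' by (simp_all add: A_def B_def algebra_simps)
  have "0 < y"
  proof (rule ccontr)
    assume "\<not> 0 < y"
    then have "y = 0" "0 < x"
      using xy by auto
    then show False
      using xA pos by (simp add: mult_le_0_iff)
  qed
  have "0 < x'"
  proof (rule ccontr)
    assume "\<not> 0 < x'"
    then have "x' = 0" "0 < y'"
      using xy' by auto
    then show False
      using yB' pos by (simp add: mult_le_0_iff)
  qed
  have "a \<bullet> q \<le> a \<bullet> w \<and> b \<bullet> p \<le> b \<bullet> w"
  proof (cases "chord p q w = 0")
    case True
    then obtain z where z: "z \<in> closed_segment p q" "a \<bullet> z = a \<bullet> w" "b \<bullet> z = b \<bullet> w"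
      using chord_zero [OF p q pq wP] by blast
    then obtain t where t: "0 \<le> t" "t \<le> 1" "z = (1 - t) *\<^sub>R p + t *\<^sub>R q"
      by (auto simp: in_segment)
    have "a \<bullet> z = a \<bullet> q + (1 - t) * A" "b \<bullet> z = b \<bullet> p + t * B"
      unfolding t(3) by (simp_all add: A_def B_def inner_simps algebra_simps)
    moreover have "0 \<le> (1 - t) * A" "0 \<le> t * B"
      using t pos by simp_all
    ultimately show ?thesis
      using z by linarith
  next
    case False
    then have cpos: "0 < chord p q w"
      using c0 by simp
    have "a \<bullet> q \<le> a \<bullet> w"
    proof (rule ccontr)
      assume neg: "\<not> a \<bullet> q \<le> a \<bullet> w"
      define D E where "D = a \<bullet> q - a \<bullet> w" and "E = b \<bullet> w - b \<bullet> q"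
      have "0 < D"
        using neg by (simp add: D_def)
      have 1: "B * D < A * E"
        using cpos by (simp add: chord_def A_def B_def D_def E_def algebra_simps)
      have 2: "y * E \<le> x * D"
        using le(1) by (simp add: D_def E_def algebra_simps)
      have "y * (B * D) < y * (A * E)"
        using 1 \<open>0 < y\<close> by simp
      also have "\<dots> = A * (y * E)"
        by simp
      also have "\<dots> \<le> A * (x * D)"
        using 2 pos by (intro mult_left_mono) auto
      also have "\<dots> = (x * A) * D"
        by simp
      also have "\<dots> \<le> (y * B) * D"
        using xA \<open>0 < D\<close> by (intro mult_right_mono) auto
      finally show False
        by (simp add: algebra_simps)
    qed
    moreover have "b \<bullet> p \<le> b \<bullet> w"
    proof (rule ccontr)
      assume neg: "\<not> b \<bullet> p \<le> b \<bullet> w"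
      define D E where "D = b \<bullet> p - b \<bullet> w" and "E = a \<bullet> w - a \<bullet> p"
      have "0 < D"
        using neg by (simp add: D_def)
      have 1: "A * D < B * E"
        using cpos by (simp add: chord_def A_def B_def D_def E_def algebra_simps)
      have 2: "x' * E \<le> y' * D"
        using le'(1) by (simp add: D_def E_def algebra_simps)
      have "x' * (A * D) < x' * (B * E)"
        using 1 \<open>0 < x'\<close> by simp
      also have "\<dots> = B * (x' * E)"
        by simp
      also have "\<dots> \<le> B * (y' * D)"
        using 2 pos by (intro mult_left_mono) auto
      also have "\<dots> = (y' * B) * D"
        by simp
      also have "\<dots> \<le> (x' * A) * D"
        using yB' \<open>0 < D\<close> by (intro mult_right_mono) auto
      finally show False
        by (simp add: algebra_simps)
    qed
    ultimately show ?thesis by simp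
  qed
  then show qw: "a \<bullet> q \<le> a \<bullet> w" and pw: "b \<bullet> p \<le> b \<bullet> w"
    by blast+
  have "0 \<le> x * (a \<bullet> w - a \<bullet> q)" "0 \<le> y' * (b \<bullet> w - b \<bullet> p)"
    using qw pw xy xy' by simp_all
  then have "y * (b \<bullet> w - b \<bullet> q) \<le> 0" "x' * (a \<bullet> w - a \<bullet> p) \<le> 0"
    using le(1) le'(1) by linarith+
  then show "b \<bullet> w \<le> b \<bullet> q" "a \<bullet> w \<le> a \<bullet> p"
    using \<open>0 < y\<close> \<open>0 < x'\<close> by (simp_all add: mult_le_0_iff)
qed

text \<open>The bounding rectangles of successive arcs share at most a corner, and over a chain
  point there is only one point of \<open>P\<close>.\<close>

lemma cap_Int_cap:
  assumes c: "p \<in> chain" "q \<in> chain" "p' \<in> chain" "q' \<in> chain"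
    and le: "b \<bullet> p < b \<bullet> q" "b \<bullet> q \<le> b \<bullet> p'" "b \<bullet> p' < b \<bullet> q'" and w: "w \<in> cap p q" "w \<in> cap p' q'"
  shows "w = q" "w = p'"
proof -
  note 1 = cap_bounds [OF c(1,2) le(1) w(1)] and 2 = cap_bounds [OF c(3,4) le(3) w(2)]
  have eq: "b \<bullet> q = b \<bullet> p'"
    using 1 2 le by linarith
  then have "q = p'"
    using chain_eqI c by blast
  moreover have "a \<bullet> w = a \<bullet> q" "b \<bullet> w = b \<bullet> q"
    using 1 2 unfolding \<open>q = p'\<close> by linarith+
  then have "w = q"
    using chain_fibre [OF c(2)] w by (simp add: cap_def)
  ultimately show "w = q" "w = p'"
    by simp_all
qed

text \<open>On the side of \<open>M\<close>, a facet \<open>H\<close> crossing the chord would share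
  \<open>p\<close>, \<open>q\<close> and \<open>w\<close> with \<open>M\<close>, one vertex too many
  for an edge. On the other side, a positive combination of the two normals is orthogonal to the
  projection direction and exposes \<open>M \<inter> H\<close>, so \<open>w\<close> is on the shadow
  boundary; its place in the cap puts it on the arc.\<close>

lemma vertex_in_cap:
  assumes M: "M facet_of P" "p \<in> M" "q \<in> M" and H: "H facet_of P" "H \<noteq> M"
    and p: "p \<in> chain" and q: "q \<in> chain" and pq: "b \<bullet> p < b \<bullet> q"
    and w: "w extreme_point_of P" "w \<in> M" "w \<in> H" "w \<in> cap p q"
  shows "H \<subseteq> cap p q \<or> w \<in> chain"
proof -
  have wP: "w \<in> P" and c0: "0 \<le> chord p q w"
    using w by (auto simp: cap_def)
  show ?thesis
  proof (cases "chord p q w = 0")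
    case True
    obtain z where z: "z \<in> closed_segment p q" "a \<bullet> z = a \<bullet> w" "b \<bullet> z = b \<bullet> w"
      using chord_zero [OF p q pq wP True] .
    have "convex M"
      using M facet_of_imp_face_of face_of_imp_convex by blast
    then have "z \<in> M"
      using z(1) M closed_segment_subset by blast
    then have "z = w"
      using same_side_fibre [OF M(1) _ M(1) w(2) refl z(2,3)] by blast
    then have "w = p \<or> w = q"
      using z(1) w(1) chain_in [OF p] chain_in [OF q] by (auto simp: extreme_point_of_def open_segment_def)
    then show ?thesis
      using p q by blast
  next
    case False
    then have cpos: "0 < chord p q w"
      using c0 by simp
    then have ne: "w \<noteq> p" "w \<noteq> q" "p \<noteq> q"
      using pq by auto
    show ?thesis
    proof (cases "upper H = upper M")
      case True
      have "0 \<le> chord p q y" if y: "y \<in> H" for y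
      proof (rule ccontr)
        assume "\<not> 0 \<le> chord p q y"
        then have "p \<in> H" "q \<in> H"
          using chord_crossing [OF M H(1) True[symmetric] p q pq w(3) y cpos] by simp_all
        then show False
          using two_facets_no_three_vertices [OF P dim H(1) M(1) H(2), of p q w] ne w M
            chain_vertex [OF p] chain_vertex [OF q] by blast
      qed
      then have "H \<subseteq> cap p q"
        using facet_subset [OF H(1)] by (auto simp: cap_def)
      then show ?thesis ..
    next
      case False
      define m h where "m = facet_normal P M \<bullet> cross3 a b" and "h = facet_normal P H \<bullet> cross3 a b"
      have mh: "0 < \<bar>m\<bar>" "0 < \<bar>h\<bar>" "\<bar>h\<bar> * m + \<bar>m\<bar> * h = 0"
        using generic [OF M(1)] generic [OF H(1)] False by (auto simp: m_def h_def upper_def)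
      \<comment> \<open>The coefficients cancel the component along \<open>cross3 a b\<close>, so
        \<open>d\<close> is a combination of \<open>a\<close> and \<open>b\<close>.\<close>
      define d where "d = \<bar>h\<bar> *\<^sub>R facet_normal P M + \<bar>m\<bar> *\<^sub>R facet_normal P H"
      have "w \<in> optimal_face P (facet_normal P M)" "w \<in> optimal_face P (facet_normal P H)"
        using facet_eq_optimal_face [OF P M(1)] facet_eq_optimal_face [OF P H(1)] w by auto
      then have od: "optimal_face P d = M \<inter> H"
        unfolding d_def using mh facet_eq_optimal_face [OF P M(1)] facet_eq_optimal_face [OF P H(1)]
        by (subst optimal_face_combination [where x = w]) auto
      have "d \<noteq> 0"
      proof
        assume "d = 0"
        then have "optimal_face P d = P"
          by (auto simp: optimal_face_def)
        then have "P \<subseteq> M"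
          using od by blast
        then have "M = P"
          using facet_of_imp_subset [OF M(1)] by blast
        then show False
          using M(1) by simp
      qed
      have "d \<bullet> cross3 a b = 0"
        using mh(3) by (simp add: d_def inner_left_distrib m_def h_def)
      then obtain x y where d: "d = x *\<^sub>R a + y *\<^sub>R b"
        using orthogonal_to_cross3 [OF _ ab] by metis
      have wd: "w \<in> optimal_face P d"
        using od w by blast
      define A B A' B' where "A = a \<bullet> p - a \<bullet> w" and "B = b \<bullet> w - b \<bullet> p"
        and "A' = a \<bullet> w - a \<bullet> q" and "B' = b \<bullet> q - b \<bullet> w"
      have nn: "0 \<le> A" "0 \<le> B" "0 \<le> A'" "0 \<le> B'"
        using cap_bounds [OF p q pq w(4)] by (simp_all add: A_def B_def A'_def B'_def)
      have det: "A * B' < A' * B"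
        using cpos by (simp add: chord_def A_def B_def A'_def B'_def algebra_simps)
      then have pos: "0 < A'" "0 < B"
        using nn by (metis less_le mult_nonneg_nonneg mult_zero_left mult_zero_right not_less)+
      have "d \<bullet> p \<le> d \<bullet> w" "d \<bullet> q \<le> d \<bullet> w"
        using optimal_faceD [OF wd] chain_in p q by auto
      then have le: "x * A \<le> y * B" "y * B' \<le> x * A'"
        by (simp_all add: d A_def B_def A'_def B'_def inner_left_distrib algebra_simps)
      \<comment> \<open>A negative \<open>y\<close> would force a negative \<open>x\<close>, and the
        product of the two support inequalities would then contradict \<open>det\<close>.\<close>
      have "0 \<le> y"
      proof (rule ccontr)
        assume "\<not> 0 \<le> y"
        then have "y * B < 0"
          using pos by (simp add: mult_neg_pos)
        then have "x * A < 0"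
          using le by linarith
        then have "x < 0"
          using nn by (simp add: mult_less_0_iff)
        have "- x * A' \<le> - y * B'" "- y * B \<le> - x * A" "0 \<le> - y * B'" "0 \<le> - y * B"
          using le \<open>\<not> 0 \<le> y\<close> nn by (auto simp: mult_nonpos_nonneg)
        then have "(- x * A') * (- y * B) \<le> (- y * B') * (- x * A)"
          by (rule mult_mono)
        then have "(x * y) * (A' * B) \<le> (x * y) * (A * B')"
          by (simp add: algebra_simps)
        moreover have "0 < x * y"
          using \<open>x < 0\<close> \<open>\<not> 0 \<le> y\<close> by (simp add: mult_neg_neg)
        then have "(x * y) * (A * B') < (x * y) * (A' * B)"
          using det by (rule mult_strict_left_mono [rotated])
        ultimately show False
          by simp
      qed
      moreover have "0 \<le> x"
      proof (rule ccontr)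
        assume "\<not> 0 \<le> x"
        then have "x * A' < 0"
          using pos by (simp add: mult_neg_pos)
        moreover have "0 \<le> y * B'"
          using \<open>0 \<le> y\<close> nn by simp
        ultimately show False
          using le by linarith
      qed
      moreover have "(x, y) \<noteq> (0, 0)"
        using \<open>d \<noteq> 0\<close> d by auto
      ultimately have "w \<in> chain"
        using w(1) wd d by (auto simp: chain_def)
      then show ?thesis ..
    qed
  qed
qed

text \<open>The first section of a path runs from \<^term>\<open>J\<close> to \<^term>\<open>J'\<close> on \<^term>\<open>M\<close>, a later one from \<^term>\<open>i\<close> to \<^term>\<open>k\<close> on \<^term>\<open>N\<close>;
  \<^term>\<open>t\<close> and \<^term>\<open>s\<close> are chain points in which these facets reach far. If a facet \<^term>\<open>H\<close> meets both sections
  in \<^term>\<open>p\<close> and \<^term>\<open>q\<close>, then both are chain points, since \<^term>\<open>H\<close> lies in neither cap. Two of the three facets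
  \<^term>\<open>H\<close>, \<^term>\<open>M\<close>, \<^term>\<open>N\<close> are on the same side, and there they interleave.\<close>

lemma no_revisit:
  assumes M: "M facet_of P" "J \<in> M" "J' \<in> M" "t \<in> M" and c: "J \<in> chain" "J' \<in> chain" "t \<in> chain"
    and JJ: "b \<bullet> J < b \<bullet> J'" "b \<bullet> J' \<le> b \<bullet> t"
    and top: "\<And>r. r \<in> chain \<Longrightarrow> r \<in> M \<Longrightarrow> b \<bullet> r \<le> b \<bullet> t"
    and p: "p extreme_point_of P" "p \<in> M" "p \<in> cap J J'" "p \<noteq> J'"
    and p_low: "\<And>F r. p \<in> chain \<Longrightarrow> F facet_of P \<Longrightarrow> p \<in> F \<Longrightarrow> r \<in> F \<Longrightarrow> r \<in> chain \<Longrightarrow> b \<bullet> r \<le> b \<bullet> t"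
    and tie: "\<And>H. p = J \<Longrightarrow> H facet_of P \<Longrightarrow> H \<noteq> M \<Longrightarrow> J \<in> H \<Longrightarrow> t \<in> H \<Longrightarrow> J' = t"
    and N: "N facet_of P" "i \<in> N" "k \<in> N" "s \<in> N" and c': "i \<in> chain" "k \<in> chain" "s \<in> chain"
    and ik: "b \<bullet> J' \<le> b \<bullet> i" "b \<bullet> i < b \<bullet> k" "b \<bullet> t < b \<bullet> s"
    and q: "q extreme_point_of P" "q \<in> N" "q \<in> cap i k" "q \<noteq> i"
    and H: "H facet_of P" "p \<in> H" "q \<in> H" "J' \<notin> H"
  shows False
proof -
  have "H \<noteq> M"
    using M H by blast
  have "N \<noteq> M"
    using top [OF c'(3)] N ik by force
  have p_out: "p \<notin> cap i k"
    using cap_Int_cap(1) [OF c(1,2) c'(1,2) JJ(1) ik(1,2) p(3)] p(4) by blast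
  have q_out: "q \<notin> cap J J'"
    using cap_Int_cap(2) [OF c(1,2) c'(1,2) JJ(1) ik(1,2) _ q(3)] q(4) by blast
  have p_chain: "p \<in> chain" if "G facet_of P" "G \<noteq> M" "p \<in> G" "\<not> G \<subseteq> cap J J'" for G
    using vertex_in_cap [OF M(1-3) that(1,2) c(1,2) JJ(1) p(1,2) that(3) p(3)] that(4) by blast
  \<comment> \<open>\<open>N\<close> is not inside the cap, since \<open>k\<close> comes after
    \<open>J'\<close>, and it reaches beyond \<open>t\<close> in \<open>s\<close>, which no facet
    through a chain point \<open>p\<close> does.\<close>
  have "H \<noteq> N"
  proof
    assume "H = N"
    have "\<not> N \<subseteq> cap J J'"
    proof
      assume "N \<subseteq> cap J J'"
      then have "b \<bullet> k \<le> b \<bullet> J'"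
        using cap_bounds [OF c(1,2) JJ(1)] N by blast
      then show False
        using ik by linarith
    qed
    then have "p \<in> chain"
      using p_chain [OF N(1) \<open>N \<noteq> M\<close>] H \<open>H = N\<close> by blast
    then show False
      using p_low [OF _ N(1) _ N(4) c'(3)] H \<open>H = N\<close> ik by force
  qed
  have pc: "p \<in> chain"
    using p_chain [OF H(1) \<open>H \<noteq> M\<close> H(2)] q_out H(3) by blast
  have qc: "q \<in> chain"
    using vertex_in_cap [OF N(1-3) H(1) \<open>H \<noteq> N\<close> c'(1,2) ik(2) q(1,2) H(3) q(3)] p_out H(2) by blast
  have bp: "b \<bullet> J \<le> b \<bullet> p" "b \<bullet> p < b \<bullet> J'"
    using cap_bounds [OF c(1,2) JJ(1) p(3)] chain_eqI [OF pc c(2)] p(4) by force+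
  have bq: "b \<bullet> i < b \<bullet> q"
    using cap_bounds [OF c'(1,2) ik(2) q(3)] chain_eqI [OF qc c'(1)] q(4) by force
  have bqt: "b \<bullet> q \<le> b \<bullet> t"
    using p_low [OF pc H(1-3) qc] .
  consider "upper H = upper M" | "upper H = upper N" | "upper M = upper N"
    by blast
  then show False
  proof cases
    case 1
    show ?thesis
    proof (cases "b \<bullet> q < b \<bullet> t")
      case True
      then show ?thesis
        using no_interleaving [OF H(1) M(1) \<open>H \<noteq> M\<close> 1 pc c(2) qc c(3) H(2,3) M(3,4)] bp bq ik by linarith
    next
      case False
      \<comment> \<open>Now no point of \<open>M\<close> after \<open>q\<close> is available. The
        interleaving is taken as \<open>J\<close>, \<open>p\<close>, \<open>J'\<close>,
        \<open>q\<close> instead, which needs \<open>p\<close> different from \<open>J\<close>;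
        \<open>tie\<close> covers the remaining case.\<close>
      then have "q = t"
        using bqt chain_eqI [OF qc c(3)] by linarith
      show ?thesis
      proof (cases "p = J")
        case True
        then have "J' = t"
          using tie [OF _ H(1) \<open>H \<noteq> M\<close>] H \<open>q = t\<close> by blast
        then show ?thesis
          using bq ik bqt by simp
      next
        case False
        then have "b \<bullet> J < b \<bullet> p"
          using bp chain_eqI [OF pc c(1)] by force
        then show ?thesis
          using no_interleaving [OF M(1) H(1) \<open>H \<noteq> M\<close>[symmetric] 1[symmetric] c(1) pc c(2) qc M(2,3) H(2,3)]
            bp bq ik by linarith
      qed
    qed
  next
    case 2
    then show ?thesis
      using no_interleaving [OF H(1) N(1) \<open>H \<noteq> N\<close> 2 pc c'(1) qc c'(3) H(2,3) N(2,4)] bp bq bqt ik by linarith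
  next
    case 3
    then show ?thesis
      using no_interleaving [OF M(1) N(1) \<open>N \<noteq> M\<close>[symmetric] 3 c(1) c'(1) c(3) c'(3) M(2,4) N(2,4)]
        bp bq bqt ik JJ by linarith
  qed
qed

end

section \<open>Walks that enter a new facet at every step\<close>

lemma shortest_path:
  assumes "(x, y) \<in> R\<^sup>*"
  obtains p k where "p 0 = x" "p k = y" "\<And>i. i < k \<Longrightarrow> (p i, p (Suc i)) \<in> R"
    "\<And>i j. i < j \<Longrightarrow> j \<le> k \<Longrightarrow> p i \<noteq> p j" "\<And>i j. Suc i < j \<Longrightarrow> j \<le> k \<Longrightarrow> (p i, p j) \<notin> R"
proof -
  define k where "k = (LEAST k. (x, y) \<in> R ^^ k)"
  have "\<exists>k. (x, y) \<in> R ^^ k"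
    using assms rtrancl_imp_relpow by blast
  then have k: "(x, y) \<in> R ^^ k"
    unfolding k_def by (rule LeastI_ex)
  have least: "k \<le> m" if "(x, y) \<in> R ^^ m" for m
    unfolding k_def using that by (rule Least_le)
  obtain p where p: "p 0 = x" "p k = y" "\<And>i. i < k \<Longrightarrow> (p i, p (Suc i)) \<in> R"
    using k unfolding relpow_fun_conv by blast
  have init: "(x, p i) \<in> R ^^ i" if "i \<le> k" for i
    unfolding relpow_fun_conv using that p by (intro exI [of _ p]) auto
  have final: "(p j, y) \<in> R ^^ (k - j)" if "j \<le> k" for j
    unfolding relpow_fun_conv using that p by (intro exI [of _ "\<lambda>i. p (j + i)"]) auto
  show thesis
  proof (rule that [OF p])
    fix i j assume ij: "i < j" "j \<le> k"
    show "p i \<noteq> p j"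
    proof
      assume "p i = p j"
      then have "(x, y) \<in> R ^^ (i + (k - j))"
        unfolding relpow_add using init [of i] final [of j] ij by (auto simp: relcomp_unfold)
      then show False
        using least [of "i + (k - j)"] ij by linarith
    qed
  next
    fix i j assume ij: "Suc i < j" "j \<le> k"
    show "(p i, p j) \<notin> R"
    proof
      assume "(p i, p j) \<in> R"
      then have "(x, p j) \<in> R ^^ Suc i"
        using init [of i] ij by auto
      then have "(x, y) \<in> R ^^ (Suc i + (k - j))"
        unfolding relpow_add using final [of j] ij by (auto simp: relcomp_unfold simp del: relpow.simps)
      then show False
        using least [of "Suc i + (k - j)"] ij by linarith
    qed
  qed
qed

text \<open>A vertex is a face and hence the intersection of the facets containing it.\<close>

lemma separating_facet:
  fixes P :: "'a::euclidean_space set"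
  assumes P: "polyhedron P" and "x extreme_point_of P" "y extreme_point_of P" "x \<noteq> y"
  obtains F where "F facet_of P" "x \<in> F" "y \<notin> F"
proof -
  have "{x} face_of P" "{x} \<noteq> P"
    using assms by (auto simp: face_of_singleton extreme_point_of_def)
  then have "{x} = \<Inter>{F. F facet_of P \<and> {x} \<subseteq> F}"
    by (intro face_of_polyhedron [OF P]) auto
  then have "y \<notin> \<Inter>{F. F facet_of P \<and> {x} \<subseteq> F}"
    using \<open>x \<noteq> y\<close> by (metis singletonD)
  then show thesis
    using that by blast
qed

definition fresh_walk :: "'a::euclidean_space set \<Rightarrow> (nat \<Rightarrow> 'a) \<Rightarrow> nat \<Rightarrow> bool" where
  "fresh_walk P p k \<longleftrightarrow> (\<forall>i<k. (p i, p (Suc i)) \<in> edge_rel P) \<and>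
     (\<forall>l. 0 < l \<longrightarrow> l \<le> k \<longrightarrow> (\<exists>F. F facet_of P \<and> p l \<in> F \<and> (\<forall>i<l. p i \<notin> F)))"

lemma fresh_walk_distinct: "fresh_walk P p k \<Longrightarrow> i < l \<Longrightarrow> l \<le> k \<Longrightarrow> p i \<noteq> p l"
  unfolding fresh_walk_def by (metis gr_implies_not0 neq0_conv)

lemma fresh_walk_length:
  fixes P :: "'a::euclidean_space set"
  assumes P: "polyhedron P" and walk: "fresh_walk P p k" and p: "p 0 extreme_point_of P"
  shows "aff_dim P + int k \<le> int (card {F. F facet_of P})"
proof -
  have "\<forall>l. \<exists>F. 0 < l \<longrightarrow> l \<le> k \<longrightarrow> F facet_of P \<and> p l \<in> F \<and> (\<forall>i<l. p i \<notin> F)"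
    using walk by (auto simp: fresh_walk_def)
  then obtain F where F: "\<And>l. 0 < l \<Longrightarrow> l \<le> k \<Longrightarrow> F l facet_of P \<and> p l \<in> F l \<and> (\<forall>i<l. p i \<notin> F l)"
    by metis
  let ?S = "{F. F facet_of P \<and> p 0 \<in> F}"
  have fin: "finite {F. F facet_of P}"
    by (rule finite_polyhedron_facets [OF P])
  have "inj_on F {1..k}"
  proof (rule linorder_inj_onI)
    fix i j assume "i < j" "i \<in> {1..k}" "j \<in> {1..k}"
    then show "F i \<noteq> F j"
      using F [of i] F [of j] by auto
  qed auto
  moreover have "?S \<inter> F ` {1..k} = {}"
    using F by auto
  moreover have "finite ?S"
    by (rule finite_subset [OF _ fin]) auto
  ultimately have "card (?S \<union> F ` {1..k}) = card ?S + k"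
    by (simp add: card_Un_disjoint card_image)
  moreover have "card (?S \<union> F ` {1..k}) \<le> card {F. F facet_of P}"
    using F by (intro card_mono fin) auto
  moreover have "aff_dim P \<le> int (card ?S)"
    by (rule card_facets_at_vertex [OF P p])
  ultimately show ?thesis
    by linarith
qed

context shadow
begin

section \<open>Sections over arcs of the chain\<close>

lemma finite_chain: "finite chain"
  by (rule finite_subset [OF _ finite_polyhedron_extreme_points [OF P]]) (auto simp: chain_def)

text \<open>Deform the objective that puts \<open>J\<close> on the chain into \<open>b\<close>. When
  \<open>J\<close> ceases to be optimal, its successor shares with it a proper optimal face and
  hence a facet.\<close>

lemma chain_facet_successor:
  assumes J: "J \<in> chain" "J \<noteq> v"
  obtains q F where "q \<in> chain" "F facet_of P" "J \<in> F" "q \<in> F" "b \<bullet> J < b \<bullet> q"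
proof -
  obtain x y where xy: "0 \<le> x" "0 \<le> y" "(x, y) \<noteq> (0, 0)" "J \<in> optimal_face P (x *\<^sub>R a + y *\<^sub>R b)"
    using chainE [OF J(1)] by metis
  define c where "c = x *\<^sub>R a + y *\<^sub>R b"
  have J0: "J \<in> optimal_face P (along c b 0)"
    using xy by (simp add: c_def)
  obtain q s1 s2 where q: "q extreme_point_of P" "0 \<le> s1" "s1 < s2" "s2 \<le> 1"
    "J \<in> optimal_face P (along c b s1)" "q \<in> optimal_face P (along c b s1)"
    "q \<in> optimal_face P (along c b s2)" "J \<notin> optimal_face P (along c b s2)"
    using parametric_successor [OF P chain_vertex [OF J(1)] J0, of v] opt_b J(2) by auto
  have eq: "along c b s1 = ((1 - s1) * x) *\<^sub>R a + ((1 - s1) * y + s1) *\<^sub>R b"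
    by (simp add: along_def c_def algebra_simps)
  have nn: "0 \<le> (1 - s1) * x" "0 \<le> (1 - s1) * y + s1"
    using xy q by auto
  have nz: "((1 - s1) * x, (1 - s1) * y + s1) \<noteq> (0, 0)"
  proof
    assume z: "((1 - s1) * x, (1 - s1) * y + s1) = (0, 0)"
    have "0 \<le> (1 - s1) * y" "s1 < 1"
      using xy q by auto
    moreover have "(1 - s1) * y + s1 = 0"
      using z by simp
    ultimately have "s1 = 0"
      using q(2) by linarith
    then have "x = 0" "y = 0"
      using z by simp_all
    then show False
      using xy by simp
  qed
  have qc: "q \<in> chain"
    unfolding chain_def using q(1) q(6) [unfolded eq] nn nz by blast
  let ?G = "optimal_face P (along c b s1)"
  have "?G face_of P" "?G \<noteq> {}" "?G \<noteq> P"
    using optimal_face_face_of [OF convex_P] optimal_proper combination_nonzero [OF nz] q(5) eq by auto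
  then obtain F where F: "F facet_of P" "?G \<subseteq> F"
    using face_of_polyhedron_subset_facet [OF P] by metis
  \<comment> \<open>The tie at \<open>s1\<close> and the strict gain at \<open>s2\<close> show that
    \<open>q\<close> gains more in \<open>b\<close> than in \<open>c\<close>. Without a gain in
    \<open>b\<close> it would lose in \<open>c\<close>, and there would be no tie at
    \<open>s1\<close>.\<close>
  have "b \<bullet> J < b \<bullet> q"
  proof (rule ccontr)
    assume neg: "\<not> b \<bullet> J < b \<bullet> q"
    have 1: "(1 - s1) * (c \<bullet> J) + s1 * (b \<bullet> J) = (1 - s1) * (c \<bullet> q) + s1 * (b \<bullet> q)"
      using optimal_face_eqD [OF q(5,6)] by (simp add: inner_along)
    have "along c b s2 \<bullet> J < along c b s2 \<bullet> q"
      using q(7,8) chain_in [OF J(1)] by (force simp: optimal_face_def)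
    then have 2: "(1 - s2) * (c \<bullet> J) + s2 * (b \<bullet> J) < (1 - s2) * (c \<bullet> q) + s2 * (b \<bullet> q)"
      by (simp add: inner_along)
    have "(s2 - s1) * ((b \<bullet> q - b \<bullet> J) - (c \<bullet> q - c \<bullet> J)) > 0"
      using 1 2 by (simp add: algebra_simps)
    then have 3: "c \<bullet> q - c \<bullet> J < b \<bullet> q - b \<bullet> J"
      using q(3) by (simp add: zero_less_mult_iff)
    then have "(1 - s1) * (c \<bullet> q - c \<bullet> J) < 0"
      using neg q by (intro mult_pos_neg) auto
    moreover have "s1 * (b \<bullet> q - b \<bullet> J) \<le> 0"
      using neg q by (intro mult_nonneg_nonpos) auto
    ultimately show False
      using 1 by (simp add: algebra_simps)
  qed
  then show thesis
    using that [OF qc F(1)] F(2) q by blast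
qed

text \<open>Take a shortest path on \<open>M\<close> within the cap. A facet through
  \<open>p l\<close> that avoids its predecessor is new: if it contained an earlier vertex, this
  vertex and \<open>p l\<close> would share two facets and be adjacent, which shortens the
  path.\<close>

lemma section_walk:
  assumes M: "M facet_of P" "J \<in> M" "J' \<in> M" and c: "J \<in> chain" "J' \<in> chain" "b \<bullet> J < b \<bullet> J'"
  obtains p k where "p 0 = J" "p k = J'" "0 < k" "fresh_walk P p k"
    "\<And>i. i \<le> k \<Longrightarrow> p i extreme_point_of P \<and> p i \<in> M \<and> p i \<in> cap J J'"
proof -
  \<comment> \<open>The linear part of the chord: within \<open>P\<close>, its superlevel set at
    \<open>J\<close> is the cap.\<close>
  define d where "d = (b \<bullet> J' - b \<bullet> J) *\<^sub>R a + (a \<bullet> J - a \<bullet> J') *\<^sub>R b"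
  have d_chord: "chord J J' x = d \<bullet> x - d \<bullet> J" for x
    by (simp add: chord_def d_def inner_left_distrib algebra_simps)
  have dJ': "d \<bullet> J' = d \<bullet> J"
    using d_chord [of J'] by simp
  have pos: "0 < b \<bullet> J' - b \<bullet> J" "0 < a \<bullet> J - a \<bullet> J'"
    using c chain_decreasing [OF c] by auto
  have Mf: "M face_of P"
    by (rule facet_of_imp_face_of [OF M(1)])
  have polyM: "polyhedron M"
    by (rule face_of_polyhedron_polyhedron [OF P Mf])
  have ext: "J extreme_point_of M" "J' extreme_point_of M"
    using extreme_point_of_face [OF Mf] chain_vertex c M by blast+
  let ?W = "{x. d \<bullet> J \<le> d \<bullet> x}"
  have "d \<bullet> y \<le> (b \<bullet> J' - b \<bullet> J) * (a \<bullet> u) + (a \<bullet> J - a \<bullet> J') * (b \<bullet> v)" if "y \<in> M" for y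
  proof -
    have "y \<in> P"
      using facet_subset [OF M(1) that] .
    then have "a \<bullet> y \<le> a \<bullet> u" "b \<bullet> y \<le> b \<bullet> v"
      using opt_a opt_b by (auto intro: optimal_faceD)
    then show ?thesis
      using pos by (auto simp: d_def inner_left_distrib intro!: add_mono mult_left_mono)
  qed
  then have "(J, J') \<in> (Restr (edge_rel M) ?W)\<^sup>*"
    using superlevel_connected [OF polyM ext(1) _ ext(2), of "d \<bullet> J" d] dJ' by auto
  then obtain p k where p: "p 0 = J" "p k = J'" "\<And>i. i < k \<Longrightarrow> (p i, p (Suc i)) \<in> Restr (edge_rel M) ?W"
    "\<And>i j. i < j \<Longrightarrow> j \<le> k \<Longrightarrow> p i \<noteq> p j" "\<And>i j. Suc i < j \<Longrightarrow> j \<le> k \<Longrightarrow> (p i, p j) \<notin> Restr (edge_rel M) ?W"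
    by (rule shortest_path) blast
  have "0 < k"
    using p c by (cases k) auto
  have mem: "p i extreme_point_of M \<and> p i \<in> ?W" if "i \<le> k" for i
  proof (cases "i < k")
    case True
    then show ?thesis
      using p(3) by (auto simp: edge_rel_def vertices_of_def)
  next
    case False
    then show ?thesis
      using that p(2) ext dJ' by simp
  qed
  have mem': "p i extreme_point_of P \<and> p i \<in> M \<and> p i \<in> cap J J'" if "i \<le> k" for i
    using mem [OF that] extreme_point_of_face [OF Mf] facet_subset [OF M(1)]
    by (auto simp: cap_def d_chord)
  have "fresh_walk P p k"
    unfolding fresh_walk_def
  proof (intro conjI allI impI)
    show "(p i, p (Suc i)) \<in> edge_rel P" if "i < k" for i
      using p(3) [OF that] edge_rel_face [OF Mf] by blast
    fix l assume l: "0 < l" "l \<le> k"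
    then obtain m where m: "l = Suc m"
      using gr0_implies_Suc by blast
    have mk: "m \<le> k" "m < l"
      using l m by auto
    obtain N where N: "N facet_of P" "p l \<in> N" "p m \<notin> N"
      using separating_facet [OF P, of "p l" "p m"] mem' [OF l(2)] mem' [OF mk(1)] p(4) [OF mk(2) l(2)] by metis
    have "p i \<notin> N" if i: "i < l" for i
    proof
      assume pN: "p i \<in> N"
      then have "i \<noteq> m"
        using N by blast
      then have "Suc i < l"
        using i m by linarith
      moreover have "N \<noteq> M"
        using N mem' [OF mk(1)] by blast
      moreover have "p i \<noteq> p l"
        by (rule p(4) [OF i l(2)])
      ultimately have E: "(p i, p l) \<in> edge_rel P"
        using two_facets_edge [OF P dim N(1) M(1), of "p i" "p l"] mem' [of i] mem' [OF l(2)] i l pN N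
        by simp
      then have "(p i, p l) \<in> edge_rel M"
      proof -
        have "closed_segment (p i) (p l) \<subseteq> M"
          using mem' [of i] mem' [OF l(2)] i l face_of_imp_convex [OF Mf]
          by (intro closed_segment_subset) auto
        then show ?thesis
          using E mem [of i] mem [OF l(2)] i l face_of_subset [of "closed_segment (p i) (p l)" P M]
            facet_of_imp_subset [OF M(1)]
          by (auto simp: edge_rel_def vertices_of_def edge_of_def)
      qed
      then show False
        using p(5) [OF \<open>Suc i < l\<close> l(2)] mem [of i] mem [OF l(2)] i l by simp
    qed
    then show "\<exists>F. F facet_of P \<and> p l \<in> F \<and> (\<forall>i<l. p i \<notin> F)"
      using N by blast
  qed
  then show thesis
    using that p(1,2) \<open>0 < k\<close> mem' by blast
qed

text \<open>The vertices that a walk may visit after \<^term>\<open>J\<close>: they lie on a section over an arc after \<^term>\<open>J\<close>, on a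
  facet that reaches at least as far along the chain as all facets at \<^term>\<open>J\<close>.\<close>

definition beyond :: "real^3 \<Rightarrow> real^3 \<Rightarrow> bool" where
  "beyond J q \<longleftrightarrow> q extreme_point_of P \<and> (\<exists>N i k s. N facet_of P \<and> i \<in> N \<and> k \<in> N \<and> s \<in> N \<and>
     i \<in> chain \<and> k \<in> chain \<and> s \<in> chain \<and> b \<bullet> J \<le> b \<bullet> i \<and> b \<bullet> i < b \<bullet> k \<and>
     q \<in> N \<and> q \<in> cap i k \<and> q \<noteq> i \<and>
     (\<forall>F r. F facet_of P \<longrightarrow> J \<in> F \<longrightarrow> r \<in> F \<longrightarrow> r \<in> chain \<longrightarrow> b \<bullet> r \<le> b \<bullet> s))"

text \<open>The facet \<^term>\<open>M\<close> at \<^term>\<open>J\<close> reaches farthest along the chain, namely to \<^term>\<open>t\<close>. It is left at the first chain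
  point \<^term>\<open>J'\<close> that lies on a facet reaching beyond \<^term>\<open>t\<close>, except when a second facet contains \<^term>\<open>J\<close> and \<^term>\<open>t\<close>:
  then the two are adjacent and the section is this edge.\<close>

lemma section_step:
  assumes J: "J \<in> chain" "J \<noteq> v"
  obtains M t J' p k where "M facet_of P" "J \<in> M" "J' \<in> M" "t \<in> M" "J' \<in> chain" "t \<in> chain"
    "b \<bullet> J < b \<bullet> J'" "b \<bullet> J' \<le> b \<bullet> t"
    "\<And>F r. F facet_of P \<Longrightarrow> J \<in> F \<Longrightarrow> r \<in> F \<Longrightarrow> r \<in> chain \<Longrightarrow> b \<bullet> r \<le> b \<bullet> t"
    "J' = v \<or> (\<exists>F r. F facet_of P \<and> J' \<in> F \<and> r \<in> F \<and> r \<in> chain \<and> b \<bullet> t < b \<bullet> r)"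
    "p 0 = J" "p k = J'" "0 < k" "fresh_walk P p k"
    "\<And>i. i \<le> k \<Longrightarrow> p i extreme_point_of P \<and> p i \<in> M \<and> p i \<in> cap J J'"
    "\<And>i F r. i < k \<Longrightarrow> p i \<in> chain \<Longrightarrow> F facet_of P \<Longrightarrow> p i \<in> F \<Longrightarrow> r \<in> F \<Longrightarrow> r \<in> chain \<Longrightarrow> b \<bullet> r \<le> b \<bullet> t"
    "\<And>H. H facet_of P \<Longrightarrow> H \<noteq> M \<Longrightarrow> J \<in> H \<Longrightarrow> t \<in> H \<Longrightarrow> J' = t"
proof -
  let ?S = "{r \<in> chain. \<exists>F. F facet_of P \<and> J \<in> F \<and> r \<in> F}"
  have "finite ?S"
    using finite_chain by simp
  moreover obtain q F0 where q: "q \<in> chain" "F0 facet_of P" "J \<in> F0" "q \<in> F0" "b \<bullet> J < b \<bullet> q"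
    using chain_facet_successor [OF J] .
  ultimately obtain t where t: "t \<in> ?S" and tmax: "\<And>r. r \<in> ?S \<Longrightarrow> b \<bullet> r \<le> b \<bullet> t"
    using finite_arg_max [of ?S "\<lambda>r. b \<bullet> r"] by blast
  then obtain M where M: "M facet_of P" "J \<in> M" "t \<in> M" and tc: "t \<in> chain"
    by blast
  have Jt: "b \<bullet> J < b \<bullet> t"
    using tmax [of q] q by force
  have top: "b \<bullet> r \<le> b \<bullet> t" if "F facet_of P" "J \<in> F" "r \<in> F" "r \<in> chain" for F r
    using tmax that by blast
  define far where "far r \<longleftrightarrow> r = v \<or> (\<exists>F s. F facet_of P \<and> r \<in> F \<and> s \<in> F \<and> s \<in> chain \<and> b \<bullet> t < b \<bullet> s)" for r
  have far_t: "far t"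
  proof (cases "t = v")
    case False
    obtain s F where "s \<in> chain" "F facet_of P" "t \<in> F" "s \<in> F" "b \<bullet> t < b \<bullet> s"
      using chain_facet_successor [OF tc False] .
    then show ?thesis
      by (auto simp: far_def)
  qed (simp add: far_def)
  show thesis
  proof (cases "\<exists>H. H facet_of P \<and> H \<noteq> M \<and> J \<in> H \<and> t \<in> H")
    case True
    then obtain H where H: "H facet_of P" "H \<noteq> M" "J \<in> H" "t \<in> H"
      by blast
    define p where "p = (\<lambda>i::nat. if i = 0 then J else t)"
    have "J \<noteq> t"
      using Jt by auto
    have "(J, t) \<in> edge_rel P"
      using two_facets_edge [OF P dim H(1) M(1) H(2) chain_vertex [OF J(1)] H(3) M(2)
          chain_vertex [OF tc] H(4) M(3) \<open>J \<noteq> t\<close>] .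
    moreover obtain N where "N facet_of P" "t \<in> N" "J \<notin> N"
      using separating_facet [OF P chain_vertex [OF tc] chain_vertex [OF J(1)]] \<open>J \<noteq> t\<close> by metis
    ultimately have walk: "fresh_walk P p 1"
      by (auto simp: fresh_walk_def p_def less_Suc_eq le_Suc_eq)
    show thesis
      by (rule that [where M = M and t = t and J' = t and p = p and k = 1])
        (use walk far_t M J tc Jt chain_vertex chain_in top in \<open>auto simp: p_def far_def cap_def\<close>)
  next
    case False
    \<comment> \<open>The candidates for leaving \<open>M\<close>. The point \<open>t\<close> is one
      of them, since it is \<open>v\<close> or some facet continues from it along the chain.\<close>
    let ?T = "{r \<in> chain. r \<in> M \<and> b \<bullet> J < b \<bullet> r \<and> far r}"
    have "finite ?T" "?T \<noteq> {}"
      using finite_chain far_t tc M Jt by auto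
    then obtain J' where J': "J' \<in> ?T" and least: "\<And>r. r \<in> ?T \<Longrightarrow> b \<bullet> J' \<le> b \<bullet> r"
      using finite_arg_max [of ?T "\<lambda>r. - (b \<bullet> r)"] by auto
    then have J'c: "J' \<in> chain" "J' \<in> M" "b \<bullet> J < b \<bullet> J'" "far J'"
      by auto
    obtain p k where p: "p 0 = J" "p k = J'" "0 < k" "fresh_walk P p k"
      and mem: "\<And>i. i \<le> k \<Longrightarrow> p i extreme_point_of P \<and> p i \<in> M \<and> p i \<in> cap J J'"
      using section_walk [OF M(1,2) J'c(2) J(1) J'c(1,3)] by metis
    \<comment> \<open>Chain points on the walk other than \<open>J\<close> lie strictly between
      \<open>J\<close> and \<open>J'\<close>, so the choice of \<open>J'\<close> as the first
      candidate excludes them; at \<open>J\<close> the choice of \<open>t\<close> gives the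
      claim.\<close>
    have low: "b \<bullet> r \<le> b \<bullet> t"
      if i: "i < k" "p i \<in> chain" and F: "F facet_of P" "p i \<in> F" "r \<in> F" "r \<in> chain" for i F r
    proof (cases "p i = J")
      case True
      then show ?thesis
        using top F by blast
    next
      case False
      have pi: "p i \<in> M" "p i \<in> cap J J'"
        using mem i by simp_all
      have "p i \<noteq> J'"
        using fresh_walk_distinct [OF p(4) i(1)] p(2) by simp
      then have "b \<bullet> J < b \<bullet> p i" "b \<bullet> p i < b \<bullet> J'"
        using cap_bounds [OF J(1) J'c(1,3) pi(2)] chain_eqI i(2) J(1) J'c(1) False by force+
      then have "\<not> far (p i)"
        using least [of "p i"] pi i by auto
      then show ?thesis
        using F unfolding far_def by force
    qed
    show thesis
      by (rule that [OF M(1,2) J'c(2) M(3) J'c(1) tc J'c(3) least top _ p mem low])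
        (use far_t tc M Jt J'c False in \<open>auto simp: far_def\<close>)
  qed
qed

text \<open>Induction on the number of chain points after \<open>J\<close>: one section is put
  before a walk from \<open>J'\<close>. Carrying \<open>beyond\<close> along the induction records
  what is needed to exclude common facets of the section and the rest.\<close>

lemma walk_to_v:
  assumes "J \<in> chain"
  shows "\<exists>p k. p 0 = J \<and> p k = v \<and> fresh_walk P p k \<and> (\<forall>i. 0 < i \<longrightarrow> i \<le> k \<longrightarrow> beyond J (p i))"
  using assms
proof (induction "card {r \<in> chain. b \<bullet> J < b \<bullet> r}" arbitrary: J rule: less_induct)
  case less
  note J = less.prems
  show ?case
  proof (cases "J = v")
    case True
    then show ?thesis
      by (intro exI [of _ "\<lambda>_. v"] exI [of _ 0]) (simp add: fresh_walk_def)
  next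
    case False
    obtain M t J' p k where M: "M facet_of P" "J \<in> M" "J' \<in> M" "t \<in> M" and c: "J' \<in> chain" "t \<in> chain"
      and JJ: "b \<bullet> J < b \<bullet> J'" "b \<bullet> J' \<le> b \<bullet> t"
      and top: "\<And>F r. F facet_of P \<Longrightarrow> J \<in> F \<Longrightarrow> r \<in> F \<Longrightarrow> r \<in> chain \<Longrightarrow> b \<bullet> r \<le> b \<bullet> t"
      and far: "J' = v \<or> (\<exists>F r. F facet_of P \<and> J' \<in> F \<and> r \<in> F \<and> r \<in> chain \<and> b \<bullet> t < b \<bullet> r)"
      and p: "p 0 = J" "p k = J'" "0 < k" "fresh_walk P p k"
      and mem: "\<And>i. i \<le> k \<Longrightarrow> p i extreme_point_of P \<and> p i \<in> M \<and> p i \<in> cap J J'"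
      and low: "\<And>i F r. i < k \<Longrightarrow> p i \<in> chain \<Longrightarrow> F facet_of P \<Longrightarrow> p i \<in> F \<Longrightarrow> r \<in> F \<Longrightarrow> r \<in> chain \<Longrightarrow> b \<bullet> r \<le> b \<bullet> t"
      and tie: "\<And>H. H facet_of P \<Longrightarrow> H \<noteq> M \<Longrightarrow> J \<in> H \<Longrightarrow> t \<in> H \<Longrightarrow> J' = t"
      by (rule section_step [OF J False]) (rule that, assumption+)
    have "card {r \<in> chain. b \<bullet> J' < b \<bullet> r} < card {r \<in> chain. b \<bullet> J < b \<bullet> r}"
    proof (rule psubset_card_mono)
      show "finite {r \<in> chain. b \<bullet> J < b \<bullet> r}"
        using finite_chain by simp
      have "J' \<in> {r \<in> chain. b \<bullet> J < b \<bullet> r}" "J' \<notin> {r \<in> chain. b \<bullet> J' < b \<bullet> r}"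
        using c JJ by auto
      then show "{r \<in> chain. b \<bullet> J' < b \<bullet> r} \<subset> {r \<in> chain. b \<bullet> J < b \<bullet> r}"
        using JJ by force
    qed
    then obtain p' k' where p': "p' 0 = J'" "p' k' = v" "fresh_walk P p' k'"
      and bey: "\<And>i. 0 < i \<Longrightarrow> i \<le> k' \<Longrightarrow> beyond J' (p' i)"
      using less.hyps c by blast
    \<comment> \<open>A fresh facet of the remaining walk avoids its start \<open>J'\<close>. Such a
      facet cannot have met the section either, so it is fresh for the whole walk.\<close>
    have sep: False
      if i: "i < k" and l: "0 < l" "l \<le> k'" and H: "H facet_of P" "p i \<in> H" "p' l \<in> H" "J' \<notin> H" for i l H
    proof -
      obtain N x y s where N: "N facet_of P" "x \<in> N" "y \<in> N" "s \<in> N" "x \<in> chain" "y \<in> chain" "s \<in> chain"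
        and xy: "b \<bullet> J' \<le> b \<bullet> x" "b \<bullet> x < b \<bullet> y" and q: "p' l \<in> N" "p' l \<in> cap x y" "p' l \<noteq> x"
        and s: "\<And>F r. F facet_of P \<Longrightarrow> J' \<in> F \<Longrightarrow> r \<in> F \<Longrightarrow> r \<in> chain \<Longrightarrow> b \<bullet> r \<le> b \<bullet> s"
        and qe: "p' l extreme_point_of P"
        using bey [OF l] unfolding beyond_def by blast
      have "J' \<noteq> v"
      proof
        assume "J' = v"
        then have "b \<bullet> y \<le> b \<bullet> J'"
          using opt_b chain_in [OF N(6)] optimal_faceD [of v P b y] by auto
        then show False
          using xy by linarith
      qed
      then have ts: "b \<bullet> t < b \<bullet> s"
        using far s by force
      have pi: "p i extreme_point_of P" "p i \<in> M" "p i \<in> cap J J'" "p i \<noteq> J'"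
        using mem [of i] i fresh_walk_distinct [OF p(4) i] p(2) by auto
      show False
        by (rule no_revisit [OF M(1-4) J c JJ _ pi _ _ N xy ts qe q H])
          (use top M(1,2) low [OF i] tie in blast)+
    qed
    define w where "w i = (if i \<le> k then p i else p' (i - k))" for i
    have wp': "w (k + i) = p' i" for i
      using p(2) p'(1) by (cases "i = 0") (auto simp: w_def)
    have "fresh_walk P w (k + k')"
      unfolding fresh_walk_def
    proof (intro conjI allI impI)
      fix i assume i: "i < k + k'"
      show "(w i, w (Suc i)) \<in> edge_rel P"
      proof (cases "i < k")
        case True
        then show ?thesis
          using p(4) by (simp add: w_def fresh_walk_def)
      next
        case False
        then obtain m where m: "i = k + m" "m < k'"
          using i by (metis add_less_cancel_left le_add_diff_inverse not_less)
        then have "w i = p' m" "w (Suc i) = p' (Suc m)"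
          using wp' [of m] wp' [of "Suc m"] by simp_all
        then show ?thesis
          using p'(3) m by (simp add: fresh_walk_def)
      qed
    next
      fix l assume l: "0 < l" "l \<le> k + k'"
      show "\<exists>F. F facet_of P \<and> w l \<in> F \<and> (\<forall>i<l. w i \<notin> F)"
      proof (cases "l \<le> k")
        case True
        then show ?thesis
          using p(4) l by (auto simp: w_def fresh_walk_def)
      next
        case False
        then obtain m where m: "l = k + m" "0 < m" "m \<le> k'"
          using l by (metis add_le_cancel_left add.right_neutral le_add_diff_inverse linorder_le_cases not_gr_zero)
        obtain F where F: "F facet_of P" "p' m \<in> F" "\<And>i. i < m \<Longrightarrow> p' i \<notin> F"
          using p'(3) m unfolding fresh_walk_def by blast
        have "J' \<notin> F"
          using F(3) [of 0] m p'(1) by simp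
        have "w i \<notin> F" if i: "i < l" for i
        proof (cases "i < k")
          case True
          then show ?thesis
            using sep [OF True m(2,3) F(1) _ F(2) \<open>J' \<notin> F\<close>] by (auto simp: w_def)
        next
          case False
          then obtain j where j: "i = k + j" "j < m"
            using i m by (metis add_less_cancel_left le_add_diff_inverse not_less)
          then show ?thesis
            using F(3) wp' by simp
        qed
        then show ?thesis
          using F m wp' by auto
      qed
    qed
    moreover have "beyond J (w i)" if i: "0 < i" "i \<le> k + k'" for i
    proof (cases "i \<le> k")
      case True
      have "p i \<noteq> J"
        using fresh_walk_distinct [OF p(4) i(1) True] p(1) by simp
      moreover have "w i = p i"
        using True by (simp add: w_def)
      ultimately show ?thesis
        unfolding beyond_def using mem [OF True] M c J JJ top
        by (intro conjI exI [of _ M] exI [of _ J] exI [of _ J'] exI [of _ t]) auto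
    next
      case False
      then obtain m where m: "i = k + m" "0 < m" "m \<le> k'"
        using i by (metis add_le_cancel_left add.right_neutral le_add_diff_inverse linorder_le_cases not_gr_zero)
      obtain N x y s where N: "N facet_of P" "x \<in> N" "y \<in> N" "s \<in> N" "x \<in> chain" "y \<in> chain" "s \<in> chain"
        and xy: "b \<bullet> J' \<le> b \<bullet> x" "b \<bullet> x < b \<bullet> y" and q: "p' m \<in> N" "p' m \<in> cap x y" "p' m \<noteq> x"
        and s: "\<And>F r. F facet_of P \<Longrightarrow> J' \<in> F \<Longrightarrow> r \<in> F \<Longrightarrow> r \<in> chain \<Longrightarrow> b \<bullet> r \<le> b \<bullet> s"
        and qe: "p' m extreme_point_of P"
        using bey [OF m(2,3)] unfolding beyond_def by blast
      \<comment> \<open>\<open>M\<close> also passes through \<open>J'\<close>, so a point that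
        dominates the facets at \<open>J'\<close> dominates \<open>t\<close>, and with it all facets
        at \<open>J\<close>.\<close>
      have "b \<bullet> t \<le> b \<bullet> s"
        using s [OF M(1,3,4) c(2)] .
      then have s': "b \<bullet> r \<le> b \<bullet> s" if "F facet_of P" "J \<in> F" "r \<in> F" "r \<in> chain" for F r
        using top [OF that] by linarith
      have Jx: "b \<bullet> J \<le> b \<bullet> x"
        using xy JJ by linarith
      have "w i = p' m"
        using m wp' by simp
      then show ?thesis
        unfolding beyond_def using N xy(2) q qe s' Jx
        by (intro conjI exI [of _ N] exI [of _ x] exI [of _ y] exI [of _ s]) auto
    qed
    moreover have "w 0 = J" "w (k + k') = v"
      using p p' wp' by (auto simp: w_def)
    ultimately show ?thesis
      by blast
  qed
qed

lemma u_in_chain: "u \<in> chain"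
proof -
  have "{u} face_of P"
    using optimal_face_face_of [OF convex_P, of a] opt_a by simp
  then have "u extreme_point_of P"
    by (simp add: face_of_singleton)
  moreover have "u \<in> optimal_face P (1 *\<^sub>R a + 0 *\<^sub>R b)"
    using opt_a by simp
  ultimately show ?thesis
    unfolding chain_def by (intro CollectI conjI exI [of _ 1] exI [of _ 0]) auto
qed

lemma short_path:
  "\<exists>k. (u, v) \<in> edge_rel P ^^ k \<and> k + 3 \<le> card {F. F facet_of P}"
proof -
  obtain p k where p: "p 0 = u" "p k = v" "fresh_walk P p k"
    using walk_to_v [OF u_in_chain] by blast
  have "(u, v) \<in> edge_rel P ^^ k"
    unfolding relpow_fun_conv using p by (auto simp: fresh_walk_def)
  moreover have "k + 3 \<le> card {F. F facet_of P}"
    using fresh_walk_length [OF P p(3)] p(1) chain_vertex [OF u_in_chain] dim by simp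
  ultimately show ?thesis
    by blast
qed

end

section \<open>Diameter in dimension three\<close>

lemma ball_avoids_hyperplanes:
  fixes c :: "'a::euclidean_space"
  assumes "0 < e" "finite W" "0 \<notin> W"
  obtains a where "norm (a - c) < e" "\<And>w. w \<in> W \<Longrightarrow> w \<bullet> a \<noteq> 0"
proof -
  have "negligible (\<Union>w\<in>W. {x. w \<bullet> x = 0})"
    using assms by (intro negligible_Union) (auto intro!: negligible_hyperplane)
  moreover have "\<not> negligible (ball c e)"
    using assms by (intro open_not_negligible) auto
  ultimately have "\<not> ball c e \<subseteq> (\<Union>w\<in>W. {x. w \<bullet> x = 0})"
    using negligible_subset by blast
  then show thesis
    using that by (force simp: dist_norm norm_minus_commute)
qed

text \<open>Sharpness leaves a ball of choices for each objective. First \<open>a\<close> avoids a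
  hyperplane containing each facet normal, hence is parallel to none; then \<open>b\<close> avoids
  the hyperplanes orthogonal to the products of normals with \<open>a\<close>. The triple product
  turns this into genericity.\<close>

lemma generic_shadow:
  fixes P :: "(real^3) set"
  assumes P: "polyhedron P" and dim: "aff_dim P = 3"
    and u: "u extreme_point_of P" and v: "v extreme_point_of P" and "u \<noteq> v"
  obtains a b where "shadow P u v a b"
proof -
  let ?n = "facet_normal P"
  have fin: "finite {F. F facet_of P}"
    by (rule finite_polyhedron_facets [OF P])
  have uvP: "u \<in> P" "v \<in> P"
    using u v by (auto simp: extreme_point_of_def)
  have "\<exists>w. w \<noteq> 0 \<and> orthogonal n w" for n :: "real^3"
    using orthogonal_to_vector_exists [of n] by auto
  then obtain h where h: "\<And>n :: real^3. h n \<noteq> 0" "\<And>n :: real^3. n \<bullet> h n = 0"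
    unfolding orthogonal_def by metis
  obtain c1 e1 where 1: "0 < e1" "\<And>y. y \<in> P \<Longrightarrow> c1 \<bullet> (y - u) \<le> - e1 * norm (y - u)"
    by (rule vertex_is_sharp [OF P u]) (rule that)
  let ?W = "(\<lambda>F. h (?n F)) ` {F. F facet_of P}"
  have "finite ?W" "0 \<notin> ?W"
    using fin h(1) by (auto simp: image_iff)
  then obtain a where a: "norm (a - c1) < e1" "\<And>w. w \<in> ?W \<Longrightarrow> w \<bullet> a \<noteq> 0"
    using ball_avoids_hyperplanes [OF 1(1), of ?W c1] by blast
  have na: "cross3 (?n F) a \<noteq> 0" if F: "F facet_of P" for F
  proof
    assume "cross3 (?n F) a = 0"
    then have "collinear {0, ?n F, a}"
      by (simp add: cross_eq_0)
    then obtain t where "a = 0 \<or> a = t *\<^sub>R ?n F"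
      using facet_normal_nonzero [OF P F] by (auto simp: collinear_lemma)
    then have "h (?n F) \<bullet> a = 0"
      using h(2) [of "?n F"] by (auto simp: inner_commute)
    then show False
      using a(2) F by blast
  qed
  obtain c2 e2 where 2: "0 < e2" "\<And>y. y \<in> P \<Longrightarrow> c2 \<bullet> (y - v) \<le> - e2 * norm (y - v)"
    by (rule vertex_is_sharp [OF P v]) (rule that)
  let ?V = "(\<lambda>F. cross3 (?n F) a) ` {F. F facet_of P}"
  have "finite ?V"
    using fin by (rule finite_imageI)
  moreover have "0 \<notin> ?V"
    using na by (metis (no_types, lifting) imageE mem_Collect_eq)
  ultimately obtain b where b: "norm (b - c2) < e2" "\<And>w. w \<in> ?V \<Longrightarrow> w \<bullet> b \<noteq> 0"
    using ball_avoids_hyperplanes [OF 2(1), of ?V c2] by blast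
  have gen: "?n F \<bullet> cross3 a b \<noteq> 0" if "F facet_of P" for F
    using b(2) [of "cross3 (?n F) a"] that cross_triple [of "?n F" a b] by (auto simp: inner_commute)
  have "aff_dim P \<le> int (card {F. F facet_of P \<and> u \<in> F})"
    by (rule card_facets_at_vertex [OF P u])
  then have "{F. F facet_of P \<and> u \<in> F} \<noteq> {}"
    using dim by (metis card.empty of_nat_0 not_numeral_le_zero)
  then obtain F where "F facet_of P"
    by blast
  then have "cross3 a b \<noteq> 0"
    using gen [of F] by auto
  then have "shadow P u v a b"
    using P dim gen sharp_imp_optimal_face [OF uvP(1) 1(2) a(1)] sharp_imp_optimal_face [OF uvP(2) 2(2) b(1)]
    by unfold_locales
  then show thesis
    using that by blast
qed

lemma diameter_real3:
  fixes P :: "(real^3) set"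
  assumes P: "polyhedron P" and dim: "aff_dim P = 3"
    and u: "u extreme_point_of P" and v: "v extreme_point_of P"
  shows "\<exists>k. (u, v) \<in> edge_rel P ^^ k \<and> k + 3 \<le> card {F. F facet_of P}"
proof (cases "u = v")
  case True
  have "fresh_walk P (\<lambda>_. u) 0"
    by (simp add: fresh_walk_def)
  then have "3 \<le> card {F. F facet_of P}"
    using fresh_walk_length [OF P] u dim by fastforce
  then show ?thesis
    using True by (intro exI [of _ 0]) simp
next
  case False
  then show ?thesis
    using generic_shadow [OF P dim u v] shadow.short_path by metis
qed

section \<open>Transport to an arbitrary ambient space\<close>

lemma polyhedron_affine_preimage:
  fixes g :: "'a::euclidean_space \<Rightarrow> 'b::euclidean_space"
  assumes "linear g" "polyhedron P"
  shows "polyhedron {y. z + g y \<in> P}"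
proof -
  obtain H where "finite H" and P: "P = \<Inter>H" and H: "\<forall>h\<in>H. \<exists>a b. a \<noteq> 0 \<and> h = {x. a \<bullet> x \<le> b}"
    using assms(2) unfolding polyhedron_def by blast
  have "polyhedron {y. z + g y \<in> h}" if h: "h \<in> H" for h
  proof -
    obtain a b where h: "h = {x. a \<bullet> x \<le> b}"
      using H h by blast
    have "{y. z + g y \<in> h} = {y. adjoint g a \<bullet> y \<le> b - a \<bullet> z}"
      using adjoint_works [OF assms(1), of _ a] by (auto simp: h inner_add_right inner_commute algebra_simps)
    then show ?thesis
      by (simp add: polyhedron_halfspace_le)
  qed
  then have "polyhedron (\<Inter>h\<in>H. {y. z + g y \<in> h})"
    using \<open>finite H\<close> by (intro polyhedron_Inter) auto
  moreover have "{y. z + g y \<in> P} = (\<Inter>h\<in>H. {y. z + g y \<in> h})"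
    using P by auto
  ultimately show ?thesis
    by simp
qed

lemma diameter_dim3:
  fixes P :: "'a::euclidean_space set"
  assumes P: "polyhedron P" and dim: "aff_dim P = 3"
    and u: "u extreme_point_of P" and v: "v extreme_point_of P"
  shows "\<exists>k. (u, v) \<in> edge_rel P ^^ k \<and> k + 3 \<le> card {F. F facet_of P}"
proof -
  have uvP: "u \<in> P" "v \<in> P"
    using u v by (auto simp: extreme_point_of_def)
  then have uaff: "u \<in> affine hull P"
    by (simp add: hull_inc)
  define S where "S = (\<lambda>x. x - u) ` (affine hull P)"
  have "subspace S"
    unfolding S_def by (rule affine_diffs_subspace_subtract [OF affine_affine_hull uaff])
  have "int (dim S) = 3"
    using aff_dim_eq_dim_subtract [of u "affine hull P"] uaff dim by (simp add: S_def hull_hull)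
  then have "dim S = dim (UNIV :: (real^3) set)"
    by simp
  then obtain f g where fg: "linear f" "linear g" "f ` S = (UNIV :: (real^3) set)" "g ` UNIV = S"
    "\<And>x. x \<in> S \<Longrightarrow> g (f x) = x" "\<And>y. f (g y) = y"
    using isometries_subspaces [OF \<open>subspace S\<close> subspace_UNIV] by (metis UNIV_I)
  have "inj g"
    using fg(6) by (metis injI)
  define T where "T y = u + g y" for y
  define Q where "Q = {y. T y \<in> P}"
  have polyQ: "polyhedron Q"
    unfolding Q_def T_def by (rule polyhedron_affine_preimage [OF fg(2) P])
  have TQ: "P = T ` Q"
  proof (intro equalityI subsetI)
    fix x assume "x \<in> P"
    then have "x - u \<in> S"
      by (auto simp: S_def hull_inc)
    then have "T (f (x - u)) = x"
      using fg(5) by (simp add: T_def)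
    then show "x \<in> T ` Q"
      using \<open>x \<in> P\<close> by (auto simp: Q_def intro!: image_eqI [of _ _ "f (x - u)"])
  qed (auto simp: Q_def)
  have Timage: "T ` C = (+) u ` (g ` C)" for C
    by (auto simp: T_def)
  have face: "T ` C face_of P \<longleftrightarrow> C face_of Q" for C
    unfolding TQ Timage face_of_translation_eq by (rule face_of_linear_image [OF fg(2) \<open>inj g\<close>])
  have affT: "aff_dim (T ` C) = aff_dim C" for C
    unfolding Timage aff_dim_translation_eq by (rule aff_dim_injective_linear_image [OF fg(2) \<open>inj g\<close>])
  have injT: "inj T"
    using \<open>inj g\<close> by (auto simp: inj_def T_def)
  have ext: "T y extreme_point_of P \<longleftrightarrow> y extreme_point_of Q" for y
    using face [of "{y}"] by (simp add: face_of_singleton)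
  have segT: "T ` closed_segment x y = closed_segment (T x) (T y)" for x y
    unfolding Timage closed_segment_linear_image [OF fg(2), symmetric]
    by (simp add: T_def closed_segment_translation)
  have edge: "(T x, T y) \<in> edge_rel P" if "(x, y) \<in> edge_rel Q" for x y
    using that ext face [of "closed_segment x y"] affT [of "closed_segment x y"]
    by (simp add: edge_rel_def vertices_of_def edge_of_def segT)
  have path: "(T x, T y) \<in> edge_rel P ^^ k" if "(x, y) \<in> edge_rel Q ^^ k" for x y k
    using that
  proof (induction k arbitrary: y)
    case (Suc k)
    then show ?case
      using edge by (metis relpow_Suc_E relpow_Suc_I)
  qed auto
  obtain u' v' where uv': "u = T u'" "v = T v'"
    using uvP TQ by blast
  obtain k where k: "(u', v') \<in> edge_rel Q ^^ k" "k + 3 \<le> card {F. F facet_of Q}"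
    using diameter_real3 [OF polyQ, of u' v'] affT [of Q] dim ext u v uv' TQ by auto
  have "card {F. F facet_of Q} \<le> card {F. F facet_of P}"
  proof (rule card_inj_on_le)
    show "inj_on ((`) T) {F. F facet_of Q}"
      using injT by (meson inj_image_eq_iff inj_onI)
    show "(`) T ` {F. F facet_of Q} \<subseteq> {F. F facet_of P}"
      using face affT TQ by (auto simp: facet_of_def)
    show "finite {F. F facet_of P}"
      by (rule finite_polyhedron_facets [OF P])
  qed
  then show ?thesis
    using path [OF k(1)] k(2) uv' by auto
qed

section \<open>The recursion of Kalai and Kleitman\<close>

text \<open>A facet of \<open>F\<close> is an intersection of facets of \<open>P\<close>. One of
  these does not contain \<open>F\<close>, and it already cuts out the facet of \<open>F\<close> for
  reasons of dimension.\<close>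

lemma card_facets_of_facet:
  fixes P :: "'a::euclidean_space set"
  assumes P: "polyhedron P" and F: "F facet_of P"
  shows "card {G. G facet_of F} < card {G. G facet_of P}"
proof -
  have FP: "F face_of P" "convex F" "F \<subseteq> P"
    using F facet_of_imp_face_of face_of_imp_convex facet_of_imp_subset by blast+
  have fin: "finite {G. G facet_of P}"
    by (rule finite_polyhedron_facets [OF P])
  have "{G. G facet_of F} \<subseteq> (\<lambda>H. F \<inter> H) ` ({G. G facet_of P} - {F})"
  proof
    fix G assume "G \<in> {G. G facet_of F}"
    then have G: "G face_of F" "G \<noteq> {}" "aff_dim G = aff_dim F - 1"
      by (auto simp: facet_of_def)
    then have GP: "G face_of P" "G \<subseteq> F" "G \<noteq> F"
      using face_of_trans FP face_of_imp_subset by (blast, blast, auto)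
    moreover have "G \<noteq> P"
      using GP FP by blast
    ultimately have eq: "G = \<Inter>{H. H facet_of P \<and> G \<subseteq> H}"
      using face_of_polyhedron [OF P] G by blast
    have "\<not> F \<subseteq> \<Inter>{H. H facet_of P \<and> G \<subseteq> H}"
      using GP eq by (metis subset_antisym)
    then obtain H where H: "H facet_of P" "G \<subseteq> H" "\<not> F \<subseteq> H"
      by blast
    have FH: "F \<inter> H face_of F"
      using FP H(1) by (metis face_of_Int face_of_face facet_of_imp_face_of inf_le1)
    then have "aff_dim (F \<inter> H) < aff_dim F"
      using H face_of_aff_dim_lt [OF FP(2)] by blast
    then have "\<not> aff_dim G < aff_dim (F \<inter> H)"
      using G by simp
    moreover have "G face_of F \<inter> H"
      using G H GP by (intro face_of_subset [OF G(1)]) auto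
    ultimately have "G = F \<inter> H"
      using face_of_aff_dim_lt face_of_imp_convex [OF FH] by blast
    then show "G \<in> (\<lambda>H. F \<inter> H) ` ({G. G facet_of P} - {F})"
      using H by auto
  qed
  then have "card {G. G facet_of F} \<le> card ({G. G facet_of P} - {F})"
    using fin by (meson card_image_le card_mono finite_Diff finite_imageI order_trans)
  also have "\<dots> < card {G. G facet_of P}"
    using fin F by (intro card_Diff1_less) auto
  finally show ?thesis .
qed

text \<open>Staying in the affine hull preserves the dimension even if \<open>P\<close> is not
  full-dimensional in the ambient space.\<close>

definition relax :: "'a::euclidean_space set \<Rightarrow> 'a set set \<Rightarrow> 'a set" where
  "relax P S = {x \<in> affine hull P. \<forall>F\<in>S. facet_normal P F \<bullet> x \<le> facet_level P F}"

context
  fixes P :: "'a::euclidean_space set" and S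
  assumes P: "polyhedron P" and S: "S \<subseteq> {F. F facet_of P}"
begin

lemma finite_constraints: "finite S"
  using finite_subset [OF S finite_polyhedron_facets [OF P]] .

lemma subset_relax: "P \<subseteq> relax P S"
  using S facet_normal_le [OF P] by (auto simp: relax_def hull_inc)

lemma polyhedron_relax: "polyhedron (relax P S)"
proof -
  have "relax P S = affine hull P \<inter> (\<Inter>F\<in>S. {x. facet_normal P F \<bullet> x \<le> facet_level P F})"
    by (auto simp: relax_def)
  then show ?thesis
    using finite_constraints by (auto intro!: polyhedron_Int polyhedron_affine_hull polyhedron_Inter polyhedron_halfspace_le)
qed

lemma affine_hull_relax: "affine hull (relax P S) = affine hull P"
proof
  have "relax P S \<subseteq> affine hull P"
    by (auto simp: relax_def)
  then show "affine hull (relax P S) \<subseteq> affine hull P"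
    by (simp add: hull_minimal)
  show "affine hull P \<subseteq> affine hull (relax P S)"
    by (rule hull_mono [OF subset_relax])
qed

lemma aff_dim_relax: "aff_dim (relax P S) = aff_dim P"
  by (metis aff_dim_affine_hull affine_hull_relax)

text \<open>A relative interior point of a facet is tight for some retained inequality, as it would
  otherwise be relatively interior to the relaxation. The face where this inequality is tight
  contains the facet and is proper, so the two coincide.\<close>

lemma card_facets_relax: "card {C. C facet_of relax P S} \<le> card S"
proof -
  let ?Q = "relax P S"
  let ?D = "\<lambda>F. ?Q \<inter> {x. facet_normal P F \<bullet> x = facet_level P F}"
  have cQ: "convex ?Q"
    using polyhedron_relax polyhedron_imp_convex by blast
  have "{C. C facet_of ?Q} \<subseteq> ?D ` S"
  proof
    fix C assume "C \<in> {C. C facet_of ?Q}"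
    then have C: "C face_of ?Q" "C \<noteq> {}" "aff_dim C = aff_dim ?Q - 1"
      by (auto simp: facet_of_def)
    then obtain x where x: "x \<in> rel_interior C"
      using rel_interior_eq_empty face_of_imp_convex by blast
    then have "x \<in> C" "x \<in> ?Q"
      using rel_interior_subset C(1) face_of_imp_subset by blast+
    have "\<exists>F\<in>S. facet_normal P F \<bullet> x = facet_level P F"
    proof (rule ccontr)
      assume no: "\<not> ?thesis"
      let ?U = "\<Inter>F\<in>S. {y. facet_normal P F \<bullet> y < facet_level P F}"
      have "open ?U"
        using finite_constraints by (intro open_INT) (auto intro: open_halfspace_lt)
      moreover have "x \<in> ?U"
        using no \<open>x \<in> ?Q\<close> by (force simp: relax_def)
      moreover have "?U \<inter> affine hull ?Q \<subseteq> ?Q"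
        unfolding affine_hull_relax by (force simp: relax_def)
      ultimately have "x \<in> rel_interior ?Q"
        using \<open>x \<in> ?Q\<close> unfolding mem_rel_interior by blast
      moreover have "C \<noteq> ?Q"
        using C by auto
      ultimately show False
        using face_of_disjoint_rel_interior [OF C(1)] \<open>x \<in> C\<close> by blast
    qed
    then obtain F where F: "F \<in> S" "facet_normal P F \<bullet> x = facet_level P F"
      by blast
    have D: "?D F face_of ?Q"
      using F by (intro face_of_Int_supporting_hyperplane_le cQ) (auto simp: relax_def)
    have "C \<subseteq> ?D F"
      using D x F \<open>x \<in> ?Q\<close> face_of_imp_subset [OF C(1)] by (intro subset_of_face_of [OF D]) auto
    have "?D F \<noteq> ?Q"
    proof
      assume "?D F = ?Q"
      then have "P \<subseteq> {x. facet_normal P F \<bullet> x = facet_level P F}"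
        using subset_relax by blast
      moreover have Ff: "F facet_of P"
        using F S by blast
      ultimately have "P \<subseteq> F"
        using mem_facetI [OF P Ff] by blast
      then have "F = P"
        using facet_of_imp_subset [OF Ff] by blast
      then show False
        using Ff by simp
    qed
    then have "\<not> aff_dim C < aff_dim (?D F)"
      using face_of_aff_dim_lt [OF cQ D] C by simp
    moreover have "C face_of ?D F"
      using \<open>C \<subseteq> ?D F\<close> by (intro face_of_subset [OF C(1)]) auto
    ultimately have "C = ?D F"
      using face_of_aff_dim_lt face_of_imp_convex [OF D] by blast
    then show "C \<in> ?D ` S"
      using F by blast
  qed
  then show ?thesis
    using finite_constraints by (meson card_image_le card_mono finite_imageI order_trans)
qed

lemma vertex_relax:
  assumes x: "x extreme_point_of P" and facets: "\<And>F. F facet_of P \<Longrightarrow> x \<in> F \<Longrightarrow> F \<in> S"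
  shows "x extreme_point_of relax P S"
  unfolding extreme_point_of_def
proof (intro conjI ballI notI)
  show "x \<in> relax P S"
    using x subset_relax by (auto simp: extreme_point_of_def)
  fix y z assume yz: "y \<in> relax P S" "z \<in> relax P S" and "x \<in> open_segment y z"
  then obtain t where t: "0 < t" "t < 1" "x = (1 - t) *\<^sub>R y + t *\<^sub>R z" "y \<noteq> z"
    by (auto simp: in_segment)
  have "facet_normal P F \<bullet> (y - x) = 0" if F: "F facet_of P" "x \<in> F" for F
  proof -
    let ?n = "facet_normal P F" and ?l = "facet_level P F"
    have le: "?n \<bullet> y \<le> ?l" "?n \<bullet> z \<le> ?l" and eq: "?n \<bullet> x = ?l"
      using yz facets F facet_normal_eq [OF P] by (auto simp: relax_def)
    have "(1 - t) * (?l - ?n \<bullet> y) + t * (?l - ?n \<bullet> z) = 0"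
      using eq t(3) by (simp add: inner_simps algebra_simps)
    moreover have "0 \<le> (1 - t) * (?l - ?n \<bullet> y)" "0 \<le> t * (?l - ?n \<bullet> z)"
      using le t by auto
    ultimately have "(1 - t) * (?l - ?n \<bullet> y) = 0"
      by linarith
    then show ?thesis
      using t eq by (simp add: inner_simps)
  qed
  moreover have "x + (y - x) \<in> affine hull P"
    using yz by (simp add: relax_def)
  ultimately have "y - x = 0"
    using vertex_direction_zero [OF P x] by blast
  moreover have "x - y = t *\<^sub>R (z - y)"
    unfolding t(3) by (simp add: algebra_simps)
  ultimately have "t *\<^sub>R (z - y) = 0"
    by simp
  then show False
    using t by auto
qed

text \<open>All facets at \<open>x\<close> are retained, so the edge starts inside \<open>P\<close>;
  \<open>y'\<close> is the point where it leaves \<open>P\<close>. If the facets at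
  \<open>y'\<close> are retained too, \<open>y'\<close> is a vertex of the relaxation and thus the
  end of the edge.\<close>

lemma edge_relax:
  assumes x: "x extreme_point_of P" "\<And>F. F facet_of P \<Longrightarrow> x \<in> F \<Longrightarrow> F \<in> S"
    and xy: "(x, y) \<in> edge_rel (relax P S)"
  obtains y' where "(x, y') \<in> edge_rel P" "(\<And>F. F facet_of P \<Longrightarrow> y' \<in> F \<Longrightarrow> F \<in> S) \<Longrightarrow> y' = y"
proof -
  let ?E = "closed_segment x y"
  have E: "?E face_of relax P S" "aff_dim ?E = 1"
    using xy by (auto simp: edge_rel_def edge_of_def)
  then have "x \<noteq> y"
    by auto
  have EP: "?E \<inter> P face_of P"
    using face_of_slice [OF E(1), of P] polyhedron_imp_convex [OF P] subset_relax
    by (metis inf.absorb2)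
  have "aff_dim (?E \<inter> P) \<le> 1"
    using E(2) aff_dim_subset [of "?E \<inter> P" ?E] by simp
  have xP: "x \<in> P"
    using x by (simp add: extreme_point_of_def)
  have yQ: "y \<in> relax P S"
    using xy by (auto simp: edge_rel_def vertices_of_def extreme_point_of_def)
  have "facet_normal P F \<bullet> (y - x) \<le> 0" if "F facet_of P" "x \<in> F" for F
    using that x(2) yQ facet_normal_eq [OF P] by (auto simp: relax_def inner_diff_right)
  moreover have "x + (y - x) \<in> affine hull P"
    using yQ by (simp add: relax_def)
  ultimately obtain e where e: "0 < e" "\<And>t. 0 \<le> t \<Longrightarrow> t \<le> e \<Longrightarrow> x + t *\<^sub>R (y - x) \<in> P"
    using feasible_direction [OF P xP] by blast
  \<comment> \<open>A point of \<open>P\<close> on the edge other than \<open>x\<close>; it forces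
    the far end \<open>y'\<close> to differ from \<open>x\<close>.\<close>
  define w where "w = x + min e 1 *\<^sub>R (y - x)"
  have "w \<in> P"
    using e by (simp add: w_def)
  moreover have "w \<in> ?E"
    unfolding in_segment w_def using e by (intro exI [of _ "min e 1"]) (simp add: algebra_simps)
  ultimately have wE: "w \<in> ?E \<inter> P"
    by blast
  have "x \<in> ?E \<inter> P"
    using xP by simp
  have poly: "polyhedron (?E \<inter> P)"
    by (rule face_of_polyhedron_polyhedron [OF P EP])
  have xext: "x extreme_point_of ?E \<inter> P"
    using extreme_point_of_face [OF EP] x(1) \<open>x \<in> ?E \<inter> P\<close> by blast
  have "(y - x) \<bullet> z \<le> (y - x) \<bullet> y" if z: "z \<in> ?E \<inter> P" for z
  proof -
    obtain t where t: "0 \<le> t" "t \<le> 1" "z = (1 - t) *\<^sub>R x + t *\<^sub>R y"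
      using z by (auto simp: in_segment)
    then have "y - z = (1 - t) *\<^sub>R (y - x)"
      by (simp add: algebra_simps)
    then have "(y - x) \<bullet> (y - z) = (1 - t) * ((y - x) \<bullet> (y - x))"
      by simp
    also have "\<dots> \<ge> 0"
      using t by simp
    finally show ?thesis
      by (simp add: inner_diff_right)
  qed
  then obtain y' where y': "y' extreme_point_of ?E \<inter> P" "y' \<in> optimal_face (?E \<inter> P) (y - x)"
    using optimal_vertex_exists [OF poly xext] by blast
  have "(y - x) \<bullet> x < (y - x) \<bullet> w"
    using e \<open>x \<noteq> y\<close> by (simp add: w_def inner_add_right)
  also have "\<dots> \<le> (y - x) \<bullet> y'"
    by (rule optimal_faceD [OF y'(2) wE])
  finally have "y' \<noteq> x"
    by auto
  have y'E: "y' \<in> ?E" "y' extreme_point_of P"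
    using extreme_point_of_face [OF EP] y'(1) by auto
  show thesis
  proof (rule that)
    show "(x, y') \<in> edge_rel P"
      using edge_relI [OF EP \<open>aff_dim (?E \<inter> P) \<le> 1\<close> \<open>x \<in> ?E \<inter> P\<close>] y'(1) y'E x(1) \<open>y' \<noteq> x\<close>
      by (auto simp: extreme_point_of_def)
    assume "\<And>F. F facet_of P \<Longrightarrow> y' \<in> F \<Longrightarrow> F \<in> S"
    then have "y' extreme_point_of relax P S"
      using vertex_relax y'E by blast
    then have "y' extreme_point_of ?E"
      using extreme_point_of_face [OF E(1)] y'E by blast
    then show "y' = y"
      using \<open>y' \<noteq> x\<close> extreme_point_of_segment by metis
  qed
qed

end

definition reach :: "'a::euclidean_space set \<Rightarrow> nat \<Rightarrow> 'a \<Rightarrow> 'a set" where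
  "reach P k u = {x. \<exists>i\<le>k. (u, x) \<in> edge_rel P ^^ i}"

definition seen :: "'a::euclidean_space set \<Rightarrow> nat \<Rightarrow> 'a \<Rightarrow> 'a set set" where
  "seen P k u = {F. F facet_of P \<and> F \<inter> reach P k u \<noteq> {}}"

lemma reach_vertex:
  assumes "u extreme_point_of P" "x \<in> reach P k u"
  shows "x extreme_point_of P"
proof -
  obtain i where "(u, x) \<in> edge_rel P ^^ i"
    using assms by (auto simp: reach_def)
  then show ?thesis
    using assms(1) by (cases i) (auto simp: edge_rel_def vertices_of_def)
qed

text \<open>If the ball of radius \<open>j\<close> around \<^term>\<open>u\<close> sees at most half of the facets, then dropping all the others
  does not change \<^term>\<open>P\<close> near this ball, so distances from \<^term>\<open>u\<close> up to \<open>j\<close> are distances in a polyhedron with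
  at most half as many facets.\<close>

lemma seen_half:
  fixes P :: "'a::euclidean_space set"
  assumes P: "polyhedron P" and u: "u extreme_point_of P" and pos: "1 \<le> aff_dim P"
    and IH: "\<And>Q x y. polyhedron Q \<Longrightarrow> aff_dim Q = aff_dim P \<Longrightarrow>
      2 * card {F. F facet_of Q} \<le> card {F. F facet_of P} \<Longrightarrow>
      (x :: 'a) extreme_point_of Q \<Longrightarrow> y extreme_point_of Q \<Longrightarrow> \<exists>k\<le>B. (x, y) \<in> edge_rel Q ^^ k"
  shows "\<exists>k \<le> B + 1. card {F. F facet_of P} < 2 * card (seen P k u)"
proof -
  let ?n = "card {F. F facet_of P}"
  have fin: "finite {F. F facet_of P}"
    by (rule finite_polyhedron_facets [OF P])
  have "1 \<le> int (card {F. F facet_of P \<and> u \<in> F})"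
    using card_facets_at_vertex [OF P u] pos by linarith
  moreover have "card {F. F facet_of P \<and> u \<in> F} \<le> ?n"
    using fin by (intro card_mono) auto
  ultimately have npos: "0 < ?n"
    by linarith
  have "\<exists>i. \<exists>x\<in>F. (u, x) \<in> edge_rel P ^^ i" if F: "F facet_of P" for F
  proof -
    obtain p where "p extreme_point_of P" "p \<in> F"
      using face_has_vertex [OF P u, of F] F by (auto simp: facet_of_def)
    then show ?thesis
      using vertices_connected [OF P u] rtrancl_imp_relpow by metis
  qed
  then obtain i where i: "\<And>F. F facet_of P \<Longrightarrow> \<exists>x\<in>F. (u, x) \<in> edge_rel P ^^ i F"
    by metis
  have "F \<in> seen P (Max (i ` {F. F facet_of P})) u" if F: "F facet_of P" for F
  proof -
    have "i F \<le> Max (i ` {F. F facet_of P})"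
      using fin F by (intro Max_ge) auto
    then show ?thesis
      using i [OF F] F by (auto simp: seen_def reach_def)
  qed
  then have "seen P (Max (i ` {F. F facet_of P})) u = {F. F facet_of P}"
    by (auto simp: seen_def)
  then have "\<exists>k. ?n < 2 * card (seen P k u)"
    using npos by (intro exI [of _ "Max (i ` {F. F facet_of P})"]) simp
  then obtain k where k: "?n < 2 * card (seen P k u)" "\<And>j. j < k \<Longrightarrow> \<not> ?n < 2 * card (seen P j u)"
    using exists_least_iff [of "\<lambda>k. ?n < 2 * card (seen P k u)"] by auto
  have "k \<le> B + 1"
  proof (rule ccontr)
    assume "\<not> k \<le> B + 1"
    then obtain j where j: "k = Suc j" "B < j"
      by (cases k) auto
    let ?S = "seen P j u"
    have S: "?S \<subseteq> {F. F facet_of P}"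
      by (auto simp: seen_def)
    have half: "2 * card ?S \<le> ?n"
      using k(2) [of j] j by simp
    have "seen P k u \<noteq> ?S"
      using k(1) half by auto
    \<comment> \<open>So the last step reaches a new vertex, whose predecessor \<open>w\<close> has
      distance exactly \<open>j\<close>, more than \<open>B\<close>. This will contradict a path of
      length at most \<open>B\<close> in the relaxation.\<close>
    then have "reach P k u \<noteq> reach P j u"
      by (auto simp: seen_def)
    moreover have "reach P j u \<subseteq> reach P k u"
      using j unfolding reach_def by (auto intro: le_SucI)
    ultimately obtain x where x: "x \<in> reach P k u" "x \<notin> reach P j u"
      by blast
    then have "(u, x) \<in> edge_rel P ^^ Suc j"
      using j by (auto simp: reach_def le_Suc_eq)
    then obtain w where w: "(u, w) \<in> edge_rel P ^^ j" "(w, x) \<in> edge_rel P"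
      by auto
    have far: "(u, w) \<notin> edge_rel P ^^ m" if "m < j" for m
    proof
      assume "(u, w) \<in> edge_rel P ^^ m"
      then have "(u, x) \<in> edge_rel P ^^ Suc m"
        using w(2) by auto
      then show False
        using x(2) that unfolding reach_def by (metis (mono_tags, lifting) Suc_leI mem_Collect_eq)
    qed
    let ?Q = "relax P ?S"
    have used: "F \<in> ?S" if "x \<in> reach P j u" "F facet_of P" "x \<in> F" for x F
      using that by (auto simp: seen_def)
    have inQ: "x extreme_point_of ?Q" if "x \<in> reach P j u" for x
      using vertex_relax [OF P S reach_vertex [OF u that]] used [OF that] by blast
    \<comment> \<open>Paths in the relaxation pull back edge by edge: the end of the corresponding
      edge of \<open>P\<close> is still in the ball of radius \<open>j\<close>, so its facets are
      retained and it is the same vertex.\<close>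
    have transfer: "(u, y) \<in> edge_rel P ^^ m" if "(u, y) \<in> edge_rel ?Q ^^ m" "m \<le> j" for y m
      using that
    proof (induction m arbitrary: y)
      case (Suc m)
      then obtain x where x: "(u, x) \<in> edge_rel ?Q ^^ m" "(x, y) \<in> edge_rel ?Q"
        by auto
      have xm: "(u, x) \<in> edge_rel P ^^ m"
        using Suc.IH [OF x(1)] Suc.prems by simp
      moreover have "m \<le> j"
        using Suc.prems by simp
      ultimately have xr: "x \<in> reach P j u"
        unfolding reach_def by blast
      obtain y' where y': "(x, y') \<in> edge_rel P" "(\<And>F. F facet_of P \<Longrightarrow> y' \<in> F \<Longrightarrow> F \<in> ?S) \<Longrightarrow> y' = y"
        using edge_relax [OF P S reach_vertex [OF u xr] used [OF xr] x(2)] by metis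
      have uy': "(u, y') \<in> edge_rel P ^^ Suc m"
        using xm y'(1) by auto
      then have "y' \<in> reach P j u"
        using Suc.prems unfolding reach_def by blast
      then have "y' = y"
        using y'(2) used by blast
      then show ?case
        using uy' by simp
    qed auto
    have "u \<in> reach P j u" "w \<in> reach P j u"
      using w by (auto simp: reach_def intro: exI [of _ 0])
    then have "u extreme_point_of ?Q" "w extreme_point_of ?Q"
      using inQ by blast+
    moreover have "2 * card {F. F facet_of ?Q} \<le> ?n"
      using card_facets_relax [OF P S] half by linarith
    ultimately obtain m where m: "m \<le> B" "(u, w) \<in> edge_rel ?Q ^^ m"
      using IH [OF polyhedron_relax [OF P S] aff_dim_relax [OF P S]] by blast
    then have "(u, w) \<in> edge_rel P ^^ m"
      using transfer j by simp
    then show False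
      using far m j by simp
  qed
  then show ?thesis
    using k(1) by blast
qed

lemma path_in_facet:
  assumes "F facet_of P" "(x, y) \<in> edge_rel F ^^ k"
  shows "(x, y) \<in> edge_rel P ^^ k"
proof -
  have "edge_rel F \<subseteq> edge_rel P"
    using edge_rel_face [OF facet_of_imp_face_of [OF assms(1)]] by blast
  then show ?thesis
    using assms(2)
  proof (induction k arbitrary: y)
    case (Suc k)
    then show ?case
      by (meson relpow_Suc_E relpow_Suc_I subsetD)
  qed auto
qed

lemma relpow_sym: "sym R \<Longrightarrow> (x, y) \<in> R ^^ k \<Longrightarrow> (y, x) \<in> R ^^ k"
proof (induction k arbitrary: y)
  case (Suc k)
  then show ?case
    by (meson relpow_Suc_E relpow_Suc_I2 symD)
qed auto

text \<open>Balls of radius at most \<open>B + 1\<close> around \<open>u\<close> and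
  \<open>v\<close> each see more than half of the facets, so some facet meets both balls, and a path
  inside it closes the gap.\<close>

lemma kalai_kleitman:
  fixes P :: "'a::euclidean_space set"
  assumes P: "polyhedron P" and pos: "1 \<le> aff_dim P"
    and u: "u extreme_point_of P" and v: "v extreme_point_of P"
    and facets: "\<And>F x y. F facet_of P \<Longrightarrow> x extreme_point_of F \<Longrightarrow> y extreme_point_of F \<Longrightarrow>
      \<exists>k\<le>A. (x, y) \<in> edge_rel F ^^ k"
    and IH: "\<And>Q x y. polyhedron Q \<Longrightarrow> aff_dim Q = aff_dim P \<Longrightarrow>
      2 * card {F. F facet_of Q} \<le> card {F. F facet_of P} \<Longrightarrow>
      (x :: 'a) extreme_point_of Q \<Longrightarrow> y extreme_point_of Q \<Longrightarrow> \<exists>k\<le>B. (x, y) \<in> edge_rel Q ^^ k"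
  shows "\<exists>k \<le> A + 2 * B + 2. (u, v) \<in> edge_rel P ^^ k"
proof -
  let ?n = "card {F. F facet_of P}"
  obtain i where i: "i \<le> B + 1" "?n < 2 * card (seen P i u)"
    using seen_half [OF P u pos IH] by blast
  obtain j where j: "j \<le> B + 1" "?n < 2 * card (seen P j v)"
    using seen_half [OF P v pos IH] by blast
  have fin: "finite {F. F facet_of P}"
    by (rule finite_polyhedron_facets [OF P])
  have sub: "seen P k x \<subseteq> {F. F facet_of P}" for k x
    by (auto simp: seen_def)
  have "seen P i u \<inter> seen P j v \<noteq> {}"
  proof
    assume "seen P i u \<inter> seen P j v = {}"
    then have "card (seen P i u \<union> seen P j v) = card (seen P i u) + card (seen P j v)"
      using finite_subset [OF sub fin] by (intro card_Un_disjoint) auto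
    moreover have "card (seen P i u \<union> seen P j v) \<le> ?n"
      using sub by (intro card_mono fin) auto
    ultimately show False
      using i j by linarith
  qed
  then obtain F x y where F: "F facet_of P" "x \<in> F" "y \<in> F" "x \<in> reach P i u" "y \<in> reach P j v"
    by (auto simp: seen_def)
  have "x extreme_point_of F" "y extreme_point_of F"
    using F reach_vertex u v extreme_point_of_face [OF facet_of_imp_face_of [OF F(1)]] by blast+
  then obtain k where k: "k \<le> A" "(x, y) \<in> edge_rel P ^^ k"
    using facets [OF F(1)] path_in_facet [OF F(1)] by blast
  obtain i' j' where ij: "i' \<le> i" "(u, x) \<in> edge_rel P ^^ i'" "j' \<le> j" "(v, y) \<in> edge_rel P ^^ j'"
    using F by (auto simp: reach_def)
  have "sym (edge_rel P)"
    using edge_rel_sym by (auto intro: symI)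
  then have "(y, v) \<in> edge_rel P ^^ j'"
    using ij(4) by (rule relpow_sym)
  then have "(u, v) \<in> edge_rel P ^^ (i' + k + j')"
    unfolding relpow_add using ij(2) k(2) by (intro relcompI)
  moreover have "i' + k + j' \<le> A + 2 * B + 2"
    using i j ij k by linarith
  ultimately show ?thesis
    by blast
qed

section \<open>The bound\<close>

text \<open>For \<open>n < 4\<close> the logarithm is negative, or \<open>log 2 0 = 0\<close>, and the value is \<open>0\<close>.\<close>

definition quarter_log :: "nat \<Rightarrow> nat" where
  "quarter_log n = nat \<lfloor>log 2 (real n / 4)\<rfloor>"

definition diameter_bound :: "nat \<Rightarrow> nat \<Rightarrow> nat" where
  "diameter_bound d n = (n - 3) * ((quarter_log n + (d - 3)) choose quarter_log n)"

lemma quarter_log_mono: "m \<le> n \<Longrightarrow> quarter_log m \<le> quarter_log n"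
  unfolding quarter_log_def
proof (cases "m = 0")
  case False
  assume "m \<le> n"
  then have "log 2 (real m / 4) \<le> log 2 (real n / 4)"
    using False by simp
  then show "nat \<lfloor>log 2 (real m / 4)\<rfloor> \<le> nat \<lfloor>log 2 (real n / 4)\<rfloor>"
    by (intro nat_mono floor_mono)
qed (simp add: log_def)

lemma quarter_log_bounds:
  assumes "4 \<le> n"
  shows "4 * 2 ^ quarter_log n \<le> n" "n < 8 * 2 ^ quarter_log n"
proof -
  define x k where "x = log 2 (real n / 4)" and "k = quarter_log n"
  have "0 \<le> x"
    using assms by (simp add: x_def)
  then have k: "real k \<le> x" "x < real k + 1"
    by (auto simp: k_def quarter_log_def x_def of_nat_nat)
  have "2 powr real k \<le> real n / 4"
    using k(1) assms by (simp add: x_def le_log_iff)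
  then have "real (4 * 2 ^ k) \<le> real n"
    by (simp add: powr_realpow)
  then show "4 * 2 ^ quarter_log n \<le> n"
    unfolding k_def of_nat_le_iff .
  have "real n / 4 < 2 powr (real k + 1)"
    using k(2) assms by (simp add: x_def log_less_iff)
  then have "real n < real (8 * 2 ^ k)"
    by (simp add: powr_add powr_realpow)
  then show "n < 8 * 2 ^ quarter_log n"
    unfolding k_def of_nat_less_iff .
qed

lemma binomial_diagonal_mono:
  assumes "j \<le> k"
  shows "(j + e) choose j \<le> (k + e) choose k"
proof -
  have "(j + e) choose j = (j + e) choose e" "(k + e) choose k = (k + e) choose e"
    using binomial_symmetric [of e "j + e"] binomial_symmetric [of e "k + e"] by simp_all
  then show ?thesis
    using assms by (simp add: binomial_right_mono)
qed

lemma diameter_bound_mono: "m \<le> n \<Longrightarrow> diameter_bound d m \<le> diameter_bound d n"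
  unfolding diameter_bound_def by (intro mult_le_mono binomial_diagonal_mono quarter_log_mono) auto

lemma diameter_bound_dim_mono: "c \<le> d \<Longrightarrow> diameter_bound c n \<le> diameter_bound d n"
  unfolding diameter_bound_def by (intro mult_le_mono binomial_right_mono) auto

text \<open>By Pascal's rule the binomial splits into \<open>x\<close>, which covers the lower
  dimension, and \<open>y\<close>, which covers the halved number of facets. The 2 is absorbed
  because \<open>2 * (n div 2 - 3) + 2\<close> is at most \<open>n - 3\<close>.\<close>

lemma diameter_bound_recursion:
  assumes d: "4 \<le> d" and n: "8 \<le> n"
  shows "diameter_bound (d - 1) (n - 1) + 2 * diameter_bound d (n div 2) + 2 \<le> diameter_bound d n"
proof -
  define e where "e = d - 4"
  have d_eq: "d - 3 = Suc e" "d - 1 - 3 = e"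
    using d by (simp_all add: e_def)
  have "8 * 2 ^ quarter_log (n div 2) \<le> n"
    using quarter_log_bounds(1) [of "n div 2"] n by linarith
  also have "n < 8 * 2 ^ quarter_log n"
    using quarter_log_bounds(2) [of n] n by simp
  finally have "(2 :: nat) ^ quarter_log (n div 2) < 2 ^ quarter_log n"
    by simp
  then have "quarter_log (n div 2) < quarter_log n"
    by simp
  then obtain j where j: "quarter_log n = Suc j" "quarter_log (n div 2) \<le> j"
    by (cases "quarter_log n") auto
  define x y where "x = (Suc j + e) choose Suc j" and "y = (Suc j + e) choose j"
  have y: "1 \<le> y"
    using zero_less_binomial [of j "Suc j + e"] unfolding y_def by linarith
  have "diameter_bound d n = (n - 3) * (x + y)"
    by (simp add: diameter_bound_def d_eq j x_def y_def)
  moreover have "diameter_bound (d - 1) (n - 1) \<le> (n - 3) * x"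
    unfolding diameter_bound_def d_eq x_def j(1) [symmetric]
    by (intro mult_le_mono binomial_diagonal_mono quarter_log_mono) auto
  moreover have "diameter_bound d (n div 2) \<le> (n div 2 - 3) * y"
  proof -
    have "(quarter_log (n div 2) + Suc e) choose quarter_log (n div 2) \<le> (j + Suc e) choose j"
      by (rule binomial_diagonal_mono [OF j(2)])
    then show ?thesis
      unfolding diameter_bound_def d_eq y_def by simp
  qed
  moreover have "2 * ((n div 2 - 3) * y) + 2 \<le> (n - 3) * y"
  proof -
    have "2 * (n div 2 - 3) + 2 \<le> n - 3"
      using n by linarith
    then have "(2 * (n div 2 - 3) + 2) * y \<le> (n - 3) * y"
      by (rule mult_le_mono1)
    moreover have "2 \<le> 2 * y"
      using y by simp
    ultimately show ?thesis
      by (simp add: algebra_simps)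
  qed
  ultimately show ?thesis
    unfolding distrib_left by linarith
qed

text \<open>If two vertices share no facet, then there are at least \<open>2 * Suc d \<ge> 8\<close> facets and the recursion
  applies.\<close>

lemma polyhedron_diameter:
  fixes P :: "'a::euclidean_space set"
  assumes "3 \<le> d" "polyhedron P" "aff_dim P = int d"
    and "u extreme_point_of P" "v extreme_point_of P"
  shows "\<exists>k \<le> diameter_bound d (card {F. F facet_of P}). (u, v) \<in> edge_rel P ^^ k"
  using assms
proof (induction d arbitrary: P u v rule: nat_induct_at_least)
  case base
  obtain k where "(u, v) \<in> edge_rel P ^^ k" "k + 3 \<le> card {F. F facet_of P}"
    using diameter_dim3 [of P u v] base by auto
  then show ?case
    \<comment> \<open>For dimension 3 the binomial coefficient is 1.\<close>
    by (intro exI [of _ k]) (simp add: diameter_bound_def)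
next
  case (Suc d)
  note dim_IH = Suc.IH
  show ?case
    using Suc.prems
  proof (induction "card {F. F facet_of P}" arbitrary: P u v rule: less_induct)
    case less
    note P = less.prems(1) and dimP = less.prems(2) and u = less.prems(3) and v = less.prems(4)
    let ?n = "card {F. F facet_of P}"
    have fin: "finite {F. F facet_of P}"
      by (rule finite_polyhedron_facets [OF P])
    have facet_path: "\<exists>k \<le> diameter_bound d (?n - 1). (x, y) \<in> edge_rel F ^^ k"
      if F: "F facet_of P" and xy: "x extreme_point_of F" "y extreme_point_of F" for F x y
    proof -
      have "polyhedron F"
        using face_of_polyhedron_polyhedron [OF P facet_of_imp_face_of [OF F]] .
      moreover have "aff_dim F = int d"
        using F dimP by (simp add: facet_of_def)
      ultimately obtain k where k: "k \<le> diameter_bound d (card {G. G facet_of F})" "(x, y) \<in> edge_rel F ^^ k"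
        using dim_IH xy by blast
      have "card {G. G facet_of F} \<le> ?n - 1"
        using card_facets_of_facet [OF P F] by linarith
      then show ?thesis
        using k diameter_bound_mono order_trans by blast
    qed
    show ?case
    proof (cases "\<exists>F. F facet_of P \<and> u \<in> F \<and> v \<in> F")
      case True
      then obtain F where F: "F facet_of P" "u \<in> F" "v \<in> F"
        by blast
      have "u extreme_point_of F" "v extreme_point_of F"
        using F u v extreme_point_of_face [OF facet_of_imp_face_of [OF F(1)]] by blast+
      then obtain k where k: "k \<le> diameter_bound d (?n - 1)" "(u, v) \<in> edge_rel F ^^ k"
        using facet_path [OF F(1)] by blast
      have "diameter_bound d (?n - 1) \<le> diameter_bound d ?n"
        by (rule diameter_bound_mono) simp
      also have "\<dots> \<le> diameter_bound (Suc d) ?n"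
        by (rule diameter_bound_dim_mono) simp
      finally show ?thesis
        using k path_in_facet [OF F(1)] order_trans by blast
    next
      case False
      let ?U = "{F. F facet_of P \<and> u \<in> F}" and ?V = "{F. F facet_of P \<and> v \<in> F}"
      have "finite ?U" "finite ?V"
        using fin by (auto intro: finite_subset [OF _ fin])
      moreover have "?U \<inter> ?V = {}"
        using False by blast
      ultimately have "card (?U \<union> ?V) = card ?U + card ?V"
        by (rule card_Un_disjoint)
      moreover have "card (?U \<union> ?V) \<le> ?n"
        by (intro card_mono fin) auto
      moreover have "Suc d \<le> card ?U" "Suc d \<le> card ?V"
        using card_facets_at_vertex [OF P u] card_facets_at_vertex [OF P v] dimP by linarith+
      ultimately have n8: "8 \<le> ?n"
        using \<open>3 \<le> d\<close> by linarith
      have half: "\<exists>k \<le> diameter_bound (Suc d) (?n div 2). (x, y) \<in> edge_rel Q ^^ k"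
        if Q: "polyhedron Q" "aff_dim Q = aff_dim P" "2 * card {F. F facet_of Q} \<le> ?n"
          and xy: "x extreme_point_of Q" "y extreme_point_of Q" for Q :: "'a set" and x y
      proof -
        have "card {F. F facet_of Q} < ?n"
          using Q(3) n8 by linarith
        then obtain k where k: "k \<le> diameter_bound (Suc d) (card {F. F facet_of Q})" "(x, y) \<in> edge_rel Q ^^ k"
          using less.hyps Q dimP xy by metis
        have "card {F. F facet_of Q} \<le> ?n div 2"
          using Q(3) by linarith
        then show ?thesis
          using k diameter_bound_mono order_trans by blast
      qed
      have "1 \<le> aff_dim P"
        using dimP by simp
      then obtain k where k: "k \<le> diameter_bound d (?n - 1) + 2 * diameter_bound (Suc d) (?n div 2) + 2"
          "(u, v) \<in> edge_rel P ^^ k"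
        using kalai_kleitman [OF P _ u v facet_path half] by blast
      moreover have "diameter_bound d (?n - 1) + 2 * diameter_bound (Suc d) (?n div 2) + 2
          \<le> diameter_bound (Suc d) ?n"
        using diameter_bound_recursion [of "Suc d" ?n] n8 \<open>3 \<le> d\<close> by simp
      ultimately show ?thesis
        using order_trans by blast
    qed
  qed
qed

theorem theorem6p4:
  fixes d n :: nat
  assumes "n \<ge> d" and "d \<ge> 3"
  shows "Delta_u TYPE('a::euclidean_space) d n
    \<le> enat ((n - 3) *
        ((nat \<lfloor>log 2 (real n / 4)\<rfloor> + d - 3) choose nat \<lfloor>log 2 (real n / 4)\<rfloor>))"
proof -
  have bound: "(n - 3) * ((nat \<lfloor>log 2 (real n / 4)\<rfloor> + d - 3) choose nat \<lfloor>log 2 (real n / 4)\<rfloor>)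
      = diameter_bound d n"
    using assms(2) by (simp add: diameter_bound_def quarter_log_def)
  have "graph_dist P u v \<le> enat (diameter_bound d n)"
    if P: "polyhedron P" "aff_dim P = int d" "card {F. F facet_of P} = n"
      and uv: "u \<in> vertices_of P" "v \<in> vertices_of P" for P :: "'a set" and u v
  proof -
    obtain k where k: "k \<le> diameter_bound d n" "(u, v) \<in> edge_rel P ^^ k"
      using polyhedron_diameter [OF assms(2) P(1,2), of u v] uv P(3) by (auto simp: vertices_of_def)
    have "graph_dist P u v \<le> enat k"
      unfolding graph_dist_def using k(2) by (intro INF_lower) simp
    also have "\<dots> \<le> enat (diameter_bound d n)"
      using k(1) by simp
    finally show ?thesis .
  qed
  then show ?thesis
    unfolding bound Delta_u_def graph_diameter_def by (auto intro!: SUP_least)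
qed

end
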